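(* Let $\lambda=\Lambda_0$. In each of the types $E_6^{(2)}$ and $F_4^{(1)}$, the maps $\tilde E_i,\tilde F_i:\mathcal Z(\lambda)\to\mathcal Z(\lambda)\cup\{0\}$, $\varepsilon_i,\varphi_i:\mathcal Z(\lambda)\to\mathbb Z\cup\{-\infty\}$ $(i\in I)$ and $\mathrm{wt}:\mathcal Z(\lambda)\to P$ (defined by the signature rule, the numbers of $-$'s and $+$'s in the $i$-signature, and $\mathrm{wt}(Y)=\lambda-\sum_{i\in I}k_i\alpha_i$) endow the set $\mathcal Z(\lambda)$ of proper Young walls with the structure of an affine crystal.
   Context: **Cartan data.** $I=\{0,1,2,3,4\}$, $a_{ij}=\langle h_i,\alpha_j\rangle$, $a_{ii}=2$; the nonzero off-diagonal entries are: for $E_6^{(2)}$, $a_{01}=a_{10}=a_{12}=a_{21}=-1$, $a_{23}=-2$, $a_{32}=-1$, $a_{34}=a_{43}=-1$; for $F_4^{(1)}$, $a_{01}=a_{10}=a_{12}=a_{21}=-1$, $a_{23}=-1$, $a_{32}=-2$, $a_{34}=a_{43}=-1$. $P$ is the affine weight lattice. **Affine crystal.** A set $\mathcal B$ with maps $\mathrm{wt}:\mathcal B\to P$, $\tilde e_i,\tilde f_i:\mathcal B\to\mathcal B\cup\{0\}$, $\varepsilon_i,\varphi_i:\mathcal B\to\mathbb Z\cup\{-\infty\}$ such that: $\varphi_i(b)=\varepsilon_i(b)+\langle h_i,\mathrm{wt}(b)\rangle$; if $\tilde e_ib\in\mathcal B$ then $\mathrm{wt}(\tilde e_ib)=\mathrm{wt}(b)+\alpha_i$,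 $\varepsilon_i(\tilde e_ib)=\varepsilon_i(b)-1$, $\varphi_i(\tilde e_ib)=\varphi_i(b)+1$; if $\tilde f_ib\in\mathcal B$ then $\mathrm{wt}(\tilde f_ib)=\mathrm{wt}(b)-\alpha_i$, $\varepsilon_i(\tilde f_ib)=\varepsilon_i(b)+1$, $\varphi_i(\tilde f_ib)=\varphi_i(b)-1$; $\tilde f_ib=b'$ iff $b=\tilde e_ib'$; and $\varphi_i(b)=-\infty$ implies $\tilde e_ib=\tilde f_ib=0$. **Young column patterns.** A pattern is an infinite vertical stack of colored blocks arranged in rows indexed by $\mathbb Z$ from bottom to top. It is invariant under the shift by four rows combined with the $180^\circ$ rotation around the vertical axis; this symmetry $\sigma$ sends a block with index $m$ to the block with the same letter and index $m+1$. "$x$ on $y$" means block $x$ rests on block $y$ (so $y$ must be present for there to be no empty space below $x$); $i$-block means a block of color $i$. *Type $E_6^{(2)}$*, for every $m\in\mathbb Z$: row $4m$: $c_m$ (color 3), $a_m$ (color 1); row $4m+1$: $b_m,b'_m$ (color 2); row $4m+2$: $a'_m$ (color 1), $c'_m$ (color 3); row $4m+3$: $z_m$ (color 0), $b''_m$ (color 2), $d_m$ (color 4). Support: $b_m$ on $c_m$; $b'_m$ on $c_m,a_m$; $a'_m$ on $b_m$; $c'_m$ on $b_m,b'_m$; $z_m$ on $a'_m$; $b''_m$ on $a'_m,c'_m$; $d_m$ on $c'_m$; $a_{m+1}$ on $z_m,b''_m$; $c_{m+1}$ on $b''_m,d_m$. *Type $F_4^{(1)}$*, for every $m\in\mathbb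 Z$: row $4m$: $c^1_m$ (color 3), $d^1_m$ (color 4), $a^1_m$ (color 1); row $4m+1$: $c^2_m$ (color 3), $b^1_m$ (color 2); row $4m+2$: $b^2_m$ (color 2), $c^3_m$ (color 3); row $4m+3$ (a double-height row): $a^2_m$ (color 1), $c^4_m$ (color 3), $d^2_m$ (color 4), $z_m$ (color 0), $b^3_m$ (color 2). Support: $c^2_m$ on $c^1_m,d^1_m$; $b^1_m$ on $c^1_m,a^1_m$; $b^2_m$ on $c^2_m$; $c^3_m$ on $b^1_m$; $a^2_m$ on $b^2_m$; $c^4_m$ on $b^2_m,c^3_m$; $d^2_m$ on $c^3_m$; $z_m$ on $a^2_m$; $b^3_m$ on $a^2_m,c^4_m$; $c^1_{m+1}$ on $b^3_m,c^4_m,d^2_m$; $d^1_{m+1}$ on $c^4_m,d^2_m$; $a^1_{m+1}$ on $z_m,b^3_m$. **Young columns.** A pre-Young column is a nonempty set of blocks of the pattern whose height is bounded above and which contains, with any block, all blocks it rests on. A block of it is free if removing it leaves a pre-Young column. A pre-Young column is exceptional if its highest nonempty row contains precisely one free $2$-block and the column contains a free $1$-block (up to $\sigma$ the only one is: all blocks of index $\le0$ together with $a_1,c_1,b_1$ in type $E_6^{(2)}$, and with $c^1_1,d^1_1,a^1_1,c^2_1,b^2_1$ in type $F_4^{(1)}$). A Young column is a non-exceptional pre-Young column. Two Young columns are equivalent if they are related by vertical shift and $180^\circ$ rotation, i.e. by a power of $\sigma$. Let $C$ (resp. $C'$) be the set of equivalence classes in type $E_6^{(2)}$ (resp. $F_4^{(1)}$).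 Some classes have names. *Type $E_6^{(2)}$:* let $D$ be the set of all blocks of index $\le-1$ and $c_0,a_0,b_0,b'_0,a'_0,c'_0,b''_0$; $y_\emptyset$ is the class of $D\cup\{d_0,c_1,b_1,a'_1,z_1\}$, $y_{r_1}$ of $D\cup\{z_0,d_0,c_1,b_1,a'_1\}$, $y_{r_2}$ of $D\cup\{z_0,a_1,b'_1,d_0,c_1\}$. *Type $F_4^{(1)}$:* let $D$ be the set of all blocks of index $\le-1$ and all blocks of index $0$ except $z_0,d^2_0$; $y_\emptyset$ is the class of $D\cup\{d^2_0,c^1_1,d^1_1,c^2_1,b^2_1,a^2_1,z_1\}$, $y_{r_1}$ of $D\cup\{z_0,d^2_0,c^1_1,d^1_1,c^2_1,b^2_1,a^2_1\}$, $y_{r_2}$ of $D\cup\{z_0,a^1_1,b^1_1,d^2_0,c^1_1,d^1_1,c^2_1\}$, $y_{r_3}$ of $D\cup\{z_0,a^1_1,b^1_1,c^3_1,d^2_0,c^1_1,d^1_1\}$, $y_{r_4}$ of $D\cup\{z_0,a^1_1,b^1_1,c^3_1,d^2_1,d^2_0,c^1_1\}$. **Crystal operators on Young columns.** An $i$-block in a Young column $y$ is removable if removing it gives a Young column; an $i$-block of the pattern not in $y$ is addable if adding it gives a Young column. $\tilde f_i$ adds an addable $i$-block if one exists (the higher one if there are two), else gives $0$; moreover $\tilde f_i(y)=0$ if $y\in y_{r_j}$, $j\ne i$. $\tilde e_i$ removes a removable $i$-block if one exists (the lower one if there are two), else gives $0$; moreover $\tilde e_i(y)=0$ if $y\in y_{r_j}$,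 $j\neq i$. $\varphi_i(y)=\max\{n:\tilde f_i^ny\ne0\}$, $\varepsilon_i(y)=\max\{n:\tilde e_i^ny\neq0\}$. These descend to $C$ and $C'$, making them classical crystals isomorphic to level $1$ perfect crystals. **Energy function.** On tensor products, $\tilde f_i(a\otimes b)=\tilde f_ia\otimes b$ if $\varphi_i(a)>\varepsilon_i(b)$ and $a\otimes\tilde f_ib$ if $\varphi_i(a)\le\varepsilon_i(b)$; $\tilde e_i(a\otimes b)=\tilde e_ia\otimes b$ if $\varphi_i(a)\ge\varepsilon_i(b)$ and $a\otimes\tilde e_ib$ otherwise. $H:C\otimes C\to\mathbb Z$ (resp. $H':C'\otimes C'\to\mathbb Z$) is the unique function with value $0$ at $y_\emptyset\otimes y_\emptyset$ such that, whenever $\tilde f_i(a\otimes b)\neq0$, $H(\tilde f_i(a\otimes b))-H(a\otimes b)$ equals $0$ if $i\ne0$, $-1$ if $i=0$ and $\varphi_0(a)>\varepsilon_0(b)$, and $+1$ if $i=0$ and $\varphi_0(a)\le\varepsilon_0(b)$ (and likewise for $H'$). **Young walls.** The Young wall pattern consists of copies of the Young column pattern, all at the same height and orientation, placed in columns $k=0,1,2,\dots$ from right to left. Fix a Young column $g\in y_\emptyset$ (the ground-state column); the ground-state wall $Y_\lambda$ has $g$ in every column. A Young wall $Y=(\dots,y_2,y_1,y_0)$ is a set of blocks in the Young wall pattern differing from $Y_\lambda$ in finitely many blocks and such that each column $y_k$ is a Young column. $|y_k|_0$ is the number of $0$-blocks in $y_k\setminus g$ minus that in $g\setminus y_k$.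 A Young wall is proper if $H(y_{k+1}\otimes y_k)+|y_{k+1}|_0-|y_k|_0\le0$ for all $k\ge0$ (with $H'$ in place of $H$ in type $F_4^{(1)}$; classes of columns are inserted in $H,H'$). $\mathcal Z(\lambda)$ is the set of proper Young walls. **Structure maps.** The $i$-signature of a Young column $y$ is $\varepsilon_i(y)$ copies of $-$ followed by $\varphi_i(y)$ copies of $+$. For a Young wall $Y$, concatenate $\cdots\mathrm{sign}_i(y_2)\,\mathrm{sign}_i(y_1)\,\mathrm{sign}_i(y_0)$ and cancel successively every $+-$ pair; the result (finitely many $-$'s followed by finitely many $+$'s) is $\mathrm{sign}_i(Y)$. $\tilde E_iY$ applies $\tilde e_i$ to the column containing the rightmost $-$ of $\mathrm{sign}_i(Y)$ ($0$ if there is none); $\tilde F_iY$ applies $\tilde f_i$ to the column containing the leftmost $+$ ($0$ if there is none). $\varepsilon_i(Y)$ and $\varphi_i(Y)$ are the numbers of $-$'s and $+$'s in $\mathrm{sign}_i(Y)$. $\mathrm{wt}(Y)=\lambda-\sum_ik_i\alpha_i$, where $k_i$ is the (signed) difference in the number of $i$-blocks between $Y$ and the ground-state wall. *)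

theory Defs
  imports Complex_Main "HOL-Library.Extended" "HOL-Library.Function_Algebras"
    "HOL-Library.Product_Plus"
begin

section \<open>Cartan data and affine crystals\<close>

datatype idx = I0 | I1 | I2 | I3 | I4

instance idx :: finite
proof
  have "(UNIV :: idx set) = {I0, I1, I2, I3, I4}"
    by (auto intro: idx.exhaust)
  then show "finite (UNIV :: idx set)"
    by (metis finite.emptyI finite.insertI)
qed

definition dynkin_edge :: "idx \<Rightarrow> idx \<Rightarrow> bool" where
  "dynkin_edge i j \<longleftrightarrow>
     (i, j) \<in> {(I0, I1), (I1, I0), (I1, I2), (I2, I1), (I2, I3), (I3, I2), (I3, I4), (I4, I3)}"

definition cartan_E62 :: "idx \<Rightarrow> idx \<Rightarrow> int" where
  "cartan_E62 i j =
     (if i = j then 2 else if (i, j) = (I2, I3) then -2 else if dynkin_edge i j then -1 else 0)"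

definition cartan_F41 :: "idx \<Rightarrow> idx \<Rightarrow> int" where
  "cartan_F41 i j =
     (if i = j then 2 else if (i, j) = (I3, I2) then -2 else if dynkin_edge i j then -1 else 0)"

text \<open>
  The affine weight lattice is the free abelian group on the fundamental weights and the null
  root \<open>\<delta>\<close>. The pair \<open>(c, n)\<close> stands for the weight with coefficients \<open>c i\<close> at
  \<open>\<Lambda> i\<close> and \<open>n\<close> at \<open>\<delta>\<close>; equivalently, \<open>c i\<close> is the pairing with \<open>h i\<close> and \<open>n\<close> the pairing
  with the scaling element \<open>d\<close>. In both types \<open>\<delta>\<close> has coefficient 1 at the simple root 0, so
  \<open>\<delta>\<close> and the simple root 0 both pair to 1 with \<open>d\<close>.
\<close>

type_synonym weight = "(idx \<Rightarrow> int) \<times> int"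

definition fund_weight :: "idx \<Rightarrow> weight" where
  "fund_weight i = ((\<lambda>j. if j = i then 1 else 0), 0)"

definition simple_root :: "(idx \<Rightarrow> idx \<Rightarrow> int) \<Rightarrow> idx \<Rightarrow> weight" where
  "simple_root A j = ((\<lambda>i. A i j), if j = I0 then 1 else 0)"

definition coroot_pairing :: "idx \<Rightarrow> weight \<Rightarrow> int" where
  "coroot_pairing i w = fst w i"

definition int_scale :: "int \<Rightarrow> weight \<Rightarrow> weight" where
  "int_scale n w = ((\<lambda>i. n * fst w i), n * snd w)"

text \<open>
  The extra element 0 is \<^term>\<open>None\<close>. The set of integers together with minus infinity is
  \<^typ>\<open>int extended\<close> without \<^term>\<open>Pinf\<close>.
\<close>

definition affine_crystal ::
  "(idx \<Rightarrow> idx \<Rightarrow> int) \<Rightarrow> 'b set \<Rightarrow> ('b \<Rightarrow> weight) \<Rightarrow> (idx \<Rightarrow> 'b \<Rightarrow> 'b option) \<Rightarrow>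
   (idx \<Rightarrow> 'b \<Rightarrow> 'b option) \<Rightarrow> (idx \<Rightarrow> 'b \<Rightarrow> int extended) \<Rightarrow> (idx \<Rightarrow> 'b \<Rightarrow> int extended) \<Rightarrow> bool"
where
  "affine_crystal A B wt e f eps phi \<longleftrightarrow>
     (\<forall>i. \<forall>b\<in>B.
        (\<forall>b'. e i b = Some b' \<longrightarrow> b' \<in> B) \<and>
        (\<forall>b'. f i b = Some b' \<longrightarrow> b' \<in> B) \<and>
        eps i b \<noteq> Pinf \<and> phi i b \<noteq> Pinf \<and>
        phi i b = eps i b + Fin (coroot_pairing i (wt b)) \<and>
        (\<forall>b'. e i b = Some b' \<longrightarrow>
           wt b' = wt b + simple_root A i \<and> eps i b' = eps i b - Fin 1 \<and> phi i b' = phi i b + Fin 1) \<and>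
        (\<forall>b'. f i b = Some b' \<longrightarrow>
           wt b' = wt b - simple_root A i \<and> eps i b' = eps i b + Fin 1 \<and> phi i b' = phi i b - Fin 1) \<and>
        (\<forall>b'\<in>B. f i b = Some b' \<longleftrightarrow> e i b' = Some b) \<and>
        (phi i b = Minf \<longrightarrow> e i b = None \<and> f i b = None))"

section \<open>Young column patterns\<close>

text \<open>
  A block \<open>(l, m)\<close> has letter \<open>l\<close> and index \<open>m\<close>, so that \<open>\<sigma>\<close> raises the index by one. By
  this symmetry a pattern is given by the data of the blocks of index 0: \<open>lrow l\<close> is the row of
  \<open>(l, 0)\<close>, and \<open>lsupp l\<close> is the set of blocks on which \<open>(l, 0)\<close> rests. The field
  \<open>rep_empty\<close> is a representative of the class \<open>y\<^sub>\<emptyset>\<close>, and \<open>rep_r j\<close> one of the class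
  \<open>y\<^bsub>r\<^sub>j\<^esub>\<close>, or \<^term>\<open>None\<close> if there is no such class.
\<close>

type_synonym 'l block = "'l \<times> int"
type_synonym 'l column = "'l block set"

record 'l pattern =
  cartan :: "idx \<Rightarrow> idx \<Rightarrow> int"
  lcolor :: "'l \<Rightarrow> idx"
  lrow :: "'l \<Rightarrow> int"
  lsupp :: "'l \<Rightarrow> 'l block set"
  rep_empty :: "'l column"
  rep_r :: "idx \<Rightarrow> 'l column option"

definition color :: "'l pattern \<Rightarrow> 'l block \<Rightarrow> idx" where
  "color T x = lcolor T (fst x)"

definition row :: "'l pattern \<Rightarrow> 'l block \<Rightarrow> int" where
  "row T x = 4 * snd x + lrow T (fst x)"

definition rests_on :: "'l pattern \<Rightarrow> 'l block \<Rightarrow> 'l block \<Rightarrow> bool" where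
  "rests_on T x y \<longleftrightarrow> (fst y, snd y - snd x) \<in> lsupp T (fst x)"

subsection \<open>The pattern of type $E_6^{(2)}$\<close>

datatype e_letter = Ea | Ea' | Eb | Eb' | Eb'' | Ec | Ec' | Ed | Ez

fun e_color :: "e_letter \<Rightarrow> idx" where
  "e_color Ec = I3" | "e_color Ea = I1"
| "e_color Eb = I2" | "e_color Eb' = I2"
| "e_color Ea' = I1" | "e_color Ec' = I3"
| "e_color Ez = I0" | "e_color Eb'' = I2" | "e_color Ed = I4"

fun e_row :: "e_letter \<Rightarrow> int" where
  "e_row Ec = 0" | "e_row Ea = 0"
| "e_row Eb = 1" | "e_row Eb' = 1"
| "e_row Ea' = 2" | "e_row Ec' = 2"
| "e_row Ez = 3" | "e_row Eb'' = 3" | "e_row Ed = 3"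

fun e_supp :: "e_letter \<Rightarrow> e_letter block set" where
  "e_supp Eb = {(Ec, 0)}"
| "e_supp Eb' = {(Ec, 0), (Ea, 0)}"
| "e_supp Ea' = {(Eb, 0)}"
| "e_supp Ec' = {(Eb, 0), (Eb', 0)}"
| "e_supp Ez = {(Ea', 0)}"
| "e_supp Eb'' = {(Ea', 0), (Ec', 0)}"
| "e_supp Ed = {(Ec', 0)}"
| "e_supp Ea = {(Ez, -1), (Eb'', -1)}"
| "e_supp Ec = {(Eb'', -1), (Ed, -1)}"

definition e_base :: "e_letter column" where
  "e_base = {(l, m). m \<le> -1} \<union>
     {(Ec, 0), (Ea, 0), (Eb, 0), (Eb', 0), (Ea', 0), (Ec', 0), (Eb'', 0)}"

fun e_rep_r :: "idx \<Rightarrow> e_letter column option" where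
  "e_rep_r I1 = Some (e_base \<union> {(Ez, 0), (Ed, 0), (Ec, 1), (Eb, 1), (Ea', 1)})"
| "e_rep_r I2 = Some (e_base \<union> {(Ez, 0), (Ea, 1), (Eb', 1), (Ed, 0), (Ec, 1)})"
| "e_rep_r _ = None"

definition E62 :: "e_letter pattern" where
  "E62 = \<lparr> cartan = cartan_E62, lcolor = e_color, lrow = e_row, lsupp = e_supp,
     rep_empty = e_base \<union> {(Ed, 0), (Ec, 1), (Eb, 1), (Ea', 1), (Ez, 1)},
     rep_r = e_rep_r \<rparr>"

subsection \<open>The pattern of type $F_4^{(1)}$\<close>

datatype f_letter = Fa1 | Fa2 | Fb1 | Fb2 | Fb3 | Fc1 | Fc2 | Fc3 | Fc4 | Fd1 | Fd2 | Fz

fun f_color :: "f_letter \<Rightarrow> idx" where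
  "f_color Fc1 = I3" | "f_color Fd1 = I4" | "f_color Fa1 = I1"
| "f_color Fc2 = I3" | "f_color Fb1 = I2"
| "f_color Fb2 = I2" | "f_color Fc3 = I3"
| "f_color Fa2 = I1" | "f_color Fc4 = I3" | "f_color Fd2 = I4" | "f_color Fz = I0" | "f_color Fb3 = I2"

fun f_row :: "f_letter \<Rightarrow> int" where
  "f_row Fc1 = 0" | "f_row Fd1 = 0" | "f_row Fa1 = 0"
| "f_row Fc2 = 1" | "f_row Fb1 = 1"
| "f_row Fb2 = 2" | "f_row Fc3 = 2"
| "f_row Fa2 = 3" | "f_row Fc4 = 3" | "f_row Fd2 = 3" | "f_row Fz = 3" | "f_row Fb3 = 3"

fun f_supp :: "f_letter \<Rightarrow> f_letter block set" where
  "f_supp Fc2 = {(Fc1, 0), (Fd1, 0)}"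
| "f_supp Fb1 = {(Fc1, 0), (Fa1, 0)}"
| "f_supp Fb2 = {(Fc2, 0)}"
| "f_supp Fc3 = {(Fb1, 0)}"
| "f_supp Fa2 = {(Fb2, 0)}"
| "f_supp Fc4 = {(Fb2, 0), (Fc3, 0)}"
| "f_supp Fd2 = {(Fc3, 0)}"
| "f_supp Fz = {(Fa2, 0)}"
| "f_supp Fb3 = {(Fa2, 0), (Fc4, 0)}"
| "f_supp Fc1 = {(Fb3, -1), (Fc4, -1), (Fd2, -1)}"
| "f_supp Fd1 = {(Fc4, -1), (Fd2, -1)}"
| "f_supp Fa1 = {(Fz, -1), (Fb3, -1)}"

definition f_base :: "f_letter column" where
  "f_base = {(l, m). m \<le> -1} \<union> {(l, m). m = 0 \<and> l \<noteq> Fz \<and> l \<noteq> Fd2}"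

fun f_rep_r :: "idx \<Rightarrow> f_letter column option" where
  "f_rep_r I1 = Some (f_base \<union>
     {(Fz, 0), (Fd2, 0), (Fc1, 1), (Fd1, 1), (Fc2, 1), (Fb2, 1), (Fa2, 1)})"
| "f_rep_r I2 = Some (f_base \<union>
     {(Fz, 0), (Fa1, 1), (Fb1, 1), (Fd2, 0), (Fc1, 1), (Fd1, 1), (Fc2, 1)})"
| "f_rep_r I3 = Some (f_base \<union>
     {(Fz, 0), (Fa1, 1), (Fb1, 1), (Fc3, 1), (Fd2, 0), (Fc1, 1), (Fd1, 1)})"
| "f_rep_r I4 = Some (f_base \<union>
     {(Fz, 0), (Fa1, 1), (Fb1, 1), (Fc3, 1), (Fd2, 1), (Fd2, 0), (Fc1, 1)})"
| "f_rep_r I0 = None"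

definition F41 :: "f_letter pattern" where
  "F41 = \<lparr> cartan = cartan_F41, lcolor = f_color, lrow = f_row, lsupp = f_supp,
     rep_empty = f_base \<union>
       {(Fd2, 0), (Fc1, 1), (Fd1, 1), (Fc2, 1), (Fb2, 1), (Fa2, 1), (Fz, 1)},
     rep_r = f_rep_r \<rparr>"

section \<open>Young columns\<close>

definition pre_young_column :: "'l pattern \<Rightarrow> 'l column \<Rightarrow> bool" where
  "pre_young_column T y \<longleftrightarrow>
     y \<noteq> {} \<and> (\<exists>N. \<forall>x\<in>y. row T x \<le> N) \<and> (\<forall>x\<in>y. \<forall>x'. rests_on T x x' \<longrightarrow> x' \<in> y)"

definition free_block :: "'l pattern \<Rightarrow> 'l column \<Rightarrow> 'l block \<Rightarrow> bool" where
  "free_block T y x \<longleftrightarrow> x \<in> y \<and> pre_young_column T (y - {x})"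

definition exceptional :: "'l pattern \<Rightarrow> 'l column \<Rightarrow> bool" where
  "exceptional T y \<longleftrightarrow>
     (\<exists>!x. free_block T y x \<and> color T x = I2 \<and> (\<forall>x'\<in>y. row T x' \<le> row T x)) \<and>
     (\<exists>x. free_block T y x \<and> color T x = I1)"

definition young_column :: "'l pattern \<Rightarrow> 'l column \<Rightarrow> bool" where
  "young_column T y \<longleftrightarrow> pre_young_column T y \<and> \<not> exceptional T y"

definition sigma_pow :: "int \<Rightarrow> 'l column \<Rightarrow> 'l column" where
  "sigma_pow k y = (\<lambda>(l, m). (l, m + k)) ` y"

definition col_class :: "'l column \<Rightarrow> 'l column set" where
  "col_class y = range (\<lambda>k. sigma_pow k y)"

definition y_empty :: "'l pattern \<Rightarrow> 'l column set" where
  "y_empty T = col_class (rep_empty T)"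

definition y_r :: "'l pattern \<Rightarrow> idx \<Rightarrow> 'l column set" where
  "y_r T j = (case rep_r T j of None \<Rightarrow> {} | Some y \<Rightarrow> col_class y)"

subsection \<open>Crystal operators on Young columns\<close>

definition removable :: "'l pattern \<Rightarrow> idx \<Rightarrow> 'l column \<Rightarrow> 'l block set" where
  "removable T i y = {x. x \<in> y \<and> color T x = i \<and> young_column T (y - {x})}"

definition addable :: "'l pattern \<Rightarrow> idx \<Rightarrow> 'l column \<Rightarrow> 'l block set" where
  "addable T i y = {x. x \<notin> y \<and> color T x = i \<and> young_column T (insert x y)}"

definition col_f :: "'l pattern \<Rightarrow> idx \<Rightarrow> 'l column \<Rightarrow> 'l column option" where
  "col_f T i y =
     (if addable T i y = {} \<or> (\<exists>j. j \<noteq> i \<and> y \<in> y_r T j) then None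
      else Some (insert (ARG_MAX (row T) x. x \<in> addable T i y) y))"

definition col_e :: "'l pattern \<Rightarrow> idx \<Rightarrow> 'l column \<Rightarrow> 'l column option" where
  "col_e T i y =
     (if removable T i y = {} \<or> (\<exists>j. j \<noteq> i \<and> y \<in> y_r T j) then None
      else Some (y - {ARG_MIN (row T) x. x \<in> removable T i y}))"

definition iter_partial :: "('a \<Rightarrow> 'a option) \<Rightarrow> nat \<Rightarrow> 'a \<Rightarrow> 'a option" where
  "iter_partial g n y = ((\<lambda>u. Option.bind u g) ^^ n) (Some y)"

definition col_phi :: "'l pattern \<Rightarrow> idx \<Rightarrow> 'l column \<Rightarrow> nat" where
  "col_phi T i y = Max {n. iter_partial (col_f T i) n y \<noteq> None}"

definition col_eps :: "'l pattern \<Rightarrow> idx \<Rightarrow> 'l column \<Rightarrow> nat" where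
  "col_eps T i y = Max {n. iter_partial (col_e T i) n y \<noteq> None}"

subsection \<open>The energy function\<close>

definition tensor_f ::
  "'l pattern \<Rightarrow> idx \<Rightarrow> 'l column \<times> 'l column \<Rightarrow> ('l column \<times> 'l column) option" where
  "tensor_f T i = (\<lambda>(a, b).
     if col_phi T i a > col_eps T i b
     then map_option (\<lambda>a'. (a', b)) (col_f T i a)
     else map_option (\<lambda>b'. (a, b')) (col_f T i b))"

text \<open>
  The operators on a class are those of any of its representatives, so the recursion for the
  energy function of the classes is written in terms of representatives.
\<close>

definition is_energy_function :: "'l pattern \<Rightarrow> ('l column set \<Rightarrow> 'l column set \<Rightarrow> int) \<Rightarrow> bool"
where
  "is_energy_function T H \<longleftrightarrow>
     H (y_empty T) (y_empty T) = 0 \<and>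
     (\<forall>i a b a' b'. young_column T a \<and> young_column T b \<and> tensor_f T i (a, b) = Some (a', b') \<longrightarrow>
        H (col_class a') (col_class b') - H (col_class a) (col_class b) =
          (if i \<noteq> I0 then 0 else if col_phi T I0 a > col_eps T I0 b then -1 else 1))"

text \<open>
  These conditions determine the function only on pairs of classes of Young columns; its values
  at other sets of columns are irrelevant, hence \<open>SOME\<close> and not \<open>THE\<close>.
\<close>

definition energy :: "'l pattern \<Rightarrow> 'l column set \<Rightarrow> 'l column set \<Rightarrow> int" where
  "energy T = (SOME H. is_energy_function T H)"

section \<open>Young walls\<close>

text \<open>\<open>Y k\<close> is the column of the wall \<open>Y\<close> in position \<open>k\<close>, counted from right to left.\<close>

type_synonym 'l wall = "nat \<Rightarrow> 'l column"

definition young_wall :: "'l pattern \<Rightarrow> 'l column \<Rightarrow> 'l wall \<Rightarrow> bool" where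
  "young_wall T g Y \<longleftrightarrow>
     finite {(k, x). (x \<in> Y k) \<noteq> (x \<in> g)} \<and> (\<forall>k. young_column T (Y k))"

definition zero_content :: "'l pattern \<Rightarrow> 'l column \<Rightarrow> 'l column \<Rightarrow> int" where
  "zero_content T g y =
     int (card {x \<in> y - g. color T x = I0}) - int (card {x \<in> g - y. color T x = I0})"

definition proper_walls :: "'l pattern \<Rightarrow> 'l column \<Rightarrow> 'l wall set" where
  "proper_walls T g = {Y. young_wall T g Y \<and>
     (\<forall>k. energy T (col_class (Y (Suc k))) (col_class (Y k))
           + zero_content T g (Y (Suc k)) - zero_content T g (Y k) \<le> 0)}"

subsection \<open>Signatures\<close>

text \<open>
  The sign \<open>(k, n)\<close> is the \<open>n\<close>-th sign, counted from left to right and starting with 0, in the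
  signature of column \<open>k\<close>. The word of all these signs is infinite to the left.
\<close>

type_synonym sign_pos = "nat \<times> nat"

definition minus_signs :: "'l pattern \<Rightarrow> idx \<Rightarrow> 'l wall \<Rightarrow> sign_pos set" where
  "minus_signs T i Y = {(k, n). n < col_eps T i (Y k)}"

definition plus_signs :: "'l pattern \<Rightarrow> idx \<Rightarrow> 'l wall \<Rightarrow> sign_pos set" where
  "plus_signs T i Y =
     {(k, n). col_eps T i (Y k) \<le> n \<and> n < col_eps T i (Y k) + col_phi T i (Y k)}"

definition left_of :: "sign_pos \<Rightarrow> sign_pos \<Rightarrow> bool" where
  "left_of p q \<longleftrightarrow> fst p > fst q \<or> (fst p = fst q \<and> snd p < snd q)"

text \<open>
  A plus \<open>p\<close> and a minus \<open>q\<close> to its right are cancelled against each other once all signs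
  between them have been cancelled among themselves.
\<close>

inductive cancels :: "'l pattern \<Rightarrow> idx \<Rightarrow> 'l wall \<Rightarrow> sign_pos \<Rightarrow> sign_pos \<Rightarrow> bool"
  for T i Y where
  "p \<in> plus_signs T i Y \<Longrightarrow> q \<in> minus_signs T i Y \<Longrightarrow> left_of p q \<Longrightarrow>
   (\<And>r. r \<in> plus_signs T i Y \<union> minus_signs T i Y \<Longrightarrow> left_of p r \<Longrightarrow> left_of r q \<Longrightarrow>
      \<exists>s. left_of p s \<and> left_of s q \<and> (cancels T i Y r s \<or> cancels T i Y s r)) \<Longrightarrow>
   cancels T i Y p q"

definition wall_minus :: "'l pattern \<Rightarrow> idx \<Rightarrow> 'l wall \<Rightarrow> sign_pos set" where
  "wall_minus T i Y = {q \<in> minus_signs T i Y. \<not> (\<exists>p. cancels T i Y p q)}"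

definition wall_plus :: "'l pattern \<Rightarrow> idx \<Rightarrow> 'l wall \<Rightarrow> sign_pos set" where
  "wall_plus T i Y = {p \<in> plus_signs T i Y. \<not> (\<exists>q. cancels T i Y p q)}"

subsection \<open>Structure maps\<close>

definition wall_E :: "'l pattern \<Rightarrow> idx \<Rightarrow> 'l wall \<Rightarrow> 'l wall option" where
  "wall_E T i Y =
     (if wall_minus T i Y = {} then None
      else let k = Min (fst ` wall_minus T i Y)
           in map_option (\<lambda>y. Y(k := y)) (col_e T i (Y k)))"

definition wall_F :: "'l pattern \<Rightarrow> idx \<Rightarrow> 'l wall \<Rightarrow> 'l wall option" where
  "wall_F T i Y =
     (if wall_plus T i Y = {} then None
      else let k = Max (fst ` wall_plus T i Y)
           in map_option (\<lambda>y. Y(k := y)) (col_f T i (Y k)))"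

definition wall_eps :: "'l pattern \<Rightarrow> idx \<Rightarrow> 'l wall \<Rightarrow> int extended" where
  "wall_eps T i Y = Fin (int (card (wall_minus T i Y)))"

definition wall_phi :: "'l pattern \<Rightarrow> idx \<Rightarrow> 'l wall \<Rightarrow> int extended" where
  "wall_phi T i Y = Fin (int (card (wall_plus T i Y)))"

definition wall_content :: "'l pattern \<Rightarrow> 'l column \<Rightarrow> 'l wall \<Rightarrow> idx \<Rightarrow> int" where
  "wall_content T g Y i =
     int (card {(k, x). x \<in> Y k - g \<and> color T x = i}) -
     int (card {(k, x). x \<in> g - Y k \<and> color T x = i})"

definition wall_wt :: "'l pattern \<Rightarrow> weight \<Rightarrow> 'l column \<Rightarrow> 'l wall \<Rightarrow> weight" where
  "wall_wt T lam g Y =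
     lam - (\<Sum>i\<in>UNIV. int_scale (wall_content T g Y i) (simple_root (cartan T) i))"

end

theory Submission
  imports Defs
begin

text \<open>
  If \<open>F\<^sub>i\<close> acts on column \<open>k\<close> of a wall, the signature rule forces
  \<open>\<phi>\<^sub>i(y\<^bsub>k+1\<^esub>) \<le> \<epsilon>\<^sub>i(y\<^sub>k)\<close> and \<open>\<phi>\<^sub>i(y\<^sub>k) > \<epsilon>\<^sub>i(y\<^bsub>k-1\<^esub>)\<close>. So \<open>f\<^sub>i\<close> acts on the right
  factor of \<open>y\<^bsub>k+1\<^esub> \<otimes> y\<^sub>k\<close> and on the left factor of \<open>y\<^sub>k \<otimes> y\<^bsub>k-1\<^esub>\<close>, and the change of the
  energy is exactly compensated by the change of the number of 0-blocks: the quantity that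
  defines properness is invariant under the operators. The cancellation of signs is computed
  column by column from the right, with a stack of the minus signs that still wait for a plus
  sign; in these terms \<open>F\<^sub>i\<close> turns one surviving plus sign into a surviving minus sign and
  leaves all other surviving signs alone. This reduces the theorem to facts on single columns
  and to the existence of an energy function. Up to \<open>\<sigma>\<close> there are only 27, respectively 53, Young
  columns, so these facts are read off from the finite tables of the crystal graph and of the
  energy function, which are verified by rewriting.
\<close>

section \<open>Signatures\<close>

text \<open>The word of signs really is infinite for color 0: the ground-state column has one minus
  and one plus sign, and all columns far to the left repeat them. In this tail every plus sign meets
  the minus sign of the next column to the right; the shift by one column leaves one plus sign in
  excess, and this excess is the pairing with \<open>fund_weight I0\<close>. Only \<open>F\<close>
  is analyzed in full. \<open>E\<close> is shown to be its inverse on Young walls, and properness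
  passes along \<open>F\<close> in both directions, so that the axioms for \<open>E\<close> follow.
  On columns two obstacles remain. A column is infinite downwards; but in both patterns a block
  forces all blocks two indices lower, so a window of three consecutive indices decides everything,
  and a column is determined by its first incomplete index and its blocks on two levels. The classes
  \<open>y_r T j\<close> switch operators off; this is recorded by inactive edges, one flag serving
  both operators so that they are inverse to each other. The energy is picked by
  \<open>SOME\<close>, so a table obeying the local rules is needed as a witness.\<close>

lemma left_of_irrefl: "\<not> left_of p p"
  and left_of_trans: "left_of p q \<Longrightarrow> left_of q r \<Longrightarrow> left_of p r"
  by (auto simp: left_of_def)

section \<open>The stack of waiting minus signs and the matching it defines\<close>

locale sign_word =
  fixes eps phi :: "nat \<Rightarrow> nat"
begin

text \<open>
  The minus signs of the columns below \<open>k\<close> that no plus sign of these columns cancels, from left to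
  right. The plus signs of column \<open>k\<close>, which stands to their left, cancel the leftmost ones.
\<close>

primrec pending :: "nat \<Rightarrow> sign_pos list" where
  "pending 0 = []"
| "pending (Suc k) = map (Pair k) [0..<eps k] @ drop (phi k) (pending k)"

definition plus :: "sign_pos set" where
  "plus = {(k, n). eps k \<le> n \<and> n < eps k + phi k}"

definition minus :: "sign_pos set" where
  "minus = {(k, n). n < eps k}"

lemma plus_minus_disjoint: "plus \<inter> minus = {}"
  by (auto simp: plus_def minus_def)

text \<open>\<open>j\<close> counts the plus signs of column \<open>k\<close> from the right and the
  waiting minus signs from the left: the rightmost plus sign meets the leftmost waiting minus sign,
  so the \<open>j\<close>-th pair encloses the pairs with smaller \<open>j\<close>.\<close>

definition matches :: "sign_pos \<Rightarrow> sign_pos \<Rightarrow> bool" where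
  "matches p q \<longleftrightarrow> (\<exists>k j. p = (k, eps k + phi k - Suc j) \<and> q = pending k ! j \<and>
     j < phi k \<and> j < length (pending k))"

lemma matchesI:
  "j < phi k \<Longrightarrow> j < length (pending k) \<Longrightarrow> matches (k, eps k + phi k - Suc j) (pending k ! j)"
  by (auto simp: matches_def)

lemma plusE:
  assumes "p \<in> plus"
  obtains k j where "p = (k, eps k + phi k - Suc j)" "j < phi k"
proof -
  obtain k n where p: "p = (k, n)" "eps k \<le> n" "n < eps k + phi k"
    using assms by (auto simp: plus_def)
  show thesis
    by (rule that[of k "eps k + phi k - Suc n"]) (use p in auto)
qed

lemma pending_minus: "x \<in> set (pending k) \<Longrightarrow> fst x < k \<and> x \<in> minus"
  by (induction k) (auto simp: minus_def dest: in_set_dropD)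

lemma sorted_pending: "sorted_wrt left_of (pending k)"
proof (induction k)
  case (Suc k)
  have "sorted_wrt left_of (map (Pair k) [0..<eps k])"
    by (auto simp: sorted_wrt_iff_nth_less left_of_def)
  moreover have "sorted_wrt left_of (drop (phi k) (pending k))"
    using Suc by (metis append_take_drop_id sorted_wrt_append)
  moreover have "left_of x y" if "x \<in> set (map (Pair k) [0..<eps k])"
      "y \<in> set (drop (phi k) (pending k))" for x y
    using that pending_minus[of y k] by (auto simp: left_of_def dest: in_set_dropD)
  ultimately show ?case
    by (simp add: sorted_wrt_append)
qed simp

lemma pending_left_of:
  "i < j \<Longrightarrow> j < length (pending k) \<Longrightarrow> left_of (pending k ! i) (pending k ! j)"
  using sorted_pending[of k] by (simp add: sorted_wrt_iff_nth_less)

lemma distinct_pending: "distinct (pending k)"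
  using pending_left_of left_of_irrefl
  by (metis distinct_conv_nth nat_neq_iff)

lemma matchesD:
  assumes "matches p q"
  shows "p \<in> plus" "q \<in> minus" "fst q < fst p" "left_of p q"
proof -
  obtain k j where *: "p = (k, eps k + phi k - Suc j)" "q = pending k ! j"
     "j < phi k" "j < length (pending k)"
    using assms by (auto simp: matches_def)
  then have "q \<in> set (pending k)" by simp
  with * pending_minus[of q k] show "p \<in> plus" "q \<in> minus" "fst q < fst p" "left_of p q"
    by (auto simp: plus_def left_of_def)
qed

lemma matches_nth:
  assumes "matches (k, eps k + phi k - Suc j) q" "j < phi k"
  shows "j < length (pending k)" "q = pending k ! j"
proof -
  obtain j' where "eps k + phi k - Suc j = eps k + phi k - Suc j'" "q = pending k ! j'"
     "j' < phi k" "j' < length (pending k)"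
    using assms by (auto simp: matches_def)
  moreover from this have "j = j'" using assms(2) by linarith
  ultimately show "j < length (pending k)" "q = pending k ! j" by auto
qed

lemma matches_functional: "matches p q \<Longrightarrow> matches p q' \<Longrightarrow> q = q'"
  by (metis matchesD(1) matches_nth(2) plusE)

text \<open>A sign enters the stack only with its own column, so once dropped it never comes
  back.\<close>

lemma pending_mono: "k \<le> k' \<Longrightarrow> q \<in> set (pending k') \<Longrightarrow> fst q < k \<Longrightarrow> q \<in> set (pending k)"
proof (induction rule: dec_induct)
  case (step n)
  then show ?case by (auto dest: in_set_dropD)
qed simp

lemma nth_notin_drop: "distinct xs \<Longrightarrow> j < n \<Longrightarrow> j < length xs \<Longrightarrow> xs ! j \<notin> set (drop n xs)"
  by (metis append_take_drop_id distinct_append disjoint_iff in_set_conv_nth length_take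
      min_less_iff_conj nth_take)

lemma not_in_drop_iff_take: "distinct xs \<Longrightarrow> x \<in> set xs \<Longrightarrow> x \<notin> set (drop n xs) \<longleftrightarrow> x \<in> set (take n xs)"
  by (metis append_take_drop_id distinct_append disjoint_iff Un_iff set_append)

lemma matched_not_pending:
  assumes "matches p q" "fst p < k"
  shows "q \<notin> set (pending k)"
proof
  assume q: "q \<in> set (pending k)"
  obtain l j where *: "p = (l, eps l + phi l - Suc j)" "q = pending l ! j"
     "j < phi l" "j < length (pending l)"
    using assms by (auto simp: matches_def)
  then have "fst q < l" using pending_minus[of q l] by simp
  then have "q \<in> set (pending (Suc l))"
    using q pending_mono[of "Suc l" k q] assms(2) * by auto
  moreover have "q \<notin> set (drop (phi l) (pending l))"
    using * nth_notin_drop distinct_pending by blast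
  ultimately show False
    using \<open>fst q < l\<close> by auto
qed

text \<open>The column of a plus sign removes its partner from every later stack. Two plus signs
  with a common partner therefore lie in one column, and there the position in a repetition-free
  stack determines them.\<close>

lemma matches_injective:
  assumes "matches p q" "matches p' q"
  shows "p = p'"
proof -
  have le: "fst p' \<le> fst p" if "matches p q" "matches p' q" for p p'
  proof (rule ccontr)
    assume "\<not> ?thesis"
    then have "q \<notin> set (pending (fst p'))" using matched_not_pending that by auto
    with that show False by (auto simp: matches_def)
  qed
  then have "fst p = fst p'" using assms by (metis le_antisym)
  then show ?thesis using assms distinct_pending
    by (auto simp: matches_def nth_eq_iff_index_eq)
qed

text \<open>A cancelled pair cannot enclose a waiting minus sign. A plus sign stays unmatched only
  if its column exhausts the stack, and the stack is consumed from its left end; so if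
  \<open>t\<close> still waits to the right of \<open>r\<close>, then \<open>r\<close> has a
  partner, and this partner stays to the left of whatever waits to the right of
  \<open>r\<close>.\<close>

lemma resolved_before_pending:
  assumes "r \<in> plus \<union> minus" "fst r < k" "r \<notin> set (pending k)" "t \<in> set (pending k)" "left_of r t"
  shows "\<exists>s. (matches r s \<or> matches s r) \<and> fst s < k \<and> (\<forall>t\<in>set (pending k). left_of r t \<longrightarrow> left_of s t)"
  using assms
proof (induction k arbitrary: t)
  case (Suc k)
  show ?case
  proof (cases "fst r = k")
    case True
    with Suc.prems have "r \<in> plus" by (cases r) (auto simp: minus_def)
    then obtain j where r: "r = (k, eps k + phi k - Suc j)" "j < phi k"
      using True by (metis fst_conv plusE)
    have t: "u \<in> set (drop (phi k) (pending k))" if "u \<in> set (pending (Suc k))" "left_of r u" for u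
      using that r by (auto simp: left_of_def)
    \<comment> \<open>Something still waits after column \<open>k\<close> has acted, so each of its
      plus signs found a partner.\<close>
    with Suc.prems have "drop (phi k) (pending k) \<noteq> []" by fastforce
    then have j: "j < length (pending k)" using r by auto
    have "left_of (pending k ! j) u" if "u \<in> set (drop (phi k) (pending k))" for u
      using that r(2) pending_left_of[of j "phi k + _" k] by (auto simp: in_set_conv_nth)
    with t have "\<forall>u\<in>set (pending (Suc k)). left_of r u \<longrightarrow> left_of (pending k ! j) u"
      by blast
    then show ?thesis
      using matchesI[OF r(2) j] pending_minus[of "pending k ! j" k] r j
      by (intro exI[of _ "pending k ! j"]) (auto simp del: pending.simps)
  next
    case False
    then have rk: "fst r < k" using Suc.prems by simp
    have t: "u \<in> set (drop (phi k) (pending k))" if "u \<in> set (pending (Suc k))" "left_of r u" for u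
      using that rk by (auto simp: left_of_def)
    show ?thesis
    proof (cases "r \<in> set (pending k)")
      case True
      then have "r \<in> set (take (phi k) (pending k))"
        using Suc.prems not_in_drop_iff_take[OF distinct_pending True] by auto
      then obtain j where j: "r = pending k ! j" "j < phi k" "j < length (pending k)"
        by (auto simp: in_set_conv_nth)
      have "left_of (k, eps k + phi k - Suc j) u" if "u \<in> set (drop (phi k) (pending k))" for u
        using pending_minus[of u k] that by (auto simp: left_of_def dest: in_set_dropD)
      with t have "\<forall>u\<in>set (pending (Suc k)). left_of r u \<longrightarrow> left_of (k, eps k + phi k - Suc j) u"
        by blast
      then show ?thesis
        using matchesI[OF j(2,3)] j
        by (intro exI[of _ "(k, eps k + phi k - Suc j)"]) (auto simp del: pending.simps)
    next
      case False
      have tk: "t \<in> set (pending k)" using t Suc.prems by (auto dest: in_set_dropD)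
      obtain s where s: "matches r s \<or> matches s r" "fst s < k"
          "\<forall>t\<in>set (pending k). left_of r t \<longrightarrow> left_of s t"
        using Suc.IH[OF Suc.prems(1) rk False tk Suc.prems(5)] by blast
      then show ?thesis
        using t by (intro exI[of _ s]) (auto dest: in_set_dropD)
    qed
  qed
qed simp

lemma matched_before:
  assumes "q \<in> minus" "fst q < k" "q \<notin> set (pending k)"
  shows "\<exists>p. matches p q \<and> fst p < k"
  using assms
proof (induction k)
  case (Suc k)
  have "fst q \<noteq> k" using Suc.prems by (cases q) (auto simp: minus_def)
  then have qk: "fst q < k" using Suc.prems by simp
  show ?case
  proof (cases "q \<in> set (pending k)")
    case True
    then have "q \<in> set (take (phi k) (pending k))"
      using Suc.prems not_in_drop_iff_take[OF distinct_pending True] by auto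
    then obtain j where j: "q = pending k ! j" "j < phi k" "j < length (pending k)"
      by (auto simp: in_set_conv_nth)
    show ?thesis using matchesI[OF j(2,3)] j(1) by auto
  next
    case False
    then show ?thesis using Suc.IH[OF Suc.prems(1) qk] by auto
  qed
qed simp

text \<open>This is the closure condition in the rule of \<open>cancels\<close>. Plus signs of the
  same column to the right of \<open>p\<close> have a smaller index, waiting signs before
  \<open>q\<close> are taken by such plus signs, and all other signs in between were settled
  earlier, on the near side of \<open>q\<close> by \<open>resolved_before_pending\<close>.\<close>

lemma matches_nested:
  assumes "matches p q" "r \<in> plus \<union> minus" "left_of p r" "left_of r q"
  shows "\<exists>s. left_of p s \<and> left_of s q \<and> (matches r s \<or> matches s r)"
proof -
  obtain k j where *: "p = (k, eps k + phi k - Suc j)" "q = pending k ! j"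
     "j < phi k" "j < length (pending k)"
    using assms by (auto simp: matches_def)
  then have q: "q \<in> set (pending k)" by simp
  show ?thesis
  proof (cases "fst r = k")
    case True
    with assms(2,3) * have "r \<in> plus" by (cases r) (auto simp: minus_def left_of_def)
    then obtain i where r: "r = (k, eps k + phi k - Suc i)" "i < phi k"
      using True by (metis fst_conv plusE)
    with assms(3) * have "i < j" by (auto simp: left_of_def)
    then show ?thesis
      using matchesI[of i k] r * pending_minus[of "pending k ! i" k] pending_left_of[of i j k]
      by (intro exI[of _ "pending k ! i"]) (auto simp: left_of_def)
  next
    case False
    then have rk: "fst r < k" using assms(3) * by (auto simp: left_of_def)
    show ?thesis
    proof (cases "r \<in> set (pending k)")
      case True
      then obtain i where i: "r = pending k ! i" "i < length (pending k)"
        by (auto simp: in_set_conv_nth)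
      have "i < j"
        using assms(4) i * pending_left_of[of j i k] left_of_trans left_of_irrefl
        by (metis nat_neq_iff)
      then show ?thesis
        using matchesI[of i k] i * pending_minus[OF q]
        by (intro exI[of _ "(k, eps k + phi k - Suc i)"]) (auto simp: left_of_def)
    next
      case False
      then obtain s where "matches r s \<or> matches s r" "fst s < k" "left_of s q"
        using resolved_before_pending[OF assms(2) rk False q assms(4)] q assms(4) by blast
      then show ?thesis
        using * by (intro exI[of _ s]) (simp add: left_of_def)
    qed
  qed
qed

text \<open>The obstruction to every other cancellation. If \<open>q\<close> waits when the column
  of \<open>p\<close> acts, its position is compared with the index of \<open>p\<close>; otherwise
  \<open>q\<close> was taken by a column to the right of \<open>p\<close>. Either way a partner of
  \<open>p\<close> or of \<open>q\<close> lies between the two.\<close>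

lemma matches_outermost:
  assumes "p \<in> plus" "q \<in> minus" "left_of p q" "\<not> matches p q"
  shows "(\<exists>p'. matches p' q \<and> left_of p p') \<or> (\<exists>q'. matches p q' \<and> left_of q' q)"
proof -
  obtain k j where p: "p = (k, eps k + phi k - Suc j)" "j < phi k"
    using assms(1) plusE by blast
  have qk: "fst q < k"
    using assms(2,3) p by (cases q) (auto simp: left_of_def minus_def)
  show ?thesis
  proof (cases "q \<in> set (pending k)")
    case True
    then obtain i where i: "q = pending k ! i" "i < length (pending k)"
      by (auto simp: in_set_conv_nth)
    consider "i < j" | "i = j" | "j < i" by linarith
    then show ?thesis
    proof cases
      case 1
      then show ?thesis using matchesI[of i k] i p
        by (intro disjI1 exI[of _ "(k, eps k + phi k - Suc i)"]) (auto simp: left_of_def)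
    next
      case 2
      then show ?thesis using matchesI[of i k] i p assms(4) by auto
    next
      case 3
      then show ?thesis using matchesI[of j k] i p pending_left_of[of j i k]
        by (intro disjI2 exI[of _ "pending k ! j"]) auto
    qed
  next
    case False
    then obtain p' where "matches p' q" "fst p' < k"
      using matched_before[OF assms(2) qk] by blast
    then show ?thesis using p by (intro disjI1 exI[of _ p']) (auto simp: left_of_def)
  qed
qed

text \<open>The word is infinite only to the left, so \<open>p\<close> bounds the gap; this permits
  induction on the number of enclosed signs.\<close>

lemma finite_between: "finite {r \<in> plus \<union> minus. left_of p r \<and> left_of r q}"
proof (rule finite_subset)
  show "{r \<in> plus \<union> minus. left_of p r \<and> left_of r q} \<subseteq> (SIGMA k:{..fst p}. {..<eps k + phi k})"
    by (auto simp: plus_def minus_def left_of_def)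
qed auto

section \<open>Surviving signs, their number, and their change under the operators\<close>

definition free_plus :: "sign_pos set" where
  "free_plus = {p \<in> plus. \<nexists>q. matches p q}"

definition free_minus :: "sign_pos set" where
  "free_minus = {q \<in> minus. \<nexists>p. matches p q}"

lemma length_pending_Suc [simp]:
  "length (pending (Suc k)) = eps k + (length (pending k) - phi k)"
  by simp

text \<open>A column spends its plus signs from the right, so the survivors are its leftmost ones;
  truncated subtraction makes the interval empty when the stack is long enough.\<close>

lemma free_plus_iff:
  "(k, n) \<in> free_plus \<longleftrightarrow> eps k \<le> n \<and> n < eps k + (phi k - length (pending k))"
proof (cases "eps k \<le> n \<and> n < eps k + phi k")
  case True
  define j where "j = eps k + phi k - Suc n"
  have n: "n = eps k + phi k - Suc j" and j: "j < phi k" using True by (auto simp: j_def)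
  have "(\<exists>q. matches (k, n) q) \<longleftrightarrow> j < length (pending k)"
    unfolding n using matches_nth(1)[of k j] matchesI[of j k] j by blast
  then show ?thesis using True by (auto simp: free_plus_def plus_def j_def)
qed (auto simp: free_plus_def plus_def)

lemma free_minus_iff: "q \<in> free_minus \<longleftrightarrow> q \<in> minus \<and> (\<forall>k>fst q. q \<in> set (pending k))"
proof
  assume "q \<in> free_minus"
  then show "q \<in> minus \<and> (\<forall>k>fst q. q \<in> set (pending k))"
    using matched_before unfolding free_minus_def by blast
next
  assume q: "q \<in> minus \<and> (\<forall>k>fst q. q \<in> set (pending k))"
  have False if "matches p q" for p
    using q matched_not_pending[OF that, of "Suc (fst p)"] matchesD(3)[OF that] less_SucI by blast
  with q show "q \<in> free_minus" by (auto simp: free_minus_def)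
qed

text \<open>Conservation law: each plus sign either survives or shortens the stack by one, and each
  minus sign lengthens it by one.\<close>

lemma pending_balance:
  "int (\<Sum>j<k. phi j - length (pending j)) - int (length (pending k))
     = (\<Sum>j<k. int (phi j) - int (eps j))"
  by (induction k) auto

lemma free_plus_nonempty_column:
  "k \<in> fst ` free_plus \<longleftrightarrow> length (pending k) < phi k"
proof
  assume "length (pending k) < phi k"
  then have "(k, eps k) \<in> free_plus" by (simp add: free_plus_iff)
  then show "k \<in> fst ` free_plus" by force
qed (auto simp: free_plus_iff)

text \<open>\<open>k\<close> is the leftmost column with a surviving plus sign, and
  \<open>(k, eps k)\<close> is the leftmost survivor. The change puts a minus sign at this position.
  It enters the stack at the far right end, behind everything that the columns further left can
  take; so it survives, and the other survivors stay as they are. The last claim holds because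
  column \<open>k\<close> empties the stack.\<close>

lemma raise_sign:
  assumes k: "length (pending k) < phi k" and later: "\<And>l. l > k \<Longrightarrow> phi l \<le> length (pending l)"
  defines "eps' \<equiv> eps(k := Suc (eps k))" and "phi' \<equiv> phi(k := phi k - 1)"
  shows "(k, eps k) \<in> free_plus" "sign_word.free_plus eps' phi' = free_plus - {(k, eps k)}"
    and "(k, eps k) \<notin> free_minus" "sign_word.free_minus eps' phi' = insert (k, eps k) free_minus"
    and "\<And>q. q \<in> free_minus \<Longrightarrow> k \<le> fst q"
proof -
  interpret new: sign_word eps' phi' .
  have [simp]: "eps' k = Suc (eps k)" "phi' k = phi k - 1"
    and [simp]: "l \<noteq> k \<Longrightarrow> eps' l = eps l" "l \<noteq> k \<Longrightarrow> phi' l = phi l" for l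
    by (simp_all add: eps'_def phi'_def)
  have below: "new.pending l = pending l" if "l \<le> k" for l
    using that by (induction l) auto
  have above: "new.pending l = pending l @ [(k, eps k)]" if "Suc k \<le> l" for l
    using that
  proof (induction rule: dec_induct)
    case base
    then show ?case using k below[of k] by simp
  next
    case (step l)
    then show ?case using later[of l] by simp
  qed
  show p: "(k, eps k) \<in> free_plus" using k by (simp add: free_plus_iff)
  show "(k, eps k) \<notin> free_minus" by (simp add: free_minus_def minus_def)
  have "(l, n) \<in> new.free_plus \<longleftrightarrow> (l, n) \<in> free_plus - {(k, eps k)}" for l n
  proof -
    consider "l < k" | "l = k" | "l > k" by linarith
    then show ?thesis
    proof cases
      case 2
      then show ?thesis using k below[of k]
        by (auto simp: free_plus_iff new.free_plus_iff)
    next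
      case 3
      then show ?thesis using above[of l] later[of l]
        by (auto simp: free_plus_iff new.free_plus_iff)
    qed (use below[of l] in \<open>auto simp: free_plus_iff new.free_plus_iff\<close>)
  qed
  then show "new.free_plus = free_plus - {(k, eps k)}" by auto
  have pk: "set (pending (Suc k)) \<subseteq> {k} \<times> {..<eps k}" using k by auto
  show kq: "k \<le> fst q" if "q \<in> free_minus" for q
  proof (rule ccontr)
    assume "\<not> ?thesis"
    then have "q \<in> set (pending (Suc k))"
      using that unfolding free_minus_iff by (meson less_SucI not_le)
    with pk \<open>\<not> ?thesis\<close> show False by auto
  qed
  have "q \<in> new.free_minus \<longleftrightarrow> q \<in> insert (k, eps k) free_minus" for q
  proof (cases "fst q < k")
    case True
    then have "q \<notin> free_minus" using kq by fastforce
    moreover have "q \<notin> set (new.pending (Suc k))"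
      using above[of "Suc k"] pk True by auto
    then have "q \<notin> new.free_minus"
      using True less_Suc_eq new.free_minus_iff by blast
    ultimately show ?thesis using True by auto
  next
    case False
    then have "(\<forall>l>fst q. q \<in> set (new.pending l)) \<longleftrightarrow>
        q = (k, eps k) \<or> (\<forall>l>fst q. q \<in> set (pending l))"
      using above by fastforce
    moreover have "q \<in> new.minus \<longleftrightarrow> q = (k, eps k) \<or> q \<in> minus"
      by (cases q; cases "fst q = k") (auto simp: new.minus_def minus_def)
    ultimately show ?thesis
      using free_minus_iff[of q] new.free_minus_iff[of q] by blast
  qed
  then show "new.free_minus = insert (k, eps k) free_minus" by blast
qed

text \<open>The converse of \<open>raise_sign\<close>: \<open>k\<close> is the rightmost column with
  a surviving minus sign, and the lowered word satisfies the hypotheses of \<open>raise_sign\<close>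
  at \<open>k\<close>. Here \<open>q\<close> is any survivor of column \<open>k\<close>; the proof
  passes to the last minus sign of the column, which survives as well.\<close>

lemma lower_sign:
  assumes q: "q \<in> free_minus" and min: "\<And>q'. q' \<in> free_minus \<Longrightarrow> fst q \<le> fst q'"
  defines "k \<equiv> fst q"
  defines "eps' \<equiv> eps(k := eps k - 1)" and "phi' \<equiv> phi(k := Suc (phi k))"
  shows "length (sign_word.pending eps' phi' k) < phi' k"
    and "\<And>l. l > k \<Longrightarrow> phi' l \<le> length (sign_word.pending eps' phi' l)"
proof -
  interpret new: sign_word eps' phi' .
  have [simp]: "eps' k = eps k - 1" "phi' k = Suc (phi k)"
    and [simp]: "l \<noteq> k \<Longrightarrow> eps' l = eps l" "l \<noteq> k \<Longrightarrow> phi' l = phi l" for l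
    by (simp_all add: eps'_def phi'_def)
  have below: "new.pending l = pending l" if "l \<le> k" for l
    using that by (induction l) auto
  \<comment> \<open>The stack is consumed from its left end: as long as \<open>q\<close> is not
    taken, nothing to the right of \<open>q\<close> is.\<close>
  have right: "x \<in> set (pending l)" if "Suc k \<le> l" "x \<in> set (pending (Suc k))" "left_of q x" for x l
    using that(1)
  proof (induction rule: dec_induct)
    case (step l)
    have "q \<in> set (pending (Suc l))"
      using q step unfolding free_minus_iff k_def by (meson Suc_le_lessD less_SucI)
    then have "q \<in> set (drop (phi l) (pending l))" using step by (auto simp: k_def)
    then obtain j where j: "pending l ! (phi l + j) = q" "phi l + j < length (pending l)"
      by (auto simp: in_set_conv_nth)
    obtain i where i: "pending l ! i = x" "i < length (pending l)"
      using step by (auto simp: in_set_conv_nth)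
    have "phi l + j < i"
      using pending_left_of[of i "phi l + j" l] i j that(3) left_of_trans left_of_irrefl
      by (metis nat_neq_iff)
    then have "drop (phi l) (pending l) ! (i - phi l) = x" "i - phi l < length (drop (phi l) (pending l))"
      using i by auto
    then have "x \<in> set (drop (phi l) (pending l))" using nth_mem by blast
    then show ?case by auto
  qed (use that in auto)
  have free: "x \<in> free_minus" if "x \<in> set (pending (Suc k))" "left_of q x" for x
    unfolding free_minus_iff
  proof (intro conjI allI impI)
    show "x \<in> minus" using that pending_minus by blast
    fix l assume "fst x < l"
    then show "x \<in> set (pending l)"
      using right[OF _ that] pending_mono[OF _ that(1), of l] by (cases "Suc k \<le> l") auto
  qed
  \<comment> \<open>A sign left over here would lie to the right of \<open>q\<close> and so survive,
    against the minimality of \<open>fst q\<close>.\<close>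
  have drop0: "drop (phi k) (pending k) = []"
  proof (rule ccontr)
    assume "\<not> ?thesis"
    then obtain x where x: "x \<in> set (drop (phi k) (pending k))"
      using hd_in_set by blast
    then have "fst x < k" using pending_minus by (meson in_set_dropD)
    moreover from this have "x \<in> free_minus"
      using x by (intro free) (auto simp: left_of_def k_def)
    ultimately show False using min[of x] by (simp add: k_def)
  qed
  then show "length (new.pending k) < phi' k"
    using below[of k] by simp
  have pos: "eps k > 0" and snd_q: "snd q < eps k"
    using q by (auto simp: free_minus_def minus_def k_def)
  have last: "(k, eps k - 1) \<in> free_minus"
  proof (cases "snd q = eps k - 1")
    case True
    then show ?thesis using q by (metis k_def prod.collapse)
  next
    case False
    then show ?thesis using snd_q by (intro free) (auto simp: left_of_def k_def)
  qed
  \<comment> \<open>Lowering removes the sign at the right end of the stack. It is never taken, so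
    the later columns act on the rest as before.\<close>
  have above: "pending l = new.pending l @ [(k, eps k - 1)]" if "Suc k \<le> l" for l
    using that
  proof (induction rule: dec_induct)
    case base
    have "[0..<eps k] = [0..<eps k - 1] @ [eps k - 1]"
      using pos by (metis Suc_diff_1 upt_Suc_append zero_le)
    then show ?case
      using drop0 below[of k] by simp
  next
    case (step l)
    have "(k, eps k - 1) \<in> set (pending (Suc l))"
      using last step(1) unfolding free_minus_iff by (metis Suc_le_lessD fst_conv less_SucI)
    then have "drop (phi l) (pending l) \<noteq> []" using step by auto
    then have "phi l < length (pending l)" by simp
    then have "phi l \<le> length (new.pending l)" unfolding step(3) by simp
    then show ?case using step by simp
  qed
  show "phi' l \<le> length (new.pending l)" if "l > k" for l
  proof -
    have "(k, eps k - 1) \<in> set (pending (Suc l))"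
      using last that unfolding free_minus_iff by (metis fst_conv less_SucI)
    then have "drop (phi l) (pending l) \<noteq> []" using that by auto
    then have "phi l < length (pending l)" by simp
    then show ?thesis using above[of l] that by simp
  qed
qed

text \<open>The plus signs of the repeating tail cancel minus signs one column further right. Hence
  the \<open>t\<close> plus signs of column \<open>K + 1\<close> take \<open>t\<close> of the signs
  that wait behind column \<open>K\<close>, which produces the summand \<open>t\<close>.\<close>

lemma
  assumes tail: "\<And>k. K \<le> k \<Longrightarrow> eps k = t \<and> phi k = t"
  shows finite_free_plus: "finite free_plus"
    and finite_free_minus: "finite free_minus"
    and free_signs_balance: "int (card free_plus) - int (card free_minus) =
          int t + (\<Sum>k<K. int (phi k) - int (eps k))"
proof -
  \<comment> \<open>Every tail column exchanges the first \<open>t\<close> waiting signs for its own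
    \<open>t\<close> minus signs; the rest of the stack is frozen.\<close>
  have stable: "t \<le> length (pending k) \<and> drop t (pending k) = drop t (pending (Suc K))"
    if "Suc K \<le> k" for k
    using that
  proof (induction rule: dec_induct)
    case base
    then show ?case using tail[of K] by simp
  next
    case (step k)
    then show ?case using tail[of k] by simp
  qed
  have "free_plus = (SIGMA k:{..K}. {eps k..<eps k + (phi k - length (pending k))})"
  proof (intro set_eqI, clarify)
    fix k n
    show "(k, n) \<in> free_plus \<longleftrightarrow>
        (k, n) \<in> (SIGMA k:{..K}. {eps k..<eps k + (phi k - length (pending k))})"
      using stable[of k] tail[of k] by (cases "k \<le> K") (auto simp: free_plus_iff)
  qed
  then show "finite free_plus"
    by simp
  from \<open>free_plus = _\<close> have plus: "card free_plus = (\<Sum>k<Suc K. phi k - length (pending k))"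
    by (auto simp: lessThan_Suc_atMost)
  have minus: "free_minus = set (drop t (pending (Suc K)))"
  proof (intro equalityI subsetI)
    fix q assume q: "q \<in> free_minus"
    define k where "k = Suc (max K (fst q))"
    have k: "K \<le> k" "Suc K \<le> k" "fst q < k" by (auto simp: k_def)
    have "q \<in> set (pending (Suc k))"
      using q k(3) unfolding free_minus_iff by (meson less_SucI)
    then have "q \<in> set (drop t (pending k))" using tail[OF k(1)] k(3) by auto
    then show "q \<in> set (drop t (pending (Suc K)))"
      using stable[OF k(2)] by simp
  next
    fix q assume q: "q \<in> set (drop t (pending (Suc K)))"
    have "q \<in> set (pending l)" if "fst q < l" for l
    proof (cases "Suc K \<le> l")
      case True
      then show ?thesis using stable[of l] q by (metis in_set_dropD)
    next
      case False
      then show ?thesis using pending_mono[OF _ in_set_dropD[OF q]] that by auto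
    qed
    then show "q \<in> free_minus"
      using pending_minus[OF in_set_dropD[OF q]] by (simp add: free_minus_iff)
  qed
  then show "finite free_minus" by simp
  have "int (card free_minus) = int (length (pending (Suc K))) - int t"
    using minus stable[of "Suc K"] distinct_pending[of "Suc K"]
    by (simp add: distinct_card of_nat_diff del: pending.simps length_pending_Suc)
  then show "int (card free_plus) - int (card free_minus) =
      int t + (\<Sum>k<K. int (phi k) - int (eps k))"
    using pending_balance[of "Suc K"] tail[of K] plus by simp
qed

end

text \<open>Forward by rule induction: for a pair that is not a match,
  \<open>matches_outermost\<close> yields a partner inside the gap which would also have to cancel
  within the gap, against uniqueness of partners. Backward by induction on the number of enclosed
  signs, \<open>matches_nested\<close> providing the premise of the rule.\<close>

lemma cancels_iff_matches:
  fixes T :: "'l pattern" and Y :: "'l wall" and i :: idx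
  defines "ep \<equiv> \<lambda>k. col_eps T i (Y k)" and "ph \<equiv> \<lambda>k. col_phi T i (Y k)"
  shows "cancels T i Y p q \<longleftrightarrow> sign_word.matches ep ph p q"
proof -
  interpret sign_word ep ph .
  have plus: "plus_signs T i Y = plus"
    unfolding plus_signs_def plus_def by (simp add: ep_def ph_def)
  have minus: "minus_signs T i Y = minus"
    unfolding minus_signs_def minus_def by (simp add: ep_def)
  show ?thesis
  proof
    assume "cancels T i Y p q"
    then show "matches p q"
    proof induction
      case (1 p q)
      show ?case
      proof (rule ccontr)
        assume not: "\<not> matches p q"
        have pq: "p \<in> plus" "q \<in> minus" using 1 plus minus by auto
        from matches_outermost[OF this 1(3) not] show False
        proof (elim disjE exE conjE)
          fix p' assume m: "matches p' q" "left_of p p'"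
          obtain s where s: "left_of s q" "matches p' s \<or> matches s p'"
            using 1(4)[of p'] matchesD(1,4)[OF m(1)] m(2) plus by blast
          then have "matches p' s"
            using matchesD(1)[OF m(1)] matchesD(2)[of s p'] plus_minus_disjoint by blast
          then show False
            using m(1) s(1) matches_functional left_of_irrefl by blast
        next
          fix q' assume m: "matches p q'" "left_of q' q"
          obtain s where s: "left_of p s" "matches q' s \<or> matches s q'"
            using 1(4)[of q'] matchesD(2,4)[OF m(1)] m(2) minus by blast
          then have "matches s q'"
            using matchesD(2)[OF m(1)] matchesD(1)[of q' s] plus_minus_disjoint by blast
          then show False
            using m(1) s(1) matches_injective left_of_irrefl by blast
        qed
      qed
    qed
  next
    assume "matches p q"
    then show "cancels T i Y p q"
    proof (induction "card {r \<in> plus \<union> minus. left_of p r \<and> left_of r q}"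
        arbitrary: p q rule: less_induct)
      case less
      show ?case
      proof (rule cancels.intros)
        show "p \<in> plus_signs T i Y" "q \<in> minus_signs T i Y" "left_of p q"
          using matchesD[OF less.prems] plus minus by auto
        fix r assume r: "r \<in> plus_signs T i Y \<union> minus_signs T i Y" "left_of p r" "left_of r q"
        then obtain s where s: "left_of p s" "left_of s q" "matches r s \<or> matches s r"
          using matches_nested[OF less.prems, of r] plus minus by blast
        have IH: "cancels T i Y a b" if ab: "matches a b" "left_of p a" "left_of b q" for a b
        proof (rule less.hyps[OF _ ab(1)])
          have a: "a \<in> plus" "left_of a b" using matchesD[OF ab(1)] by auto
          show "card {r \<in> plus \<union> minus. left_of a r \<and> left_of r b}
              < card {r \<in> plus \<union> minus. left_of p r \<and> left_of r q}"
            by (rule psubset_card_mono[OF finite_between])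
              (use ab a left_of_trans left_of_irrefl in blast)
        qed
        show "\<exists>s. left_of p s \<and> left_of s q \<and> (cancels T i Y r s \<or> cancels T i Y s r)"
          using s r IH by blast
      qed
    qed
  qed
qed

section \<open>Walls over a crystal of columns\<close>

lemma iter_partial_0: "iter_partial g 0 y = Some y"
  by (simp add: iter_partial_def)

lemma iter_partial_Suc: "iter_partial g (Suc n) y = Option.bind (g y) (iter_partial g n)"
proof -
  have "((\<lambda>u. Option.bind u g) ^^ n) None = None"
    by (induction n) auto
  then show ?thesis
    by (cases "g y") (simp_all add: iter_partial_def funpow_Suc_right del: funpow.simps)
qed

lemma string_end:
  assumes "g y = None"
  shows "{n. iter_partial g n y \<noteq> None} = {0}"
proof -
  have "iter_partial g n y \<noteq> None \<longleftrightarrow> n = 0" for n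
    using assms by (cases n) (simp_all add: iter_partial_0 iter_partial_Suc)
  then show ?thesis by auto
qed

lemma string_step:
  assumes "g y = Some y'"
  shows "{n. iter_partial g n y \<noteq> None} = insert 0 (Suc ` {n. iter_partial g n y' \<noteq> None})"
proof -
  have "iter_partial g n y \<noteq> None \<longleftrightarrow> n = 0 \<or> (\<exists>m. n = Suc m \<and> iter_partial g m y' \<noteq> None)" for n
    using assms by (cases n) (simp_all add: iter_partial_0 iter_partial_Suc)
  then show ?thesis by auto
qed

lemma Max_string_step:
  assumes "g y = Some y'" "finite {n. iter_partial g n y' \<noteq> None}"
  shows "Max {n. iter_partial g n y \<noteq> None} = Suc (Max {n. iter_partial g n y' \<noteq> None})"
proof -
  let ?S = "{n. iter_partial g n y' \<noteq> None}"
  have "0 \<in> ?S" by (simp add: iter_partial_0)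
  then have "Max (insert 0 (Suc ` ?S)) = Max (Suc ` ?S)"
    using assms(2) by (subst Max_insert) auto
  also have "\<dots> = Suc (Max ?S)"
    using assms(2) \<open>0 \<in> ?S\<close> by (metis empty_iff mono_Max_commute mono_Suc)
  finally show ?thesis by (simp only: string_step[of g, OF assms(1)])
qed

section \<open>Contents of columns and weights of walls\<close>

definition content :: "'l pattern \<Rightarrow> 'l column \<Rightarrow> 'l column \<Rightarrow> idx \<Rightarrow> int" where
  "content T g y j =
     int (card {x \<in> y - g. color T x = j}) - int (card {x \<in> g - y. color T x = j})"

text \<open>A new block either enters \<open>y - g\<close> or leaves \<open>g - y\<close>; both
  raise the signed count of its color by one.\<close>

lemma content_insert:
  assumes "x \<notin> y" "finite (y - g)" "finite (g - y)"
  shows "content T g (insert x y) j = content T g y j + of_bool (color T x = j)"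
proof (cases "x \<in> g")
  case True
  have "{z \<in> insert x y - g. color T z = j} = {z \<in> y - g. color T z = j}"
    using True by auto
  moreover have "{z \<in> g - y. color T z = j} =
      (if color T x = j then insert x else id) {z \<in> g - insert x y. color T z = j}"
    using True assms(1) by auto
  moreover have "finite {z \<in> g - insert x y. color T z = j}"
    using assms(3) by (auto elim!: rev_finite_subset)
  ultimately show ?thesis by (simp add: content_def)
next
  case False
  have "{z \<in> g - insert x y. color T z = j} = {z \<in> g - y. color T z = j}"
    using False by auto
  moreover have "{z \<in> insert x y - g. color T z = j} =
      (if color T x = j then insert x else id) {z \<in> y - g. color T z = j}"
    using False assms(1) by auto
  moreover have "finite {z \<in> y - g. color T z = j}"
    using assms(2) by (auto elim!: rev_finite_subset)
  ultimately show ?thesis using assms(1) by (simp add: content_def)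
qed

lemma UNIV_idx: "(UNIV :: idx set) = {I0, I1, I2, I3, I4}"
  by (auto intro: idx.exhaust)

lemma card_columns:
  assumes "\<And>k. finite (A k)" "\<And>k. K \<le> k \<Longrightarrow> A k = {}"
  shows "card {(k :: nat, x). x \<in> A k} = (\<Sum>k<K. card (A k))"
proof -
  have "{(k, x). x \<in> A k} = (SIGMA k:{..<K}. A k)"
    using assms(2) by (auto simp: not_le[symmetric])
  then show ?thesis using assms(1) by simp
qed

lemma wall_content_eq_sum:
  assumes "\<And>k. finite (Y k - g)" "\<And>k. finite (g - Y k)" "\<And>k. K \<le> k \<Longrightarrow> Y k = g"
  shows "wall_content T g Y j = (\<Sum>k<K. content T g (Y k) j)"
proof -
  have fin: "finite {x \<in> Y k - g. color T x = j}" "finite {x \<in> g - Y k. color T x = j}" for k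
    by (rule finite_subset[OF _ assms(1)[of k]], force) (rule finite_subset[OF _ assms(2)[of k]], force)
  have "card {(k, x). x \<in> {x \<in> Y k - g. color T x = j}} = (\<Sum>k<K. card {x \<in> Y k - g. color T x = j})"
    by (rule card_columns[OF fin(1)]) (simp add: assms(3))
  moreover have "card {(k, x). x \<in> {x \<in> g - Y k. color T x = j}} = (\<Sum>k<K. card {x \<in> g - Y k. color T x = j})"
    by (rule card_columns[OF fin(2)]) (simp add: assms(3))
  ultimately show ?thesis
    by (simp add: wall_content_def content_def sum_subtractf)
qed

lemma wall_wt_eq:
  "wall_wt T lam g Y =
     ((\<lambda>i. fst lam i - (\<Sum>j\<in>UNIV. wall_content T g Y j * cartan T i j)),
      snd lam - wall_content T g Y I0)"
  by (auto simp: wall_wt_def UNIV_idx prod_eq_iff int_scale_def simple_root_def fun_eq_iff)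

lemma wall_wt_raise:
  assumes "\<And>j. wall_content T g Y' j = wall_content T g Y j + of_bool (i = j)"
  shows "wall_wt T lam g Y' = wall_wt T lam g Y - simple_root (cartan T) i"
  unfolding wall_wt_eq
  by (cases i) (auto simp: UNIV_idx prod_eq_iff simple_root_def fun_eq_iff assms algebra_simps)

text \<open>The interface between walls and columns. Besides the crystal axioms on single columns it
  contains the strings of the ground-state column, which express level 1, and with
  \<open>col_weight\<close> the weight of a column relative to \<open>g\<close>; the finiteness
  premises there make \<open>card\<close> a true count.\<close>

locale column_crystal =
  fixes T :: "'l pattern" and g :: "'l column"
  assumes col_f_insert: "young_column T y \<Longrightarrow> col_f T i y = Some y' \<Longrightarrow>
      \<exists>x. x \<notin> y \<and> color T x = i \<and> y' = insert x y \<and> young_column T y'"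
    and col_e_young: "young_column T y \<Longrightarrow> col_e T i y = Some y' \<Longrightarrow> young_column T y'"
    and col_f_iff_col_e: "young_column T y \<Longrightarrow> young_column T y' \<Longrightarrow>
      col_f T i y = Some y' \<longleftrightarrow> col_e T i y' = Some y"
    and finite_f_string: "young_column T y \<Longrightarrow> finite {n. iter_partial (col_f T i) n y \<noteq> None}"
    and finite_e_string: "young_column T y \<Longrightarrow> finite {n. iter_partial (col_e T i) n y \<noteq> None}"
    and ex_energy: "\<exists>H. is_energy_function T H"
    and col_phi_ground: "col_phi T i g = of_bool (i = I0)"
    and col_eps_ground: "col_eps T i g = of_bool (i = I0)"
    and col_weight: "young_column T y \<Longrightarrow> finite (y - g) \<Longrightarrow> finite (g - y) \<Longrightarrow>
      int (col_phi T i y) - int (col_eps T i y) = - (\<Sum>j\<in>UNIV. content T g y j * cartan T i j)"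
begin

lemma col_f_young: "young_column T y \<Longrightarrow> col_f T i y = Some y' \<Longrightarrow> young_column T y'"
  using col_f_insert by blast

lemma col_f_string:
  assumes "young_column T y" "col_f T i y = Some y'"
  shows "col_phi T i y = Suc (col_phi T i y')" "col_eps T i y' = Suc (col_eps T i y)"
proof -
  have y': "young_column T y'" using assms col_f_young by blast
  then have e: "col_e T i y' = Some y" using assms col_f_iff_col_e by blast
  show "col_phi T i y = Suc (col_phi T i y')"
    unfolding col_phi_def by (rule Max_string_step[OF assms(2) finite_f_string[OF y']])
  show "col_eps T i y' = Suc (col_eps T i y)"
    unfolding col_eps_def by (rule Max_string_step[OF e finite_e_string[OF assms(1)]])
qed

lemma energy_rule:
  assumes "young_column T a" "young_column T b" "tensor_f T i (a, b) = Some (a', b')"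
  shows "energy T (col_class a') (col_class b') - energy T (col_class a) (col_class b) =
          (if i \<noteq> I0 then 0 else if col_phi T I0 a > col_eps T I0 b then -1 else 1)"
proof -
  have "is_energy_function T (energy T)"
    unfolding energy_def using ex_energy by (rule someI_ex)
  then show ?thesis using assms unfolding is_energy_function_def by blast
qed

section \<open>Signatures of walls and the column on which an operator acts\<close>

abbreviation word_plus where
  "word_plus i Y \<equiv> sign_word.free_plus (\<lambda>k. col_eps T i (Y k)) (\<lambda>k. col_phi T i (Y k))"

abbreviation word_minus where
  "word_minus i Y \<equiv> sign_word.free_minus (\<lambda>k. col_eps T i (Y k)) (\<lambda>k. col_phi T i (Y k))"

abbreviation pending_count where
  "pending_count i Y k \<equiv>
     length (sign_word.pending (\<lambda>k. col_eps T i (Y k)) (\<lambda>k. col_phi T i (Y k)) k)"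

lemma wall_plus_eq: "wall_plus T i Y = word_plus i Y"
  unfolding wall_plus_def plus_signs_def sign_word.free_plus_def sign_word.plus_def
    cancels_iff_matches ..

lemma wall_minus_eq: "wall_minus T i Y = word_minus i Y"
  unfolding wall_minus_def minus_signs_def sign_word.free_minus_def sign_word.minus_def
    cancels_iff_matches ..

text \<open>The column of the leftmost surviving plus sign, expressed by stack lengths instead of
  \<open>Max\<close>; in this form the inequalities of the tensor product rule can be read
  off.\<close>

definition acts_at :: "idx \<Rightarrow> 'l wall \<Rightarrow> nat \<Rightarrow> bool" where
  "acts_at i Y k \<longleftrightarrow> pending_count i Y k < col_phi T i (Y k) \<and>
     (\<forall>l>k. col_phi T i (Y l) \<le> pending_count i Y l)"

lemma young_wallD:
  assumes "young_wall T g Y"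
  shows "young_column T (Y k)" "finite (Y k - g)" "finite (g - Y k)" "\<exists>K. \<forall>k\<ge>K. Y k = g"
proof -
  let ?D = "{(k, x). (x \<in> Y k) \<noteq> (x \<in> g)}"
  have fin: "finite ?D" and "young_column T (Y k)" using assms by (auto simp: young_wall_def)
  then show "young_column T (Y k)" by blast
  have "finite (Pair k -` ?D)" using fin by (rule finite_vimageI) (simp add: inj_on_def)
  then show "finite (Y k - g)" "finite (g - Y k)"
    by (rule finite_subset[rotated], force)+
  from fin have "finite (fst ` ?D)" by (rule finite_imageI)
  then obtain K where K: "\<forall>k\<in>fst ` ?D. k < K"
    unfolding finite_nat_set_iff_bounded by (rule exE)
  have "Y k = g" if "k \<ge> K" for k
  proof (rule ccontr)
    assume "Y k \<noteq> g"
    then obtain x where "(k, x) \<in> ?D" by auto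
    then have "k \<in> fst ` ?D" by (rule image_eqI[rotated]) simp
    then have "k < K" using K by (rule bspec[rotated])
    with that show False by simp
  qed
  then show "\<exists>K. \<forall>k\<ge>K. Y k = g" by blast
qed

lemma young_wall_update:
  assumes Y: "young_wall T g Y" and "young_column T y'"
    and "finite (y' - g)" "finite (g - y')"
  shows "young_wall T g (Y(k := y'))"
proof -
  have "{(l, x). (x \<in> (Y(k := y')) l) \<noteq> (x \<in> g)} \<subseteq>
      {(l, x). (x \<in> Y l) \<noteq> (x \<in> g)} \<union> {k} \<times> ((y' - g) \<union> (g - y'))"
    by (auto split: if_splits)
  moreover have "finite \<dots>" using assms by (auto simp: young_wall_def)
  ultimately have "finite {(l, x). (x \<in> (Y(k := y')) l) \<noteq> (x \<in> g)}"
    by (rule finite_subset)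
  then show ?thesis using assms by (auto simp: young_wall_def)
qed

lemma tail_signs:
  assumes "young_wall T g Y"
  obtains K where "\<And>k. K \<le> k \<Longrightarrow> Y k = g"
    "\<And>k. K \<le> k \<Longrightarrow> col_eps T i (Y k) = of_bool (i = I0) \<and> col_phi T i (Y k) = of_bool (i = I0)"
  using young_wallD(4)[OF assms] col_eps_ground col_phi_ground by metis

lemma finite_signs:
  assumes "young_wall T g Y"
  shows "finite (word_plus i Y)" "finite (word_minus i Y)"
  using tail_signs[OF assms, of i] sign_word.finite_free_plus sign_word.finite_free_minus by metis+

text \<open>The columns before the tail contribute their own \<open>phi - eps\<close>; the extra 1
  for \<open>i = I0\<close> coming from the tail is the coefficient of
  \<open>fund_weight I0\<close>.\<close>

lemma wall_phi_eps:
  assumes Y: "young_wall T g Y"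
  shows "int (card (wall_plus T i Y)) - int (card (wall_minus T i Y)) =
     coroot_pairing i (wall_wt T (fund_weight I0) g Y)"
proof -
  obtain K where K: "\<And>k. K \<le> k \<Longrightarrow> Y k = g"
    "\<And>k. K \<le> k \<Longrightarrow> col_eps T i (Y k) = of_bool (i = I0) \<and> col_phi T i (Y k) = of_bool (i = I0)"
    using tail_signs[OF Y] by metis
  have content: "wall_content T g Y j = (\<Sum>k<K. content T g (Y k) j)" for j
    by (rule wall_content_eq_sum) (fact young_wallD(2,3)[OF Y] K(1))+
  have "int (card (wall_plus T i Y)) - int (card (wall_minus T i Y)) =
      of_bool (i = I0) + (\<Sum>k<K. int (col_phi T i (Y k)) - int (col_eps T i (Y k)))"
    unfolding wall_plus_eq wall_minus_eq
    by (subst sign_word.free_signs_balance[where t = "of_bool (i = I0)" and K = K]) (use K in auto)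
  also have "\<dots> = of_bool (i = I0) - (\<Sum>k<K. \<Sum>j\<in>UNIV. content T g (Y k) j * cartan T i j)"
    using col_weight young_wallD[OF Y] by (simp add: sum_negf)
  also have "(\<Sum>k<K. \<Sum>j\<in>UNIV. content T g (Y k) j * cartan T i j) =
      (\<Sum>j\<in>UNIV. wall_content T g Y j * cartan T i j)"
    unfolding content sum_distrib_right
    by (rule sum.swap)
  finally show ?thesis
    by (simp add: coroot_pairing_def wall_wt_eq fund_weight_def)
qed

lemma acts_at_Max:
  assumes "young_wall T g Y" "wall_plus T i Y \<noteq> {}"
  shows "acts_at i Y (Max (fst ` wall_plus T i Y))"
  using assms(2) Max_in[of "fst ` wall_plus T i Y"] Max_ge[of "fst ` wall_plus T i Y"]
    finite_signs(1)[OF assms(1), of i]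
  unfolding acts_at_def wall_plus_eq
  by (auto simp: sign_word.free_plus_nonempty_column not_le[symmetric] simp del: Max_ge)

lemma Max_acts_at:
  assumes "young_wall T g Y" "acts_at i Y k"
  shows "wall_plus T i Y \<noteq> {}" "Max (fst ` wall_plus T i Y) = k"
proof -
  have k: "k \<in> fst ` wall_plus T i Y"
    using assms(2) unfolding acts_at_def wall_plus_eq sign_word.free_plus_nonempty_column by blast
  then show "wall_plus T i Y \<noteq> {}" by blast
  have "l \<le> k" if "l \<in> fst ` wall_plus T i Y" for l
    using that assms(2) unfolding acts_at_def wall_plus_eq sign_word.free_plus_nonempty_column
    by (meson not_le)
  then show "Max (fst ` wall_plus T i Y) = k"
    using k finite_signs(1)[OF assms(1), of i] by (intro Max_eqI) (auto simp: wall_plus_eq)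
qed

lemma wall_F_iff:
  assumes Y: "young_wall T g Y"
  shows "wall_F T i Y = Some Y' \<longleftrightarrow>
     (\<exists>k y'. acts_at i Y k \<and> col_f T i (Y k) = Some y' \<and> Y' = Y(k := y'))"
proof
  assume "wall_F T i Y = Some Y'"
  then show "\<exists>k y'. acts_at i Y k \<and> col_f T i (Y k) = Some y' \<and> Y' = Y(k := y')"
    using acts_at_Max[OF Y] by (auto simp: wall_F_def Let_def split: if_splits)
next
  assume "\<exists>k y'. acts_at i Y k \<and> col_f T i (Y k) = Some y' \<and> Y' = Y(k := y')"
  then show "wall_F T i Y = Some Y'"
    using Max_acts_at[OF Y] by (auto simp: wall_F_def Let_def)
qed

lemma wall_F_young:
  assumes Y: "young_wall T g Y" and k: "col_f T i (Y k) = Some y'"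
  shows "young_wall T g (Y(k := y'))"
proof -
  obtain x where "y' = insert x (Y k)" "young_column T y'"
    using col_f_insert[OF young_wallD(1)[OF Y] k] by blast
  then show ?thesis
    using young_wallD(2,3)[OF Y, of k] by (intro young_wall_update Y) (auto simp: insert_Diff_if)
qed

lemma wall_F_content:
  assumes Y: "young_wall T g Y" and k: "col_f T i (Y k) = Some y'"
  shows "content T g y' j = content T g (Y k) j + of_bool (i = j)"
    and "wall_content T g (Y(k := y')) j = wall_content T g Y j + of_bool (i = j)"
proof -
  obtain x where x: "x \<notin> Y k" "color T x = i" "y' = insert x (Y k)"
    using col_f_insert[OF young_wallD(1)[OF Y] k] by blast
  then show c: "content T g y' j = content T g (Y k) j + of_bool (i = j)"
    using content_insert[OF x(1) young_wallD(2,3)[OF Y]] by simp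
  obtain K where K: "\<And>k. K \<le> k \<Longrightarrow> Y k = g" using young_wallD(4)[OF Y] by blast
  define L where "L = max K (Suc k)"
  have "k < L" by (simp add: L_def)
  have Y': "young_wall T g (Y(k := y'))" using wall_F_young[OF assms] .
  have "wall_content T g (Y(k := y')) j = (\<Sum>l<L. content T g ((Y(k := y')) l) j)"
    using young_wallD(2,3)[OF Y'] K by (intro wall_content_eq_sum) (auto simp: L_def)
  also have "\<dots> = (\<Sum>l<L. content T g (Y l) j + (if l = k then of_bool (i = j) else 0))"
    using c by (intro sum.cong) auto
  also have "\<dots> = (\<Sum>l<L. content T g (Y l) j) + of_bool (i = j)"
    using \<open>k < L\<close> by (simp add: sum.distrib sum.delta)
  also have "(\<Sum>l<L. content T g (Y l) j) = wall_content T g Y j"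
    using young_wallD(2,3)[OF Y] K by (intro wall_content_eq_sum[symmetric]) (auto simp: L_def)
  finally show "wall_content T g (Y(k := y')) j = wall_content T g Y j + of_bool (i = j)" .
qed

lemma wall_F_signs:
  assumes Y: "young_wall T g Y" and at: "acts_at i Y k" and k: "col_f T i (Y k) = Some y'"
  defines "p \<equiv> (k, col_eps T i (Y k))"
  shows "p \<in> wall_plus T i Y" "wall_plus T i (Y(k := y')) = wall_plus T i Y - {p}"
    and "p \<notin> wall_minus T i Y" "wall_minus T i (Y(k := y')) = insert p (wall_minus T i Y)"
    and "\<And>q. q \<in> wall_minus T i Y \<Longrightarrow> k \<le> fst q"
proof -
  note s = col_f_string[OF young_wallD(1)[OF Y] k]
  have e: "(\<lambda>l. col_eps T i ((Y(k := y')) l)) = (\<lambda>l. col_eps T i (Y l))(k := Suc (col_eps T i (Y k)))"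
    and ph: "(\<lambda>l. col_phi T i ((Y(k := y')) l)) = (\<lambda>l. col_phi T i (Y l))(k := col_phi T i (Y k) - 1)"
    using s by auto
  note at' = at[unfolded acts_at_def, THEN conjunct1] at[unfolded acts_at_def, THEN conjunct2, rule_format]
  note r = sign_word.raise_sign[OF at']
  show "p \<in> wall_plus T i Y" "wall_plus T i (Y(k := y')) = wall_plus T i Y - {p}"
    and "p \<notin> wall_minus T i Y" "wall_minus T i (Y(k := y')) = insert p (wall_minus T i Y)"
    and "\<And>q. q \<in> wall_minus T i Y \<Longrightarrow> k \<le> fst q"
    unfolding wall_plus_eq wall_minus_eq e ph p_def by (simp_all only: r not_False_eq_True)
qed

text \<open>The raised sign is a surviving minus sign of column \<open>k\<close>, and none lies
  further right, so \<open>E\<close> selects the column on which \<open>F\<close> has acted.\<close>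

lemma wall_E_if_F:
  assumes Y: "young_wall T g Y" and F: "wall_F T i Y = Some Y'"
  shows "wall_E T i Y' = Some Y"
proof -
  obtain k y' where k: "acts_at i Y k" "col_f T i (Y k) = Some y'" "Y' = Y(k := y')"
    using F wall_F_iff[OF Y] by blast
  note s = wall_F_signs[OF Y k(1,2)]
  have "finite (wall_minus T i Y)" using finite_signs(2)[OF Y] by (simp add: wall_minus_eq)
  then have "Min (fst ` wall_minus T i Y') = k"
    using s(5) unfolding k(3) s(4) by (intro Min_eqI) auto
  moreover have "col_e T i y' = Some (Y k)"
    using col_f_iff_col_e col_f_young k(2) young_wallD(1)[OF Y] by blast
  moreover have "wall_minus T i Y' \<noteq> {}" using s(4) k(3) by simp
  ultimately show ?thesis using k(3) by (simp add: wall_E_def Let_def)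
qed

text \<open>With this inversion every axiom about an arrow of \<open>E\<close> becomes one about the
  arrow of \<open>F\<close> that starts at \<open>Y'\<close>.\<close>

lemma wall_F_if_E:
  assumes Y: "young_wall T g Y" and E: "wall_E T i Y = Some Y'"
  shows "young_wall T g Y'" "wall_F T i Y' = Some Y"
proof -
  define k where "k = Min (fst ` wall_minus T i Y)"
  obtain y' where ne: "wall_minus T i Y \<noteq> {}" and e: "col_e T i (Y k) = Some y'"
      and Y': "Y' = Y(k := y')"
    using E by (auto simp: wall_E_def Let_def k_def split: if_splits)
  have fin: "finite (wall_minus T i Y)" using finite_signs(2)[OF Y] by (simp add: wall_minus_eq)
  have "k \<in> fst ` wall_minus T i Y"
    using ne fin by (simp add: k_def)
  then obtain q where q: "q \<in> wall_minus T i Y" "fst q = k"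
    by blast
  have min: "k \<le> fst q'" if "q' \<in> wall_minus T i Y" for q'
    using that fin by (auto simp: k_def)
  have y': "young_column T y'" using col_e_young[OF young_wallD(1)[OF Y] e] .
  have f: "col_f T i y' = Some (Y k)"
    using col_f_iff_col_e[OF y' young_wallD(1)[OF Y]] e by blast
  obtain x where x: "x \<notin> y'" "Y k = insert x y'"
    using col_f_insert[OF y' f] by blast
  have "finite (y' - g)" "finite (g - y')"
    using young_wallD(2,3)[OF Y, of k] x(2) finite_subset[of "g - y'" "insert x (g - Y k)"]
    by (auto simp: insert_Diff_if split: if_splits)
  then show W: "young_wall T g Y'" unfolding Y' by (intro young_wall_update Y y')
  note s = col_f_string[OF y' f]
  have es: "(\<lambda>l. col_eps T i (Y' l)) = (\<lambda>l. col_eps T i (Y l))(k := col_eps T i (Y k) - 1)"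
    and ps: "(\<lambda>l. col_phi T i (Y' l)) = (\<lambda>l. col_phi T i (Y l))(k := Suc (col_phi T i (Y k)))"
    using s Y' by auto
  note low = sign_word.lower_sign[OF q(1)[unfolded wall_minus_eq], unfolded q(2), folded es ps]
  have "acts_at i Y' k"
    unfolding acts_at_def using low min by (auto simp: wall_minus_eq)
  then show "wall_F T i Y' = Some Y"
    using f Y' unfolding wall_F_iff[OF W] by (intro exI[of _ k] exI[of _ "Y k"]) auto
qed

text \<open>An equivalence, because the direction from \<open>Y'\<close> to \<open>Y\<close> is what
  closes the proper walls under \<open>E\<close>.\<close>

lemma proper_iff_F:
  assumes Y: "young_wall T g Y" and F: "wall_F T i Y = Some Y'"
  shows "Y \<in> proper_walls T g \<longleftrightarrow> Y' \<in> proper_walls T g"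
proof -
  obtain k y' where k: "acts_at i Y k" "col_f T i (Y k) = Some y'" "Y' = Y(k := y')"
    using F wall_F_iff[OF Y] by blast
  have W: "young_wall T g Y'" using wall_F_young[OF Y k(2)] k(3) by simp
  note yc = young_wallD(1)[OF Y]
  have zc: "zero_content T g y' = zero_content T g (Y k) + of_bool (i = I0)"
    using wall_F_content(1)[OF Y k(2), of I0] by (simp add: content_def zero_content_def)
  have "energy T (col_class (Y' (Suc l))) (col_class (Y' l))
           + zero_content T g (Y' (Suc l)) - zero_content T g (Y' l) =
        energy T (col_class (Y (Suc l))) (col_class (Y l))
           + zero_content T g (Y (Suc l)) - zero_content T g (Y l)" for l
  proof -
    consider "l = k" | "Suc l = k" | "l \<noteq> k" "Suc l \<noteq> k" by blast
    then show ?thesis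
    proof cases
      case 1
      have "col_phi T i (Y (Suc k)) \<le> pending_count i Y (Suc k)"
        using k(1) by (auto simp: acts_at_def)
      \<comment> \<open>The plus signs of column \<open>k\<close> exhaust the stack, so only its own
        minus signs wait after it.\<close>
      also have "\<dots> = col_eps T i (Y k)"
        using k(1) by (simp add: acts_at_def sign_word.length_pending_Suc)
      finally have le: "col_phi T i (Y (Suc k)) \<le> col_eps T i (Y k)" .
      then have "tensor_f T i (Y (Suc k), Y k) = Some (Y (Suc k), y')"
        using k(2) by (simp add: tensor_f_def)
      from energy_rule[OF yc yc this] show ?thesis
        using 1 k(3) zc le by (cases "i = I0") auto
    next
      case 2
      \<comment> \<open>All minus signs of column \<open>l\<close> still wait when the next column
        acts.\<close>
      have "col_eps T i (Y l) \<le> pending_count i Y (Suc l)"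
        by (simp add: sign_word.length_pending_Suc)
      also have "\<dots> < col_phi T i (Y k)" using k(1) 2 by (auto simp: acts_at_def)
      finally have lt: "col_eps T i (Y l) < col_phi T i (Y k)" .
      then have "tensor_f T i (Y k, Y l) = Some (y', Y l)"
        using k(2) by (simp add: tensor_f_def)
      from energy_rule[OF yc yc this] show ?thesis
        using 2 k(3) zc lt by (cases "i = I0") auto
    qed (use k(3) in auto)
  qed
  then show ?thesis using Y W by (simp only: proper_walls_def mem_Collect_eq)
qed

lemma proper_young: "Y \<in> proper_walls T g \<Longrightarrow> young_wall T g Y"
  by (simp add: proper_walls_def)

text \<open>The last two equations are the rules for \<open>E\<close>, read from the target
  \<open>Y'\<close> back to \<open>Y\<close>.\<close>

lemma wall_F_structure:
  assumes Y: "young_wall T g Y" and F: "wall_F T i Y = Some Y'"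
  shows "wall_wt T lam g Y' = wall_wt T lam g Y - simple_root (cartan T) i"
    and "wall_eps T i Y' = wall_eps T i Y + Fin 1"
    and "wall_phi T i Y' = wall_phi T i Y - Fin 1"
    and "wall_phi T i Y = wall_phi T i Y' + Fin 1"
    and "wall_eps T i Y = wall_eps T i Y' - Fin 1"
proof -
  obtain k y' where k: "acts_at i Y k" "col_f T i (Y k) = Some y'" "Y' = Y(k := y')"
    using F wall_F_iff[OF Y] by blast
  show "wall_wt T lam g Y' = wall_wt T lam g Y - simple_root (cartan T) i"
    using wall_F_content(2)[OF Y k(2)] k(3) by (intro wall_wt_raise) simp
  note s = wall_F_signs[OF Y k(1,2), folded k(3)]
  have fin: "finite (wall_plus T i Y)" "finite (wall_minus T i Y)"
    using finite_signs[OF Y] by (simp_all add: wall_plus_eq wall_minus_eq)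
  have "card (wall_minus T i Y') = Suc (card (wall_minus T i Y))"
    using s(3,4) fin(2) by simp
  moreover have "card (wall_plus T i Y) = Suc (card (wall_plus T i Y'))"
    using s(1,2) fin(1) by (metis card_Suc_Diff1)
  ultimately show "wall_eps T i Y' = wall_eps T i Y + Fin 1"
    "wall_phi T i Y' = wall_phi T i Y - Fin 1"
    "wall_phi T i Y = wall_phi T i Y' + Fin 1"
    "wall_eps T i Y = wall_eps T i Y' - Fin 1"
    by (simp_all add: wall_eps_def wall_phi_def)
qed

theorem proper_walls_crystal:
  "affine_crystal (cartan T) (proper_walls T g) (wall_wt T (fund_weight I0) g)
     (wall_E T) (wall_F T) (wall_eps T) (wall_phi T)"
  unfolding affine_crystal_def
proof (intro allI ballI conjI impI)
  fix i Y assume Y: "Y \<in> proper_walls T g"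
  note W = proper_young[OF Y]
  show "wall_eps T i Y \<noteq> Pinf" "wall_phi T i Y \<noteq> Pinf" by (simp_all add: wall_eps_def wall_phi_def)
  show "wall_phi T i Y = wall_eps T i Y + Fin (coroot_pairing i (wall_wt T (fund_weight I0) g Y))"
    using wall_phi_eps[OF W, of i] by (simp add: wall_eps_def wall_phi_def)
  show "wall_E T i Y = None" "wall_F T i Y = None" if "wall_phi T i Y = Minf"
    using that by (simp_all add: wall_phi_def)
  fix Y'
  {
    assume E: "wall_E T i Y = Some Y'"
    note F = wall_F_if_E[OF W E]
    show "Y' \<in> proper_walls T g" using proper_iff_F[OF F] Y by blast
    note s = wall_F_structure[OF F]
    show "wall_wt T (fund_weight I0) g Y' = wall_wt T (fund_weight I0) g Y + simple_root (cartan T) i"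
      by (simp add: s(1))
    show "wall_eps T i Y' = wall_eps T i Y - Fin 1" "wall_phi T i Y' = wall_phi T i Y + Fin 1"
      by (fact s)+
  next
    assume F: "wall_F T i Y = Some Y'"
    show "Y' \<in> proper_walls T g" using proper_iff_F[OF W F] Y by blast
    show "wall_wt T (fund_weight I0) g Y' = wall_wt T (fund_weight I0) g Y - simple_root (cartan T) i"
      "wall_eps T i Y' = wall_eps T i Y + Fin 1" "wall_phi T i Y' = wall_phi T i Y - Fin 1"
      by (fact wall_F_structure[OF W F])+
  next
    assume "Y' \<in> proper_walls T g"
    then show "wall_F T i Y = Some Y' \<longleftrightarrow> wall_E T i Y' = Some Y"
      using wall_E_if_F[OF W] wall_F_if_E(2)[OF proper_young] by blast
  }
qed

end

section \<open>Columns given by finite tables\<close>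

text \<open>
  The edge \<open>(n, x, m, k, b)\<close> says that adding the block \<open>x\<close> to the \<open>n\<close>-th representative gives
  the \<open>m\<close>-th representative shifted by \<open>\<sigma>\<^sup>k\<close>; the flag \<open>b\<close> marks the edges that are arrows of the
  crystal graph.
\<close>

type_synonym 'l edge = "nat \<times> 'l block \<times> nat \<times> int \<times> bool"

section \<open>Executable conditions on the tables\<close>

definition shift :: "int \<Rightarrow> 'l block \<Rightarrow> 'l block" where
  "shift k x = (fst x, snd x + k)"

text \<open>
  Every pre-Young column is, up to a unique power of \<open>\<sigma>\<close>, of the form \<open>base L\<close> where \<open>L\<close> misses
  a block of index 0 and has only blocks of index 0 and 1.
\<close>

definition base :: "'l block list \<Rightarrow> 'l column" where
  "base L = {x. snd x < 0} \<union> set L"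

definition supports :: "('l \<Rightarrow> 'l block list) \<Rightarrow> 'l block \<Rightarrow> 'l block list" where
  "supports supp x = map (shift (snd x)) (supp (fst x))"

text \<open>The list \<open>x # xs\<close> is read from top to bottom: \<open>x\<close> may only rest on elements of \<open>xs\<close>.\<close>

fun ideals :: "('a \<Rightarrow> 'a list) \<Rightarrow> 'a list \<Rightarrow> 'a list list" where
  "ideals s [] = [[]]"
| "ideals s (x # xs) =
     (let I = ideals s xs; zs = filter (\<lambda>z. z \<in> set xs) (s x)
      in I @ map ((#) x) (filter (\<lambda>S. \<forall>z\<in>set zs. z \<in> set S) I))"

text \<open>\<open>ls\<close> lists the letters from bottom to top; the reversals make every block
  precede those it rests on, as \<open>ideals\<close> expects. Index 2 is included to establish that
  a block there forces all blocks of index 0.\<close>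

definition window :: "'l list \<Rightarrow> 'l block list" where
  "window ls = concat (map (\<lambda>m. map (\<lambda>l. (l, m)) (rev ls)) [2, 1, 0])"

definition full :: "'l list \<Rightarrow> 'l block list \<Rightarrow> bool" where
  "full ls L \<longleftrightarrow> (\<forall>l\<in>set ls. (l, 0) \<in> set L)"

definition same_set :: "'a list \<Rightarrow> 'a list \<Rightarrow> bool" where
  "same_set xs ys \<longleftrightarrow> (\<forall>x\<in>set xs. x \<in> set ys) \<and> (\<forall>y\<in>set ys. y \<in> set xs)"

text \<open>The list of the column moved by \<sigma>: the blocks of index -1, implicit in
  \<open>base\<close>, arrive at index 0 and must be listed.\<close>

definition raised :: "'l list \<Rightarrow> 'l block list \<Rightarrow> 'l block list" where
  "raised ls L = map (\<lambda>l. (l, 0)) ls @ map (shift 1) L"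

text \<open>The bounds on rows and support indices confine all interaction to neighboring indices;
  that each letter carries some block keeps deep blocks from being free.\<close>

definition pattern_check :: "'l list \<Rightarrow> ('l \<Rightarrow> 'l block list) \<Rightarrow> ('l \<Rightarrow> int) \<Rightarrow> bool" where
  "pattern_check ls supp rw \<longleftrightarrow> distinct ls \<and>
     (\<forall>l\<in>set ls. 0 \<le> rw l \<and> rw l \<le> 3 \<and>
        (\<forall>z\<in>set (supp l). (snd z = 0 \<or> snd z = -1) \<and> z \<noteq> (l, 0)) \<and>
        (\<exists>l'\<in>set ls. \<exists>z\<in>set (supp l'). fst z = l))"

definition ideals_check ::
  "'l list \<Rightarrow> ('l \<Rightarrow> 'l block list) \<Rightarrow> 'l block list list \<Rightarrow> bool" where
  "ideals_check ls supp Ls \<longleftrightarrow>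
     (\<forall>L\<in>set (ideals (supports supp) (window ls)). full ls L \<or> L \<in> set Ls)"

text \<open>The first condition fixes the order of the entries, so equal columns have equal lists;
  \<open>\<not> full\<close> makes the power of \<sigma> unique. The last condition lets one descend
  through a column index by index.\<close>

definition rep_check :: "'l list \<Rightarrow> ('l \<Rightarrow> 'l block list) \<Rightarrow> 'l block list \<Rightarrow> bool" where
  "rep_check ls supp L \<longleftrightarrow> L = filter (\<lambda>x. x \<in> set L) (window ls) \<and> \<not> full ls L \<and>
     (\<forall>x\<in>set L. snd x < 2 \<and> (\<forall>z\<in>set (supports supp x). snd z < 0 \<or> z \<in> set L)) \<and>
     ((\<exists>x\<in>set L. snd x = 1) \<longrightarrow> (\<exists>x\<in>set L. snd x = 0))"

text \<open>Index -1 is added to the listed blocks because its blocks can still be free; those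
  further down always carry a block.\<close>

definition exceptional_list ::
  "'l list \<Rightarrow> ('l \<Rightarrow> 'l block list) \<Rightarrow> ('l \<Rightarrow> idx) \<Rightarrow> ('l \<Rightarrow> int) \<Rightarrow> 'l block list \<Rightarrow> bool" where
  "exceptional_list ls supp clr rw L \<longleftrightarrow>
     (let M = map (\<lambda>l. (l, -1)) ls @ L;
          free = (\<lambda>x. \<forall>z\<in>set M. x \<notin> set (supports supp z));
          top = (\<lambda>x. \<forall>z\<in>set M. 4 * snd z + rw (fst z) \<le> 4 * snd x + rw (fst x))
      in length (filter (\<lambda>x. clr (fst x) = I2 \<and> top x \<and> free x) M) = 1 \<and>
         (\<exists>x\<in>set M. clr (fst x) = I1 \<and> free x))"

definition edge_check :: "'l list \<Rightarrow> 'l block list list \<Rightarrow> 'l edge list \<Rightarrow> bool" where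
  "edge_check ls reps edges \<longleftrightarrow> (\<forall>(n, x, m, k, b)\<in>set edges.
     n < length reps \<and> m < length reps \<and> 0 \<le> snd x \<and> x \<notin> set (reps ! n) \<and>
     (k = 0 \<and> same_set (x # reps ! n) (reps ! m) \<or>
      k = 1 \<and> same_set (x # reps ! n) (raised ls (reps ! m))))"

text \<open>Apart from the edges in \<open>X\<close>, these are the reasons why a block of the
  window cannot be added. Blocks of index 2 are passed over: they would require index 0 to be
  complete.\<close>

definition complete_at :: "'l list \<Rightarrow> ('l \<Rightarrow> 'l block list) \<Rightarrow> 'l block list \<Rightarrow>
    'l block list \<Rightarrow> 'l block list \<Rightarrow> 'l block \<Rightarrow> bool" where
  "complete_at ls supp exc L X x \<longleftrightarrow>
     snd x = 2 \<or> x \<in> set L \<or> x \<in> set X \<or>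
     (\<exists>z\<in>set (supports supp x). 0 \<le> snd z \<and> z \<notin> set L) \<or>
     same_set (x # L) exc \<or> same_set (x # L) (raised ls exc)"

fun complete_from :: "'l list \<Rightarrow> ('l \<Rightarrow> 'l block list) \<Rightarrow> 'l block list \<Rightarrow> 'l edge list \<Rightarrow>
    nat \<times> 'l block list \<Rightarrow> bool" where
  "complete_from ls supp exc edges (n, L) \<longleftrightarrow>
     (\<forall>x\<in>set (window ls).
        complete_at ls supp exc L (map (\<lambda>e. fst (snd e)) (filter (\<lambda>e. fst e = n) edges)) x)"

definition complete_check :: "'l list \<Rightarrow> ('l \<Rightarrow> 'l block list) \<Rightarrow> 'l block list list \<Rightarrow>
    'l block list \<Rightarrow> 'l edge list \<Rightarrow> bool" where
  "complete_check ls supp reps exc edges \<longleftrightarrow>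
     (\<forall>nL\<in>set (enumerate 0 reps). complete_from ls supp exc edges nL)"

definition unmarked :: "(idx \<Rightarrow> nat option) \<Rightarrow> idx \<Rightarrow> nat \<Rightarrow> bool" where
  "unmarked special i n \<longleftrightarrow> (\<forall>j\<in>set [I0, I1, I2, I3, I4]. j = i \<or> special j \<noteq> Some n)"

definition sources :: "('l \<Rightarrow> idx) \<Rightarrow> 'l edge list \<Rightarrow> idx \<Rightarrow> nat list" where
  "sources clr edges i = map fst (filter (\<lambda>(n, x, m, k, b). b \<and> clr (fst x) = i) edges)"

definition targets :: "('l \<Rightarrow> idx) \<Rightarrow> 'l edge list \<Rightarrow> idx \<Rightarrow> nat list" where
  "targets clr edges i =
     map (\<lambda>(n, x, m, k, b). m) (filter (\<lambda>(n, x, m, k, b). b \<and> clr (fst x) = i) edges)"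

text \<open>The block is the highest addable one at the source and the lowest removable one at the
  target. Blocks at the target are compared after shifting back by \<open>k\<close>, since each edge
  reaches the representative \<open>m\<close> up to its own power of \<sigma>.\<close>

fun extremal :: "('l \<Rightarrow> idx) \<Rightarrow> ('l \<Rightarrow> int) \<Rightarrow> 'l edge \<Rightarrow> 'l edge \<Rightarrow> bool" where
  "extremal clr rw (n, x, m, k, b) (n', x', m', k', b') \<longleftrightarrow>
     clr (fst x') \<noteq> clr (fst x) \<or>
     (n' \<noteq> n \<or> x' = x \<or> 4 * snd x' + rw (fst x') < 4 * snd x + rw (fst x)) \<and>
     (m' \<noteq> m \<or> shift (-k') x' = shift (-k) x \<or>
      4 * snd x + rw (fst x) - 4 * k < 4 * snd x' + rw (fst x') - 4 * k')"

text \<open>An inactive edge is admissible only if, at each end, the operator is switched off or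
  another edge is active. So an unmarked end with a candidate block always has an arrow.\<close>

fun crystal_edge ::
  "('l \<Rightarrow> idx) \<Rightarrow> ('l \<Rightarrow> int) \<Rightarrow> (idx \<Rightarrow> nat option) \<Rightarrow> 'l edge list \<Rightarrow> 'l edge \<Rightarrow> bool" where
  "crystal_edge clr rw special edges (n, x, m, k, b) \<longleftrightarrow>
     b \<and> unmarked special (clr (fst x)) n \<and> unmarked special (clr (fst x)) m \<and>
       (\<forall>e\<in>set edges. extremal clr rw (n, x, m, k, b) e) \<or>
     \<not> b \<and> (\<not> unmarked special (clr (fst x)) n \<or> n \<in> set (sources clr edges (clr (fst x)))) \<and>
       (\<not> unmarked special (clr (fst x)) m \<or> m \<in> set (targets clr edges (clr (fst x))))"

definition crystal_check :: "('l \<Rightarrow> idx) \<Rightarrow> ('l \<Rightarrow> int) \<Rightarrow> (idx \<Rightarrow> nat option) \<Rightarrow> 'l edge list \<Rightarrow> bool" where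
  "crystal_check clr rw special edges \<longleftrightarrow> (\<forall>e\<in>set edges. crystal_edge clr rw special edges e)"

definition supported_in :: "nat list \<Rightarrow> nat list \<Rightarrow> bool" where
  "supported_in ps ns \<longleftrightarrow> (\<forall>(n, p)\<in>set (enumerate 0 ps). p = 0 \<or> n \<in> set ns)"

text \<open>The entries change by one along arrows and vanish where no arrow leaves (for
  \<open>phi\<close>) or arrives (for \<open>eps\<close>); by induction this forces them to be the
  string lengths.\<close>

definition string_check ::
  "nat \<Rightarrow> ('l \<Rightarrow> idx) \<Rightarrow> (idx \<Rightarrow> nat list) \<Rightarrow> (idx \<Rightarrow> nat list) \<Rightarrow> 'l edge list \<Rightarrow> bool" where
  "string_check N clr eps phi edges \<longleftrightarrow>
     (\<forall>(n, x, m, k, b)\<in>set edges.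
        \<not> b \<or> phi (clr (fst x)) ! n = Suc (phi (clr (fst x)) ! m) \<and>
          eps (clr (fst x)) ! m = Suc (eps (clr (fst x)) ! n)) \<and>
     (\<forall>i\<in>set [I0, I1, I2, I3, I4]. length (eps i) = N \<and> length (phi i) = N \<and>
        supported_in (phi i) (sources clr edges i) \<and> supported_in (eps i) (targets clr edges i))"

text \<open>A full period of blocks has weight \<delta> up to a multiple and pairs to 0 with every
  coroot; hence the listed blocks alone determine the pairings, whatever the power of
  \<sigma>.\<close>

definition weight_check :: "(idx \<Rightarrow> idx \<Rightarrow> int) \<Rightarrow> ('l \<Rightarrow> idx) \<Rightarrow> 'l list \<Rightarrow> 'l block list list \<Rightarrow>
    nat \<Rightarrow> (idx \<Rightarrow> nat list) \<Rightarrow> (idx \<Rightarrow> nat list) \<Rightarrow> bool" where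
  "weight_check A clr ls reps vac eps phi \<longleftrightarrow> (\<forall>i\<in>set [I0, I1, I2, I3, I4].
     let w = (\<lambda>L. sum_list (map (\<lambda>x. A i (clr (fst x))) L)); w0 = w (reps ! vac) in
     sum_list (map (\<lambda>l. A i (clr l)) ls) = 0 \<and>
     (\<forall>(n, L)\<in>set (enumerate 0 reps). int (phi i ! n) - int (eps i ! n) = w0 - w L))"

definition differ_by :: "nat \<Rightarrow> (nat \<Rightarrow> bool) \<Rightarrow> nat list \<Rightarrow> nat list \<Rightarrow> nat list \<Rightarrow> bool" where
  "differ_by d P ks us vs \<longleftrightarrow> (\<forall>(k, u, v)\<in>set (zip ks (zip us vs)). \<not> P k \<or> u + d = v)"

text \<open>In the first clause the arrow moves the left factor, a row of the table; in the second
  the right factor, a column. The decrease in the first clause is written as an addition, so the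
  entries can be natural numbers.\<close>

fun energy_edge :: "('l \<Rightarrow> idx) \<Rightarrow> (idx \<Rightarrow> nat list) \<Rightarrow> (idx \<Rightarrow> nat list) \<Rightarrow>
    nat list list \<Rightarrow> 'l edge \<Rightarrow> bool" where
  "energy_edge clr eps phi en (n, x, m, k, b) \<longleftrightarrow> \<not> b \<or>
     differ_by (if clr (fst x) = I0 then 1 else 0) (\<lambda>k. k < phi (clr (fst x)) ! n)
       (eps (clr (fst x))) (en ! m) (en ! n) \<and>
     differ_by (if clr (fst x) = I0 then 1 else 0) (\<lambda>k. k \<le> eps (clr (fst x)) ! n)
       (phi (clr (fst x))) (map (\<lambda>r. r ! n) en) (map (\<lambda>r. r ! m) en)"

definition energy_check :: "nat \<Rightarrow> ('l \<Rightarrow> idx) \<Rightarrow> (idx \<Rightarrow> nat list) \<Rightarrow> (idx \<Rightarrow> nat list) \<Rightarrow>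
    nat list list \<Rightarrow> 'l edge list \<Rightarrow> bool" where
  "energy_check N clr eps phi en edges \<longleftrightarrow>
     length en = N \<and> (\<forall>r\<in>set en. length r = N) \<and>
     (\<forall>e\<in>set edges. energy_edge clr eps phi en e)"

section \<open>Invariance under the powers of \<sigma>\<close>

lemma fst_shift [simp]: "fst (shift k x) = fst x"
  and snd_shift [simp]: "snd (shift k x) = snd x + k"
  by (simp_all add: shift_def)

lemma shift_shift [simp]: "shift j (shift k x) = shift (j + k) x"
  and shift_0 [simp]: "shift 0 x = x"
  and shift_eq_iff [simp]: "shift k x = shift k z \<longleftrightarrow> x = z"
  by (auto simp: shift_def prod_eq_iff)

lemma shift_minus_eq: "shift (- k) x = z \<longleftrightarrow> x = shift k z"
  by (auto simp: shift_def prod_eq_iff)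

lemma sigma_pow_eq: "sigma_pow k y = shift k ` y"
proof -
  have "(\<lambda>(l, m). (l, m + k)) = shift k" by (auto simp: fun_eq_iff shift_def)
  then show ?thesis unfolding sigma_pow_def by (rule arg_cong)
qed

lemma mem_sigma_pow: "x \<in> sigma_pow k y \<longleftrightarrow> shift (- k) x \<in> y"
  unfolding sigma_pow_eq image_iff by (metis shift_minus_eq)

lemma sigma_pow_sigma_pow [simp]: "sigma_pow j (sigma_pow k y) = sigma_pow (j + k) y"
  by (auto simp: mem_sigma_pow add.commute)

lemma sigma_pow_0 [simp]: "sigma_pow 0 y = y"
  by (auto simp: mem_sigma_pow)

lemma sigma_pow_insert: "sigma_pow k (insert x y) = insert (shift k x) (sigma_pow k y)"
  by (simp add: sigma_pow_eq)

lemma sigma_pow_remove: "sigma_pow k (y - {x}) = sigma_pow k y - {shift k x}"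
  by (auto simp: sigma_pow_eq)

lemma sigma_pow_inject: "sigma_pow k y = sigma_pow k z \<longleftrightarrow> y = z"
  by (metis add.left_inverse sigma_pow_0 sigma_pow_sigma_pow)

lemma color_shift [simp]: "color T (shift k x) = color T x"
  by (simp add: color_def)

lemma row_shift [simp]: "row T (shift k x) = row T x + 4 * k"
  by (simp add: row_def)

lemma rests_on_shift [simp]: "rests_on T (shift k x) (shift k z) = rests_on T x z"
  by (simp add: rests_on_def)

lemma pre_young_sigma_pow [simp]: "pre_young_column T (sigma_pow k y) = pre_young_column T y"
proof -
  have imp: "pre_young_column T (sigma_pow k y)" if y: "pre_young_column T y" for k y
    unfolding pre_young_column_def
  proof (intro conjI ballI allI impI)
    show "sigma_pow k y \<noteq> {}" using y by (simp add: sigma_pow_eq pre_young_column_def)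
    obtain N where "\<forall>x\<in>y. row T x \<le> N" using y by (auto simp: pre_young_column_def)
    then show "\<exists>N. \<forall>x\<in>sigma_pow k y. row T x \<le> N"
      by (intro exI[of _ "N + 4 * k"]) (auto simp: sigma_pow_eq)
    fix x x' assume x: "x \<in> sigma_pow k y" "rests_on T x x'"
    then have "rests_on T (shift (- k) x) (shift (- k) x')" by simp
    with x(1) y show "x' \<in> sigma_pow k y"
      unfolding mem_sigma_pow pre_young_column_def by blast
  qed
  from imp[of "sigma_pow k y" "- k"] imp[of y k] show ?thesis by auto
qed

lemma free_block_sigma_pow: "free_block T (sigma_pow k y) (shift k x) = free_block T y x"
proof -
  have "sigma_pow k y - {shift k x} = sigma_pow k (y - {x})" by (simp add: sigma_pow_remove)
  then show ?thesis by (simp add: free_block_def mem_sigma_pow)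
qed

lemma exceptional_sigma_pow [simp]: "exceptional T (sigma_pow k y) = exceptional T y"
proof -
  have imp: "exceptional T (sigma_pow k y)" if y: "exceptional T y" for k y
  proof -
    let ?P = "\<lambda>y x. free_block T y x \<and> color T x = I2 \<and> (\<forall>x'\<in>y. row T x' \<le> row T x)"
    have P: "?P (sigma_pow k y) (shift k x) = ?P y x" for x
      by (auto simp: free_block_sigma_pow) (auto simp: sigma_pow_eq)
    obtain x where x: "?P y x" "\<And>z. ?P y z \<Longrightarrow> z = x"
      using y unfolding exceptional_def by blast
    have "z = shift k x" if "?P (sigma_pow k y) z" for z
    proof -
      have "z = shift k (shift (- k) z)" by simp
      with P[of "shift (- k) z"] that have "?P y (shift (- k) z)" by simp
      then have "shift (- k) z = x" by (rule x(2))
      then show ?thesis by (simp add: shift_minus_eq)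
    qed
    then have "\<exists>!x. ?P (sigma_pow k y) x"
      using x(1) P by blast
    moreover obtain w where "free_block T y w" "color T w = I1"
      using y unfolding exceptional_def by blast
    then have "\<exists>x. free_block T (sigma_pow k y) x \<and> color T x = I1"
      by (intro exI[of _ "shift k w"]) (simp add: free_block_sigma_pow)
    ultimately show ?thesis unfolding exceptional_def by blast
  qed
  from imp[of "sigma_pow k y" "- k"] imp[of y k] show ?thesis by auto
qed

lemma young_sigma_pow [simp]: "young_column T (sigma_pow k y) = young_column T y"
  by (simp add: young_column_def)

lemma col_class_sigma_pow [simp]: "col_class (sigma_pow k y) = col_class y"
proof -
  have "sigma_pow j (sigma_pow k y) \<in> col_class y" "sigma_pow j y = sigma_pow (j - k) (sigma_pow k y)" for j
    by (auto simp: col_class_def)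
  then show ?thesis unfolding col_class_def by blast
qed

lemma filter_in_ideals:
  "(\<And>x z. x \<in> y \<Longrightarrow> z \<in> set (s x) \<Longrightarrow> z \<in> y) \<Longrightarrow> filter (\<lambda>x. x \<in> y) xs \<in> set (ideals s xs)"
  by (induction xs) (auto simp: Let_def)

text \<open>\<open>ARG_MAX\<close> is determined when the maximum is attained once, hence the strict
  inequality for all other addable blocks.\<close>

lemma col_f_eqI:
  assumes "\<nexists>j. j \<noteq> i \<and> y \<in> y_r T j" "x \<in> addable T i y"
    and max: "\<And>z. z \<in> addable T i y \<Longrightarrow> z \<noteq> x \<Longrightarrow> row T z < row T x"
  shows "col_f T i y = Some (insert x y)"
proof -
  have "(ARG_MAX (row T) z. z \<in> addable T i y) = x"
  proof (rule arg_maxI[of "\<lambda>z. z \<in> addable T i y" x])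
    show "\<not> row T x < row T z" if "z \<in> addable T i y" for z
      using max[OF that] by (cases "z = x") auto
    show "z = x" if "z \<in> addable T i y" "\<forall>w. w \<in> addable T i y \<longrightarrow> \<not> row T z < row T w" for z
      using max[OF that(1)] that(2) assms(2) by blast
  qed fact
  then show ?thesis using assms(1,2) by (auto simp: col_f_def)
qed

lemma col_e_eqI:
  assumes "\<nexists>j. j \<noteq> i \<and> y \<in> y_r T j" "x \<in> removable T i y"
    and min: "\<And>z. z \<in> removable T i y \<Longrightarrow> z \<noteq> x \<Longrightarrow> row T x < row T z"
  shows "col_e T i y = Some (y - {x})"
proof -
  have "(ARG_MIN (row T) z. z \<in> removable T i y) = x"
  proof (rule arg_minI[of "\<lambda>z. z \<in> removable T i y" x])
    show "\<not> row T z < row T x" if "z \<in> removable T i y" for z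
      using min[OF that] by (cases "z = x") auto
    show "z = x" if "z \<in> removable T i y" "\<forall>w. w \<in> removable T i y \<longrightarrow> \<not> row T w < row T z" for z
      using min[OF that(1)] that(2) assms(2) by blast
  qed fact
  then show ?thesis using assms(1,2) by (auto simp: col_e_def)
qed

lemma length_filter_eq_1_iff:
  assumes "distinct xs"
  shows "length (filter P xs) = 1 \<longleftrightarrow> (\<exists>!x. x \<in> set xs \<and> P x)"
proof -
  have "length (filter P xs) = card {x \<in> set xs. P x}"
    using assms by (metis distinct_card distinct_filter set_filter)
  then have "length (filter P xs) = 1 \<longleftrightarrow> (\<exists>x. {x \<in> set xs. P x} = {x})"
    by (simp add: card_1_singleton_iff)
  also have "\<dots> \<longleftrightarrow> (\<exists>!x. x \<in> set xs \<and> P x)"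
    unfolding Ex1_def by (intro arg_cong[where f = Ex] ext) auto
  finally show ?thesis .
qed

text \<open>
  The given representatives of the classes \<open>y\<^bsub>r\<^sub>j\<^esub>\<close> contain all blocks of index 0, hence \<open>raised\<close> in
  the assumption \<open>special\<close>.
\<close>

locale column_table =
  fixes T :: "'l pattern" and ls :: "'l list" and supp :: "'l \<Rightarrow> 'l block list"
    and reps :: "'l block list list" and exc :: "'l block list" and edges :: "'l edge list"
    and eps phi :: "idx \<Rightarrow> nat list" and en :: "nat list list"
    and special :: "idx \<Rightarrow> nat option" and vac :: nat
  assumes letters: "set ls = UNIV"
    and lsupp: "lsupp T l = set (supp l)"
    and pattern: "pattern_check ls supp (lrow T)"
    and ideals: "ideals_check ls supp (exc # reps)"
    and reps: "\<forall>L\<in>set (exc # reps). rep_check ls supp L"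
    and exc: "exceptional_list ls supp (lcolor T) (lrow T) exc"
    and not_exc: "\<forall>L\<in>set reps. \<not> exceptional_list ls supp (lcolor T) (lrow T) L"
    and distinct: "distinct reps"
    and edges: "edge_check ls reps edges"
    and complete: "complete_check ls supp reps exc edges"
    and crystal: "crystal_check (lcolor T) (lrow T) special edges"
    and strings: "string_check (length reps) (lcolor T) eps phi edges"
    and weights: "weight_check (cartan T) (lcolor T) ls reps vac eps phi"
    and energies: "energy_check (length reps) (lcolor T) eps phi en edges"
    and special: "rep_r T j = map_option (\<lambda>n. base (raised ls (reps ! n))) (special j)"
    and special_less: "special j = Some n \<Longrightarrow> n < length reps"
    and vac: "vac < length reps" "rep_empty T = base (reps ! vac)" "en ! vac ! vac = 0"
    and vac_strings: "phi i ! vac = of_bool (i = I0)" "eps i ! vac = of_bool (i = I0)"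
begin

section \<open>Normal form of pre-Young columns\<close>

lemma rests_on_iff: "rests_on T x z \<longleftrightarrow> z \<in> set (supports supp x)"
proof -
  have "z = shift (snd x) w \<longleftrightarrow> w = (fst z, snd z - snd x)" for w
    by (auto simp: shift_def prod_eq_iff)
  then show ?thesis by (auto simp: rests_on_def supports_def lsupp image_iff)
qed

lemma rests_on_index: "rests_on T x z \<Longrightarrow> snd z = snd x \<or> snd z = snd x - 1"
  using pattern unfolding pattern_check_def rests_on_def lsupp letters by fastforce

lemma not_rests_on_self: "\<not> rests_on T x x"
  using pattern unfolding pattern_check_def rests_on_def lsupp letters by fastforce

lemma lrow_range: "0 \<le> lrow T l" "lrow T l \<le> 3"
  using pattern unfolding pattern_check_def letters by auto

lemma row_range: "4 * snd x \<le> row T x" "row T x \<le> 4 * snd x + 3"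
  using lrow_range[of "fst x"] by (auto simp: row_def)

lemma rested_on: "\<exists>x. rests_on T x z \<and> snd x \<le> snd z + 1"
proof -
  obtain l' w where w: "w \<in> set (supp l')" "fst w = fst z" "snd w = 0 \<or> snd w = -1"
    using pattern unfolding pattern_check_def letters by (metis UNIV_I)
  then have "rests_on T (l', snd z - snd w) z"
    by (auto simp: rests_on_def lsupp) (metis prod.collapse)+
  then show ?thesis using w(3) by (intro exI[of _ "(l', snd z - snd w)"]) auto
qed

lemma set_window: "set (window ls) = {x. snd x \<in> {0, 1, 2}}"
  by (auto simp: window_def letters)

lemma full_iff: "full ls L \<longleftrightarrow> (\<forall>l. (l, 0) \<in> set L)"
  by (simp add: full_def letters)

lemma repD:
  assumes "L \<in> set (exc # reps)"
  shows "filter (\<lambda>x. x \<in> set L) (window ls) = L" "\<exists>l. (l, 0) \<notin> set L"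
    and "x \<in> set L \<Longrightarrow> snd x = 0 \<or> snd x = 1"
    and "x \<in> set L \<Longrightarrow> rests_on T x z \<Longrightarrow> 0 \<le> snd z \<Longrightarrow> z \<in> set L"
    and "x \<in> set L \<Longrightarrow> snd x = 1 \<Longrightarrow> \<exists>z\<in>set L. snd z = 0"
proof -
  have c: "rep_check ls supp L" using reps assms by blast
  then show f: "filter (\<lambda>x. x \<in> set L) (window ls) = L" by (simp add: rep_check_def)
  show "\<exists>l. (l, 0) \<notin> set L" using c by (simp add: rep_check_def full_iff)
  show "snd x = 0 \<or> snd x = 1" if "x \<in> set L"
  proof -
    have "x \<in> set (window ls)" using that by (subst (asm) f[symmetric]) simp
    then show ?thesis using c that by (auto simp: rep_check_def set_window)
  qed
  show "z \<in> set L" if "x \<in> set L" "rests_on T x z" "0 \<le> snd z"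
  proof -
    have "snd z < 0 \<or> z \<in> set L"
      using c that(1,2) unfolding rep_check_def rests_on_iff by blast
    then show ?thesis using that(3) by linarith
  qed
  show "\<exists>z\<in>set L. snd z = 0" if "x \<in> set L" "snd x = 1"
    using c that by (auto simp: rep_check_def)
qed

lemma distinct_rep: "L \<in> set (exc # reps) \<Longrightarrow> distinct L"
proof -
  assume L: "L \<in> set (exc # reps)"
  have "distinct ls" using pattern by (simp add: pattern_check_def)
  then have "distinct (window ls)"
    by (auto simp: window_def distinct_map inj_on_def)
  then show "distinct L" using repD(1)[OF L] by (metis distinct_filter)
qed

text \<open>The part of a column inside the window is closed under support within the window, so the
  enumeration meets it.\<close>

lemma filter_window:
  assumes "pre_young_column T y"
  defines "L \<equiv> filter (\<lambda>x. x \<in> y) (window ls)"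
  shows "full ls L \<or> L \<in> set (exc # reps)"
proof -
  have "L \<in> set (ideals (supports supp) (window ls))"
    unfolding L_def
    by (rule filter_in_ideals) (use assms in \<open>auto simp: pre_young_column_def rests_on_iff\<close>)
  then show ?thesis using ideals by (auto simp: ideals_check_def split: if_splits)
qed

text \<open>Moving the block to index 1 or 2 turns the claims into properties of the enumerated
  lists: one with a block of index 1 has a block of index 0, and one with a block of index 2
  contains all of these.\<close>

lemma pre_young_lower:
  assumes y: "pre_young_column T y" and l: "(l, m) \<in> y"
  shows "\<exists>l'. (l', m - 1) \<in> y" "(l', m - 2) \<in> y"
proof -
  define L where "L k = filter (\<lambda>x. x \<in> sigma_pow (k - m) y) (window ls)" for k
  have mem: "x \<in> set (L k) \<longleftrightarrow> snd x \<in> {0, 1, 2} \<and> shift (m - k) x \<in> y" for x k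
    by (auto simp: L_def set_window mem_sigma_pow)
  have L: "full ls (L k) \<or> L k \<in> set (exc # reps)" for k
    unfolding L_def by (rule filter_window) (simp add: y)
  have "(l, 1) \<in> set (L 1)" using l by (simp add: mem shift_def)
  then have "\<exists>l'. (l', 0) \<in> set (L 1)"
    using L[of 1] repD(5)[of "L 1" "(l, 1)"] by (fastforce simp: full_iff)
  then show "\<exists>l'. (l', m - 1) \<in> y" by (auto simp: mem shift_def)
  have "(l, 2) \<in> set (L 2)" using l by (simp add: mem shift_def)
  then have "full ls (L 2)" using L[of 2] repD(3)[of "L 2" "(l, 2)"] by auto
  then have "(l', 0) \<in> set (L 2)" by (simp add: full_iff)
  then show "(l', m - 2) \<in> y" by (auto simp: mem shift_def)
qed

lemma pre_young_below:
  assumes y: "pre_young_column T y" and l: "(l, m) \<in> y" and "m' \<le> m"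
  shows "\<exists>l'. (l', m') \<in> y"
  using assms(3)
proof (induction m' rule: int_le_induct)
  case base
  then show ?case using l by blast
next
  case (step i)
  then show ?case using pre_young_lower(1)[OF y] by blast
qed

lemma pre_young_all_below:
  assumes y: "pre_young_column T y" and l: "(l, m) \<in> y" and "m' \<le> m - 2"
  shows "(l', m') \<in> y"
proof -
  obtain l'' where "(l'', m' + 2) \<in> y" using pre_young_below[OF y l, of "m' + 2"] assms(3) by auto
  then show ?thesis using pre_young_lower(2)[OF y, of l'' "m' + 2"] by simp
qed

lemma pre_young_level:
  assumes y: "pre_young_column T y"
  shows "\<exists>k. (\<forall>x. snd x < k \<longrightarrow> x \<in> y) \<and> (\<exists>l. (l, k) \<notin> y)"
proof -
  obtain l0 m0 where l0: "(l0, m0) \<in> y" using y by (auto simp: pre_young_column_def)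
  obtain R where R: "\<And>x. x \<in> y \<Longrightarrow> row T x \<le> R"
    using y unfolding pre_young_column_def by blast
  let ?P = "\<lambda>n. \<exists>l. (l, m0 - 1 + int n) \<notin> y"
  \<comment> \<open>The offset is large enough for the row of this block to exceed the height bound
    \<open>R\<close>. The search starts at \<open>m0 - 1\<close>, as everything up to
    \<open>m0 - 2\<close> is present.\<close>
  have "(l0, m0 - 1 + int (nat (\<bar>R\<bar> + \<bar>m0\<bar> + 2))) \<notin> y"
  proof
    assume "(l0, m0 - 1 + int (nat (\<bar>R\<bar> + \<bar>m0\<bar> + 2))) \<in> y"
    from R[OF this] row_range(1)[of "(l0, m0 - 1 + int (nat (\<bar>R\<bar> + \<bar>m0\<bar> + 2)))"]
    show False by simp
  qed
  then have ex: "?P (LEAST n. ?P n)" by (intro LeastI_ex[of ?P]) blast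
  define k where "k = m0 - 1 + int (LEAST n. ?P n)"
  have "(l, m) \<in> y" if "m < k" for l m
  proof (cases "m \<le> m0 - 2")
    case True
    then show ?thesis using pre_young_all_below[OF y l0] by simp
  next
    case False
    then have "nat (m - (m0 - 1)) < (LEAST n. ?P n)" using that by (simp add: k_def)
    from not_less_Least[OF this] False show ?thesis by simp
  qed
  then have "x \<in> y" if "snd x < k" for x
    using that by (metis prod.collapse)
  moreover have "\<exists>l. (l, k) \<notin> y" using ex by (simp only: k_def)
  ultimately show ?thesis by blast
qed

text \<open>The first incomplete level is shifted to index 0. A block of index 2 or more would then
  put one of index 2 into the window, and no listed representative has one.\<close>

lemma pre_young_cases:
  assumes y: "pre_young_column T y"
  obtains k L where "L \<in> set (exc # reps)" "y = sigma_pow k (base L)"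
proof -
  obtain k l where k: "\<And>x. snd x < k \<Longrightarrow> x \<in> y" "(l, k) \<notin> y"
    using pre_young_level[OF y] by blast
  define y' where "y' = sigma_pow (- k) y"
  have y': "pre_young_column T y'" by (simp add: y'_def y)
  define L where "L = filter (\<lambda>x. x \<in> y') (window ls)"
  have mem: "x \<in> set L \<longleftrightarrow> x \<in> y' \<and> snd x \<in> {0, 1, 2}" for x
    by (auto simp: L_def set_window)
  have neg: "x \<in> y'" if "snd x < 0" for x
    using that by (simp add: y'_def mem_sigma_pow k)
  have "(l, 0) \<notin> set L" using k(2) by (simp add: mem y'_def mem_sigma_pow shift_def)
  then have L: "L \<in> set (exc # reps)"
    using filter_window[OF y'] by (auto simp: full_iff L_def[symmetric])
  have "snd x < 2" if x: "x \<in> y'" for x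
  proof (rule ccontr)
    assume "\<not> ?thesis"
    then obtain l' where "(l', 2) \<in> y'"
      using pre_young_below[OF y', of "fst x" "snd x" 2] x by auto
    then have "(l', 2) \<in> set L" by (simp add: mem)
    from repD(3)[OF L this] show False by simp
  qed
  then have "y' = base L"
    using neg by (force simp: base_def mem)
  moreover have "y = sigma_pow k y'" by (simp add: y'_def)
  ultimately have "y = sigma_pow k (base L)" by simp
  with L show thesis by (rule that)
qed

lemma pre_young_base: "L \<in> set (exc # reps) \<Longrightarrow> pre_young_column T (base L)"
  unfolding pre_young_column_def
proof (intro conjI ballI allI impI)
  assume L: "L \<in> set (exc # reps)"
  have "(undefined, -1) \<in> base L" by (simp add: base_def)
  then show "base L \<noteq> {}" by blast
  have "row T x \<le> 7" if "x \<in> base L" for x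
    using that repD(3)[OF L, of x] row_range(2)[of x] by (auto simp: base_def)
  then show "\<exists>N. \<forall>x\<in>base L. row T x \<le> N" by blast
  fix x z assume x: "x \<in> base L" "rests_on T x z"
  show "z \<in> base L"
  proof (cases "snd z < 0")
    case False
    then have "x \<in> set L" using rests_on_index[OF x(2)] x(1) by (auto simp: base_def)
    then have "z \<in> set L" using repD(4)[OF L _ x(2)] False by simp
    then show ?thesis by (simp add: base_def)
  qed (simp add: base_def)
qed

text \<open>An infinite column stays nonempty, so removal can fail only by taking away the support
  of another block.\<close>

lemma free_block_iff:
  assumes y: "pre_young_column T y" and inf: "infinite y"
  shows "free_block T y x \<longleftrightarrow> x \<in> y \<and> (\<forall>z\<in>y. \<not> rests_on T z x)"
proof
  assume "free_block T y x"
  then show "x \<in> y \<and> (\<forall>z\<in>y. \<not> rests_on T z x)"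
    using not_rests_on_self unfolding free_block_def pre_young_column_def by blast
next
  assume x: "x \<in> y \<and> (\<forall>z\<in>y. \<not> rests_on T z x)"
  have "y - {x} \<noteq> {}" using inf by (metis finite.emptyI finite_insert insert_Diff_single insert_absorb x)
  then show "free_block T y x"
    using x y unfolding free_block_def pre_young_column_def by blast
qed

lemma infinite_base: "infinite (base (L :: 'l block list))"
proof
  assume "finite (base L)"
  moreover have "range (\<lambda>n. (undefined :: 'l, - 1 - int n)) \<subseteq> base L" by (auto simp: base_def)
  ultimately have "finite (range (\<lambda>n. (undefined :: 'l, - 1 - int n)))" by (rule rev_finite_subset)
  then show False by (subst (asm) finite_image_iff) (auto simp: inj_on_def)
qed

text \<open>The finite list \<open>M\<close> decides both clauses: blocks of index below -1 always
  carry a block of the column, and they are lower than every block of \<open>M\<close>.\<close>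

lemma exceptional_base:
  assumes L: "L \<in> set (exc # reps)"
  shows "exceptional T (base L) \<longleftrightarrow> exceptional_list ls supp (lcolor T) (lrow T) L"
proof -
  define M where "M = map (\<lambda>l. (l, -1)) ls @ L"
  have M: "x \<in> set M \<longleftrightarrow> x \<in> base L \<and> -1 \<le> snd x" for x
    using repD(3)[OF L, of x] by (cases x) (auto simp: M_def base_def letters)
  have "distinct M"
    using distinct_rep[OF L] repD(3)[OF L] pattern
    by (force simp: M_def pattern_check_def distinct_map inj_on_def)
  define free where "free x \<longleftrightarrow> (\<forall>z\<in>set M. x \<notin> set (supports supp z))" for x
  define top where "top x \<longleftrightarrow> (\<forall>z\<in>set M. 4 * snd z + lrow T (fst z) \<le> 4 * snd x + lrow T (fst x))" for x
  have free: "free_block T (base L) x \<longleftrightarrow> x \<in> set M \<and> free x" for x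
  proof (cases "-1 \<le> snd x")
    case True
    have "z \<in> set M" if "z \<in> base L" "rests_on T z x" for z
      using rests_on_index[OF that(2)] that(1) True by (auto simp: M)
    then show ?thesis
      unfolding free_block_iff[OF pre_young_base[OF L] infinite_base] free_def
      using True M by (auto simp: rests_on_iff)
  next
    case False
    obtain z where "rests_on T z x" "snd z \<le> snd x + 1" using rested_on by blast
    moreover from this False have "z \<in> base L" by (simp add: base_def)
    ultimately show ?thesis
      unfolding free_block_iff[OF pre_young_base[OF L] infinite_base] using False M by auto
  qed
  have top: "(\<forall>z\<in>base L. row T z \<le> row T x) \<longleftrightarrow> top x" if "x \<in> set M" for x
  proof -
    have "row T z \<le> row T x" if "z \<in> base L" "z \<notin> set M" for z
      using that row_range(2)[of z] row_range(1)[of x] \<open>x \<in> set M\<close> by (simp add: M)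
    then show ?thesis by (auto simp: top_def row_def[of T, symmetric] M)
  qed
  have pointwise: "free_block T (base L) x \<and> color T x = I2 \<and> (\<forall>x'\<in>base L. row T x' \<le> row T x) \<longleftrightarrow>
      x \<in> set M \<and> lcolor T (fst x) = I2 \<and> top x \<and> free x" for x
    by (cases "x \<in> set M") (auto simp: free top color_def)
  have "(\<exists>!x. free_block T (base L) x \<and> color T x = I2 \<and> (\<forall>x'\<in>base L. row T x' \<le> row T x)) \<longleftrightarrow>
      (\<exists>!x. x \<in> set M \<and> lcolor T (fst x) = I2 \<and> top x \<and> free x)"
    unfolding pointwise ..
  moreover have "(\<exists>x. free_block T (base L) x \<and> color T x = I1) \<longleftrightarrow>
      (\<exists>x\<in>set M. lcolor T (fst x) = I1 \<and> free x)"
    unfolding free color_def Bex_def by blast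
  ultimately show ?thesis
    unfolding exceptional_def exceptional_list_def Let_def M_def[symmetric] free_def[symmetric]
      top_def[symmetric] length_filter_eq_1_iff[OF \<open>distinct M\<close>] by simp
qed

section \<open>Young columns as shifted representatives\<close>

abbreviation rep :: "nat \<Rightarrow> 'l column" where
  "rep n \<equiv> base (reps ! n)"

lemma young_rep: "n < length reps \<Longrightarrow> young_column T (sigma_pow k (rep n))"
  using pre_young_base exceptional_base not_exc by (simp add: young_column_def)

lemma not_young_exc: "\<not> young_column T (sigma_pow k (base exc))"
  using exceptional_base[of exc] exc by (simp add: young_column_def)

lemma young_cases:
  assumes "young_column T y"
  obtains k n where "n < length reps" "y = sigma_pow k (rep n)"
proof -
  obtain k L where L: "L \<in> set (exc # reps)" "y = sigma_pow k (base L)"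
    using assms pre_young_cases unfolding young_column_def by blast
  then have "L \<in> set reps" using assms not_young_exc by auto
  then show thesis using L that by (metis in_set_conv_nth)
qed

text \<open>The shift is recovered as the first incomplete level, and the list from the fixed order
  of its entries.\<close>

lemma sigma_pow_base_eqD:
  assumes "L \<in> set (exc # reps)" "L' \<in> set (exc # reps)"
    and eq: "sigma_pow k (base L) = sigma_pow k' (base L')"
  shows "k = k' \<and> L = L'"
proof -
  have le: "k' \<le> k" if L: "L \<in> set (exc # reps)" and eq: "sigma_pow k (base L) = sigma_pow k' (base L')"
    for k k' L L'
  proof (rule ccontr)
    assume less: "\<not> ?thesis"
    obtain l where "(l, 0) \<notin> set L" using repD(2)[OF L] by blast
    then have "(l, k) \<notin> sigma_pow k (base L)" by (simp add: mem_sigma_pow shift_def base_def)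
    moreover have "(l, k) \<in> sigma_pow k' (base L')"
      using less by (simp add: mem_sigma_pow shift_def base_def)
    ultimately show False using eq by simp
  qed
  then have k: "k = k'" using assms by (metis order_antisym)
  then have "base L = base L'" using eq by (simp add: sigma_pow_inject)
  moreover have "x \<in> set K \<longleftrightarrow> 0 \<le> snd x \<and> x \<in> base K" if "K \<in> set (exc # reps)" for x K
    using repD(3)[OF that, of x] by (auto simp: base_def)
  ultimately have "x \<in> set L \<longleftrightarrow> x \<in> set L'" for x
    using assms(1,2) by simp
  then have "L = L'" using repD(1)[OF assms(1)] repD(1)[OF assms(2)] by presburger
  with k show ?thesis by blast
qed

lemma sigma_pow_rep_eqD:
  assumes "n < length reps" "n' < length reps" "sigma_pow k (rep n) = sigma_pow k' (rep n')"
  shows "k = k'" "n = n'"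
  using sigma_pow_base_eqD[OF _ _ assms(3)] assms(1,2) distinct
  by (auto simp: nth_eq_iff_index_eq)

section \<open>Addable and removable blocks as edges\<close>

lemma base_raised:
  "base (raised ls L) = sigma_pow 1 (base L)"
proof -
  have "x \<in> base (raised ls L) \<longleftrightarrow> x \<in> sigma_pow 1 (base L)" for x
  proof -
    have "x \<in> shift 1 ` set L \<longleftrightarrow> shift (- 1) x \<in> set L"
      unfolding image_iff by (metis shift_minus_eq)
    moreover have "x \<in> range (\<lambda>l. (l, 0)) \<longleftrightarrow> snd x = 0" by (cases x) auto
    ultimately show ?thesis by (auto simp: base_def raised_def letters mem_sigma_pow)
  qed
  then show ?thesis by blast
qed

lemma same_set_iff: "same_set xs zs \<longleftrightarrow> set xs = set zs"
  by (auto simp: same_set_def)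

lemma base_cong: "set L = set L' \<Longrightarrow> base L = base L'"
  by (simp add: base_def)

lemma base_Cons: "base (x # L) = insert x (base L)"
  by (auto simp: base_def)

lemma edgeD:
  assumes "(n, x, m, k, b) \<in> set edges"
  shows "n < length reps" "m < length reps" "x \<notin> rep n" "insert x (rep n) = sigma_pow k (rep m)"
proof -
  have c: "n < length reps" "m < length reps" "0 \<le> snd x" "x \<notin> set (reps ! n)"
     "if k = 0 then same_set (x # reps ! n) (reps ! m)
      else k = 1 \<and> same_set (x # reps ! n) (raised ls (reps ! m))"
    using edges assms by (auto simp: edge_check_def)
  show "n < length reps" "m < length reps" "x \<notin> rep n" using c by (auto simp: base_def)
  have "base (x # reps ! n) = sigma_pow k (rep m)"
    using c(5) base_cong[of "x # reps ! n"] base_raised by (auto simp: same_set_iff split: if_splits)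
  then show "insert x (rep n) = sigma_pow k (rep m)" by (simp add: base_Cons)
qed

lemma edge_complete:
  assumes n: "n < length reps" and x: "x \<notin> rep n" and y: "young_column T (insert x (rep n))"
  shows "\<exists>m k b. (n, x, m, k, b) \<in> set edges"
proof -
  let ?L = "reps ! n"
  have L: "?L \<in> set (exc # reps)" using n by simp
  have pre: "pre_young_column T (insert x (rep n))" using y by (simp add: young_column_def)
  have x0: "0 \<le> snd x" "x \<notin> set ?L" using x by (auto simp: base_def)
  have x2: "snd x < 2"
  proof (rule ccontr)
    assume x2: "\<not> ?thesis"
    \<comment> \<open>A block of index 2 or more would force this missing block to be
      present.\<close>
    obtain l where l: "(l, 0) \<notin> set ?L" using repD(2)[OF L] by blast
    have "(l, 0) \<in> insert x (rep n)"
      using pre_young_all_below[OF pre, of "fst x" "snd x" 0 l] x2 by simp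
    then show False using l x2 by (auto simp: base_def)
  qed
  then have win: "x \<in> set (window ls)" using x0(1) by (auto simp: set_window)
  have "z \<in> set ?L" if "z \<in> set (supports supp x)" "0 \<le> snd z" for z
  proof -
    have "rests_on T x z" using that by (simp add: rests_on_iff)
    then have "z \<in> insert x (rep n)" "z \<noteq> x"
      using pre not_rests_on_self unfolding pre_young_column_def by blast+
    then show ?thesis using that by (auto simp: base_def)
  qed
  then have supp: "\<not> (\<exists>z\<in>set (supports supp x). 0 \<le> snd z \<and> z \<notin> set ?L)" by blast
  have "\<not> same_set (x # ?L) exc"
    using base_cong[of "x # ?L" exc] not_young_exc[of 0] y by (auto simp: same_set_iff base_Cons)
  moreover have "\<not> same_set (x # ?L) (raised ls exc)"
    using base_cong[of "x # ?L" "raised ls exc"] not_young_exc[of 1] y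
    by (auto simp: same_set_iff base_Cons base_raised)
  moreover have "(n, ?L) \<in> set (enumerate 0 reps)"
    using n by (simp add: in_set_enumerate_eq)
  ultimately have "x \<in> set (map (\<lambda>e. fst (snd e)) (filter (\<lambda>e. fst e = n) edges))"
    using complete win x2 x0(2) supp unfolding complete_check_def
    by (fastforce simp: complete_at_def split: if_splits)
  then obtain e where "e \<in> set edges" "fst e = n" "fst (snd e) = x" by auto
  then show ?thesis by (metis prod.collapse)
qed

lemma addable_rep:
  assumes n: "n < length reps"
  shows "addable T i (sigma_pow s (rep n)) =
    {shift s x | x m k b. (n, x, m, k, b) \<in> set edges \<and> lcolor T (fst x) = i}" (is "?A = ?B")
proof (intro equalityI subsetI)
  fix z assume "z \<in> ?A"
  then have z: "z \<notin> sigma_pow s (rep n)" "color T z = i" "young_column T (insert z (sigma_pow s (rep n)))"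
    by (auto simp: addable_def)
  define x where "x = shift (- s) z"
  have zx: "z = shift s x" by (simp add: x_def)
  have "x \<notin> rep n" using z(1) by (simp add: x_def mem_sigma_pow)
  moreover have "young_column T (insert x (rep n))"
    using z(3) by (simp add: zx sigma_pow_insert[symmetric])
  ultimately obtain m k b where "(n, x, m, k, b) \<in> set edges" using edge_complete[OF n] by blast
  moreover have "lcolor T (fst x) = i" using z(2) by (simp add: zx color_def)
  ultimately show "z \<in> ?B" using zx by blast
next
  fix z assume "z \<in> ?B"
  then obtain x m k b where z: "z = shift s x" "(n, x, m, k, b) \<in> set edges" "lcolor T (fst x) = i"
    by blast
  note e = edgeD[OF z(2)]
  show "z \<in> ?A"
    unfolding addable_def z(1) using e young_rep[OF e(2)] z(3)
    by (auto simp: sigma_pow_insert[symmetric] mem_sigma_pow color_def)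
qed

text \<open>Removal is reduced to addition: the column left over has a normal form of its own, to
  which the block is addable. Uniqueness of the normal form identifies the target, and
  \<open>s - k\<close> undoes the shift of the edge.\<close>

lemma removable_rep:
  assumes m: "m < length reps"
  shows "removable T i (sigma_pow s (rep m)) =
    {shift (s - k) x | n x k b. (n, x, m, k, b) \<in> set edges \<and> lcolor T (fst x) = i}" (is "?A = ?B")
proof (intro equalityI subsetI)
  fix z assume "z \<in> ?A"
  then have z: "z \<in> sigma_pow s (rep m)" "color T z = i" "young_column T (sigma_pow s (rep m) - {z})"
    by (auto simp: removable_def)
  obtain t n where n: "n < length reps" "sigma_pow s (rep m) - {z} = sigma_pow t (rep n)"
    using z(3) young_cases by blast
  have ins: "insert z (sigma_pow t (rep n)) = sigma_pow s (rep m)" using n(2) z(1) by auto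
  have "z \<in> addable T i (sigma_pow t (rep n))"
    using n(2) z(2) ins young_rep[OF m] unfolding addable_def by auto
  then obtain x m' k b where x: "z = shift t x" "(n, x, m', k, b) \<in> set edges" "lcolor T (fst x) = i"
    unfolding addable_rep[OF n(1)] by blast
  note e = edgeD[OF x(2)]
  have "sigma_pow (t + k) (rep m') = sigma_pow s (rep m)"
    using ins by (simp add: x(1) sigma_pow_insert[symmetric] e(4))
  from sigma_pow_rep_eqD[OF e(2) m this] have "t = s - k" "m' = m" by simp_all
  with x show "z \<in> ?B" by blast
next
  fix z assume "z \<in> ?B"
  then obtain n x k b where z: "z = shift (s - k) x" "(n, x, m, k, b) \<in> set edges" "lcolor T (fst x) = i"
    by blast
  note e = edgeD[OF z(2)]
  have y: "sigma_pow s (rep m) = insert z (sigma_pow (s - k) (rep n))"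
    using arg_cong[OF e(4), of "sigma_pow (s - k)"] by (simp add: z(1) sigma_pow_insert)
  have "z \<notin> sigma_pow (s - k) (rep n)" using e(3) by (simp add: z(1) mem_sigma_pow)
  then have "sigma_pow s (rep m) - {z} = sigma_pow (s - k) (rep n)" using y by auto
  then show "z \<in> ?A"
    using y young_rep[OF e(1)] z(3) by (auto simp: removable_def color_def z(1))
qed


section \<open>Column operators as active edges\<close>

lemma y_r_iff: "n < length reps \<Longrightarrow> sigma_pow s (rep n) \<in> y_r T j \<longleftrightarrow> special j = Some n"
proof (cases "special j")
  case (Some m)
  assume n: "n < length reps"
  have "sigma_pow s (rep n) \<in> col_class (rep m) \<longleftrightarrow> m = n"
    using sigma_pow_rep_eqD(2)[OF n special_less[OF Some]] by (auto simp: col_class_def)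
  then show ?thesis using Some special[of j] by (simp add: y_r_def base_raised)
qed (use special[of j] in \<open>simp add: y_r_def\<close>)

lemma unmarked_iff:
  "n < length reps \<Longrightarrow> unmarked special i n \<longleftrightarrow> (\<nexists>j. j \<noteq> i \<and> sigma_pow s (rep n) \<in> y_r T j)"
proof -
  assume n: "n < length reps"
  have "set [I0, I1, I2, I3, I4] = UNIV" by (simp add: UNIV_idx)
  then show ?thesis unfolding unmarked_def y_r_iff[OF n] by blast
qed

lemma active_edgeD:
  assumes "(n, x, m, k, True) \<in> set edges" "lcolor T (fst x) = i"
  shows "unmarked special i n" "unmarked special i m"
    and "(n, x', m', k', b') \<in> set edges \<Longrightarrow> lcolor T (fst x') = i \<Longrightarrow> x' \<noteq> x \<Longrightarrow> row T x' < row T x"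
    and "(n', x', m, k', b') \<in> set edges \<Longrightarrow> lcolor T (fst x') = i \<Longrightarrow>
      shift (- k') x' \<noteq> shift (- k) x \<Longrightarrow> row T (shift (- k) x) < row T (shift (- k') x')"
proof -
  note c = bspec[OF crystal[unfolded crystal_check_def] assms(1), unfolded crystal_edge.simps]
  show "unmarked special i n" "unmarked special i m"
    using c assms(2) by simp_all
  show "row T x' < row T x" if "(n, x', m', k', b') \<in> set edges" "lcolor T (fst x') = i" "x' \<noteq> x"
    using c assms(2) that by (fastforce simp: row_def)
  show "row T (shift (- k) x) < row T (shift (- k') x')"
    if "(n', x', m, k', b') \<in> set edges" "lcolor T (fst x') = i" "shift (- k') x' \<noteq> shift (- k) x"
    using c assms(2) that by (fastforce simp: row_def)
qed

lemma inactive_edgeD: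
  assumes "(n, x, m, k, b) \<in> set edges" "lcolor T (fst x) = i"
  shows "unmarked special i n \<Longrightarrow> n \<in> set (sources (lcolor T) edges i)"
    and "unmarked special i m \<Longrightarrow> m \<in> set (targets (lcolor T) edges i)"
proof -
  note c = bspec[OF crystal[unfolded crystal_check_def] assms(1), unfolded crystal_edge.simps]
  show "n \<in> set (sources (lcolor T) edges i)" if "unmarked special i n"
  proof (cases b)
    case True
    then show ?thesis using assms by (force simp: sources_def)
  qed (use c assms(2) that in simp)
  show "m \<in> set (targets (lcolor T) edges i)" if "unmarked special i m"
  proof (cases b)
    case True
    then show ?thesis using assms by (force simp: targets_def)
  qed (use c assms(2) that in simp)
qed

lemma sourcesE:
  assumes "n \<in> set (sources (lcolor T) edges i)"
  obtains x m k where "(n, x, m, k, True) \<in> set edges" "lcolor T (fst x) = i"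
  using assms that by (fastforce simp: sources_def)

lemma targetsE:
  assumes "m \<in> set (targets (lcolor T) edges i)"
  obtains n x k where "(n, x, m, k, True) \<in> set edges" "lcolor T (fst x) = i"
  using assms that by (fastforce simp: targets_def)

lemma col_f_edge:
  assumes e: "(n, x, m, k, True) \<in> set edges" "lcolor T (fst x) = i"
  shows "col_f T i (sigma_pow s (rep n)) = Some (sigma_pow (s + k) (rep m))"
proof -
  note E = edgeD[OF e(1)] and C = active_edgeD[OF e]
  have "col_f T i (sigma_pow s (rep n)) = Some (insert (shift s x) (sigma_pow s (rep n)))"
  proof (rule col_f_eqI)
    show "\<nexists>j. j \<noteq> i \<and> sigma_pow s (rep n) \<in> y_r T j" using C(1) unmarked_iff[OF E(1)] by blast
    show "shift s x \<in> addable T i (sigma_pow s (rep n))"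
      unfolding addable_rep[OF E(1)] using e by blast
    fix z assume "z \<in> addable T i (sigma_pow s (rep n))" "z \<noteq> shift s x"
    then show "row T z < row T (shift s x)"
      unfolding addable_rep[OF E(1)] using C(3) by auto
  qed
  then show ?thesis by (simp add: sigma_pow_insert[symmetric] E(4))
qed

lemma col_e_edge:
  assumes e: "(n, x, m, k, True) \<in> set edges" "lcolor T (fst x) = i"
  shows "col_e T i (sigma_pow s (rep m)) = Some (sigma_pow (s - k) (rep n))"
proof -
  note E = edgeD[OF e(1)] and C = active_edgeD[OF e]
  have "col_e T i (sigma_pow s (rep m)) = Some (sigma_pow s (rep m) - {shift (s - k) x})"
  proof (rule col_e_eqI)
    show "\<nexists>j. j \<noteq> i \<and> sigma_pow s (rep m) \<in> y_r T j" using C(2) unmarked_iff[OF E(2)] by blast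
    show "shift (s - k) x \<in> removable T i (sigma_pow s (rep m))"
      unfolding removable_rep[OF E(2)] using e by blast
    fix z assume "z \<in> removable T i (sigma_pow s (rep m))" "z \<noteq> shift (s - k) x"
    then obtain n' x' k' b' where z: "z = shift (s - k') x'" "(n', x', m, k', b') \<in> set edges"
        "lcolor T (fst x') = i" "shift (s - k') x' \<noteq> shift (s - k) x"
      unfolding removable_rep[OF E(2)] by auto
    have "shift (- k') x' \<noteq> shift (- k) x"
    proof
      assume "shift (- k') x' = shift (- k) x"
      then have "shift s (shift (- k') x') = shift s (shift (- k) x)" by simp
      with z(4) show False by simp
    qed
    from C(4)[OF z(2,3) this] show "row T (shift (s - k) x) < row T z" by (simp add: z(1))
  qed
  also have "sigma_pow s (rep m) - {shift (s - k) x} = sigma_pow (s - k) (rep n)"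
  proof -
    have "sigma_pow s (rep m) = insert (shift (s - k) x) (sigma_pow (s - k) (rep n))"
      using arg_cong[OF E(4), of "sigma_pow (s - k)"] by (simp add: sigma_pow_insert)
    then show ?thesis using E(3) by (simp add: mem_sigma_pow)
  qed
  finally show ?thesis .
qed

text \<open>At an unmarked vertex with an addable \<open>i\<close>-block the check supplies an
  active edge of color \<open>i\<close>, and \<open>col_f_edge\<close> says that the operator
  follows it.\<close>

lemma col_f_cases:
  assumes n: "n < length reps" and f: "col_f T i (sigma_pow s (rep n)) = Some y'"
  obtains x m k where "(n, x, m, k, True) \<in> set edges" "lcolor T (fst x) = i"
    "y' = sigma_pow (s + k) (rep m)"
proof -
  have "addable T i (sigma_pow s (rep n)) \<noteq> {}" "unmarked special i n"
    using f unfolding unmarked_iff[OF n, of i s] col_f_def by (auto split: if_splits)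
  then have "n \<in> set (sources (lcolor T) edges i)"
    using inactive_edgeD(1) unfolding addable_rep[OF n] by blast
  then obtain x m k where x: "(n, x, m, k, True) \<in> set edges" "lcolor T (fst x) = i"
    by (rule sourcesE)
  with col_f_edge[OF x, of s] f show thesis by (intro that[OF x]) simp
qed

lemma col_e_cases:
  assumes m: "m < length reps" and e: "col_e T i (sigma_pow s (rep m)) = Some y'"
  obtains n x k where "(n, x, m, k, True) \<in> set edges" "lcolor T (fst x) = i"
    "y' = sigma_pow (s - k) (rep n)"
proof -
  have "removable T i (sigma_pow s (rep m)) \<noteq> {}" "unmarked special i m"
    using e unfolding unmarked_iff[OF m, of i s] col_e_def by (auto split: if_splits)
  then have "m \<in> set (targets (lcolor T) edges i)"
    using inactive_edgeD(2) unfolding removable_rep[OF m] by blast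
  then obtain n x k where x: "(n, x, m, k, True) \<in> set edges" "lcolor T (fst x) = i"
    by (rule targetsE)
  with col_e_edge[OF x, of s] e show thesis by (intro that[OF x]) simp
qed

section \<open>String lengths read off from the tables\<close>

lemma stringD:
  assumes "(n, x, m, k, True) \<in> set edges" "lcolor T (fst x) = i"
  shows "phi i ! n = Suc (phi i ! m)" "eps i ! m = Suc (eps i ! n)"
  using bspec[OF conjunct1[OF strings[unfolded string_check_def]] assms(1)] assms(2)
  by simp_all

lemma string_tables:
  "length (eps i) = length reps" "length (phi i) = length reps"
  "supported_in (phi i) (sources (lcolor T) edges i)" "supported_in (eps i) (targets (lcolor T) edges i)"
proof -
  have "i \<in> set [I0, I1, I2, I3, I4]" by (cases i) auto
  note bspec[OF conjunct2[OF strings[unfolded string_check_def]] this]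
  then show "length (eps i) = length reps" "length (phi i) = length reps"
    "supported_in (phi i) (sources (lcolor T) edges i)" "supported_in (eps i) (targets (lcolor T) edges i)"
    by blast+
qed

lemma string_active:
  assumes "n < length reps"
  shows "phi i ! n \<noteq> 0 \<Longrightarrow> n \<in> set (sources (lcolor T) edges i)"
    and "eps i ! n \<noteq> 0 \<Longrightarrow> n \<in> set (targets (lcolor T) edges i)"
proof -
  have p: "(n, phi i ! n) \<in> set (enumerate 0 (phi i))" and e: "(n, eps i ! n) \<in> set (enumerate 0 (eps i))"
    using assms string_tables(1,2)[of i] by (simp_all add: in_set_enumerate_eq)
  show "n \<in> set (sources (lcolor T) edges i)" if "phi i ! n \<noteq> 0"
    using bspec[OF string_tables(3)[of i, unfolded supported_in_def] p] that by simp
  show "n \<in> set (targets (lcolor T) edges i)" if "eps i ! n \<noteq> 0"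
    using bspec[OF string_tables(4)[of i, unfolded supported_in_def] e] that by simp
qed

text \<open>Induction on the table entry; finiteness and length go together, because the step for
  \<open>Max\<close> needs the shorter string to be finite.\<close>

lemma f_string:
  assumes "n < length reps"
  shows "finite {r. iter_partial (col_f T i) r (sigma_pow s (rep n)) \<noteq> None}"
    and "col_phi T i (sigma_pow s (rep n)) = phi i ! n"
proof -
  have "finite {r. iter_partial (col_f T i) r (sigma_pow s (rep n)) \<noteq> None} \<and>
      Max {r. iter_partial (col_f T i) r (sigma_pow s (rep n)) \<noteq> None} = phi i ! n"
    using assms
  proof (induction "phi i ! n" arbitrary: n s)
    case 0
    have none: "col_f T i (sigma_pow s (rep n)) = None"
    proof (rule ccontr)
      assume "\<not> ?thesis"
      then obtain y' where "col_f T i (sigma_pow s (rep n)) = Some y'" by blast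
      then show False using 0 stringD(1) by (elim col_f_cases[OF 0(2)]) fastforce
    qed
    then show ?case unfolding string_end[of "col_f T i", OF none] using 0 by simp
  next
    case (Suc p)
    have "phi i ! n \<noteq> 0" using Suc(2) by linarith
    then have "n \<in> set (sources (lcolor T) edges i)" by (rule string_active(1)[OF Suc(3)])
    then obtain x m k where x: "(n, x, m, k, True) \<in> set edges" "lcolor T (fst x) = i"
      by (rule sourcesE)
    have m: "m < length reps" "p = phi i ! m"
      using edgeD(2)[OF x(1)] stringD(1)[OF x] Suc(2) by simp_all
    note IH = Suc(1)[OF m(2,1), of "s + k"] and f = col_f_edge[OF x, of s]
    show ?case
      unfolding Max_string_step[of "col_f T i", OF f conjunct1[OF IH]]
      unfolding string_step[of "col_f T i", OF f]
      using IH stringD(1)[OF x] by simp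
  qed
  then show "finite {r. iter_partial (col_f T i) r (sigma_pow s (rep n)) \<noteq> None}"
    "col_phi T i (sigma_pow s (rep n)) = phi i ! n"
    by (simp_all add: col_phi_def)
qed

lemma e_string:
  assumes "n < length reps"
  shows "finite {r. iter_partial (col_e T i) r (sigma_pow s (rep n)) \<noteq> None}"
    and "col_eps T i (sigma_pow s (rep n)) = eps i ! n"
proof -
  have "finite {r. iter_partial (col_e T i) r (sigma_pow s (rep n)) \<noteq> None} \<and>
      Max {r. iter_partial (col_e T i) r (sigma_pow s (rep n)) \<noteq> None} = eps i ! n"
    using assms
  proof (induction "eps i ! n" arbitrary: n s)
    case 0
    have none: "col_e T i (sigma_pow s (rep n)) = None"
    proof (rule ccontr)
      assume "\<not> ?thesis"
      then obtain y' where "col_e T i (sigma_pow s (rep n)) = Some y'" by blast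
      then show False using 0 stringD(2) by (elim col_e_cases[OF 0(2)]) fastforce
    qed
    then show ?case unfolding string_end[of "col_e T i", OF none] using 0 by simp
  next
    case (Suc p)
    have "eps i ! n \<noteq> 0" using Suc(2) by linarith
    then have "n \<in> set (targets (lcolor T) edges i)" by (rule string_active(2)[OF Suc(3)])
    then obtain x m k where x: "(m, x, n, k, True) \<in> set edges" "lcolor T (fst x) = i"
      by (rule targetsE)
    have m: "m < length reps" "p = eps i ! m"
      using edgeD(1)[OF x(1)] stringD(2)[OF x] Suc(2) by simp_all
    note IH = Suc(1)[OF m(2,1), of "s - k"] and e = col_e_edge[OF x, of s]
    show ?case
      unfolding Max_string_step[of "col_e T i", OF e conjunct1[OF IH]]
      unfolding string_step[of "col_e T i", OF e]
      using IH stringD(2)[OF x] by simp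
  qed
  then show "finite {r. iter_partial (col_e T i) r (sigma_pow s (rep n)) \<noteq> None}"
    "col_eps T i (sigma_pow s (rep n)) = eps i ! n"
    by (simp_all add: col_eps_def)
qed

section \<open>Weights of columns\<close>

lemma sum_content:
  assumes "finite (y - g)" "finite (g - y)"
  shows "(\<Sum>j\<in>UNIV. content T g y j * c j) =
    (\<Sum>x\<in>y - g. c (color T x)) - (\<Sum>x\<in>g - y. c (color T x))"
proof -
  have *: "(\<Sum>j\<in>UNIV. int (card {x \<in> A. color T x = j}) * c j) = (\<Sum>x\<in>A. c (color T x))"
    if "finite A" for A
  proof -
    have "int (card {x \<in> A. color T x = j}) * c j = sum (\<lambda>x. c (color T x)) {x \<in> A. color T x = j}" for j
      by simp
    then show ?thesis using that by (simp only: sum.group[OF _ finite subset_UNIV])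
  qed
  show ?thesis
    unfolding content_def left_diff_distrib sum_subtractf *[OF assms(1)] *[OF assms(2)] ..
qed

text \<open>The complete levels from the cutoff \<open>M\<close> up to \<open>s\<close> contribute
  multiples of the sum over one period, which is 0; the listed blocks remain.\<close>

lemma upper_sum:
  assumes L: "L \<in> set (exc # reps)" and "M \<le> s" and c: "sum_list (map (\<lambda>l. c (lcolor T l)) ls) = (0 :: int)"
  defines "U \<equiv> {x \<in> sigma_pow s (base L). M \<le> snd x}"
  shows "finite U" "(\<Sum>x\<in>U. c (color T x)) = sum_list (map (\<lambda>x. c (lcolor T (fst x))) L)"
proof -
  have finite_letters: "finite (UNIV :: 'l set)" using letters by (metis List.finite_set)
  have U: "U = UNIV \<times> {M..<s} \<union> shift s ` set L"
  proof -
    have "x \<in> U \<longleftrightarrow> x \<in> UNIV \<times> {M..<s} \<union> shift s ` set L" for x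
    proof -
      have "x \<in> shift s ` set L \<longleftrightarrow> shift (- s) x \<in> set L"
        unfolding image_iff by (metis shift_minus_eq)
      moreover have "s \<le> snd x" if "shift (- s) x \<in> set L"
        using repD(3)[OF L that] by auto
      ultimately show ?thesis
        using \<open>M \<le> s\<close> by (cases x) (auto simp: U_def mem_sigma_pow base_def)
    qed
    then show ?thesis by blast
  qed
  show "finite U" unfolding U using finite_letters by simp
  have disj: "UNIV \<times> {M..<s} \<inter> shift s ` set L = {}"
  proof -
    have "s \<le> snd x" if "x \<in> shift s ` set L" for x
      using that repD(3)[OF L] by fastforce
    then show ?thesis by force
  qed
  have "(\<Sum>l\<in>UNIV. c (lcolor T l)) = 0"
    using c pattern letters by (simp add: pattern_check_def sum_list_distinct_conv_sum_set)
  moreover have "(\<Sum>x\<in>UNIV \<times> {M..<s}. c (color T x)) = (\<Sum>l\<in>UNIV. \<Sum>m\<in>{M..<s}. c (lcolor T l))"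
    by (simp add: sum.cartesian_product color_def split_beta del: sum_constant)
  ultimately have "(\<Sum>x\<in>UNIV \<times> {M..<s}. c (color T x)) = 0"
    by (simp add: sum_distrib_left[symmetric])
  then have "(\<Sum>x\<in>U. c (color T x)) = (\<Sum>x\<in>shift s ` set L. c (color T x))"
    unfolding U using finite_letters disj by (subst sum.union_disjoint) auto
  also have "\<dots> = (\<Sum>x\<in>set L. c (color T x))"
    by (subst sum.reindex) (auto simp: inj_on_def)
  also have "\<dots> = sum_list (map (\<lambda>x. c (lcolor T (fst x))) L)"
    using distinct_rep[OF L] by (simp add: sum_list_distinct_conv_sum_set color_def)
  finally show "(\<Sum>x\<in>U. c (color T x)) = sum_list (map (\<lambda>x. c (lcolor T (fst x))) L)" .
qed

text \<open>Both columns contain everything below \<open>M\<close>, so \<open>y - g\<close> and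
  \<open>g - y\<close> are differences of finite parts, whose sums \<open>upper_sum\<close>
  evaluates.\<close>

lemma string_weight:
  assumes n: "n < length reps" and y: "y = sigma_pow s (rep n)" and g: "g = sigma_pow t (rep vac)"
    and fin: "finite (y - g)" "finite (g - y)"
  shows "int (phi i ! n) - int (eps i ! n) = - (\<Sum>j\<in>UNIV. content T g y j * cartan T i j)"
proof -
  define c where "c = cartan T i"
  define w where "w L = sum_list (map (\<lambda>x. c (lcolor T (fst x))) L)" for L :: "'l block list"
  have "i \<in> set [I0, I1, I2, I3, I4]" by (cases i) auto
  note W = bspec[OF weights[unfolded weight_check_def] this, unfolded Let_def, folded c_def, folded w_def]
  have c0: "sum_list (map (\<lambda>l. c (lcolor T l)) ls) = 0" using W by blast
  have "(n, reps ! n) \<in> set (enumerate 0 reps)" using n by (simp add: in_set_enumerate_eq)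
  then have wn: "int (phi i ! n) - int (eps i ! n) = w (reps ! vac) - w (reps ! n)"
    using W by blast
  define M where "M = min s t"
  define up where "up A = {x \<in> A. M \<le> snd x}" for A :: "'l column"
  have M: "M \<le> s" "M \<le> t" by (simp_all add: M_def)
  have low: "x \<in> y" "x \<in> g" if "snd x < M" for x
    using that M by (simp_all add: y g mem_sigma_pow base_def)
  have d: "y - g = up y - up g" "g - y = up g - up y"
    using low by (force simp: up_def)+
  have sy: "finite (up y)" "(\<Sum>x\<in>up y. c (color T x)) = w (reps ! n)"
    using upper_sum[OF _ M(1) c0, of "reps ! n"] n by (simp_all add: up_def y w_def)
  have sg: "finite (up g)" "(\<Sum>x\<in>up g. c (color T x)) = w (reps ! vac)"
    using upper_sum[OF _ M(2) c0, of "reps ! vac"] vac(1) by (simp_all add: up_def g w_def)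
  have "(\<Sum>x\<in>y - g. c (color T x)) - (\<Sum>x\<in>g - y. c (color T x)) = w (reps ! n) - w (reps ! vac)"
    unfolding d sy(2)[symmetric] sg(2)[symmetric]
    using sum.Int_Diff[OF sy(1), of "\<lambda>x. c (color T x)" "up g"]
      sum.Int_Diff[OF sg(1), of "\<lambda>x. c (color T x)" "up y"] by (simp add: Int_commute)
  then show ?thesis
    using sum_content[OF fin, of c] wn by (simp add: c_def)
qed

section \<open>The energy function\<close>

definition class_index :: "'l column set \<Rightarrow> nat" where
  "class_index A = (THE n. n < length reps \<and> A = col_class (rep n))"

lemma class_index_rep: "n < length reps \<Longrightarrow> class_index (col_class (rep n)) = n"
  unfolding class_index_def
proof (rule the_equality)
  fix m assume n: "n < length reps" and m: "m < length reps \<and> col_class (rep n) = col_class (rep m)"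
  have "sigma_pow 0 (rep n) \<in> col_class (rep n)" unfolding col_class_def by blast
  then obtain k where "sigma_pow 0 (rep n) = sigma_pow k (rep m)"
    unfolding m[THEN conjunct2] by (auto simp: col_class_def)
  from sigma_pow_rep_eqD(2)[OF n m[THEN conjunct1] this] show "m = n" by simp
qed simp

lemma energyD:
  assumes "(n, x, m, k, True) \<in> set edges" "lcolor T (fst x) = i" "c < length reps"
  shows "eps i ! c < phi i ! n \<Longrightarrow> en ! m ! c + (if i = I0 then 1 else 0) = en ! n ! c"
    and "phi i ! c \<le> eps i ! n \<Longrightarrow> en ! c ! m = en ! c ! n + (if i = I0 then 1 else 0)"
proof -
  note len = string_tables(1,2)[of i]
  have len': "length en = length reps" "\<And>r. r \<in> set en \<Longrightarrow> length r = length reps"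
    and c: "energy_edge (lcolor T) eps phi en (n, x, m, k, True)"
    using energies assms(1) unfolding energy_check_def by blast+
  note nm = edgeD(1,2)[OF assms(1)]
  show "en ! m ! c + (if i = I0 then 1 else 0) = en ! n ! c" if "eps i ! c < phi i ! n"
  proof -
    have "(eps i ! c, en ! m ! c, en ! n ! c) \<in> set (zip (eps i) (zip (en ! m) (en ! n)))"
      using len len' nm assms(3) by (force simp: in_set_zip)
    then show ?thesis using c assms(2) that by (fastforce simp: differ_by_def)
  qed
  show "en ! c ! m = en ! c ! n + (if i = I0 then 1 else 0)" if "phi i ! c \<le> eps i ! n"
  proof -
    have "(phi i ! c, en ! c ! n, en ! c ! m) \<in>
        set (zip (phi i) (zip (map (\<lambda>r. r ! n) en) (map (\<lambda>r. r ! m) en)))"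
      using len len' nm assms(3) by (force simp: in_set_zip)
    then show ?thesis using c assms(2) that by (fastforce simp: differ_by_def)
  qed
qed

text \<open>The witness behind \<open>SOME\<close>: an arrow of the tensor product is an active edge
  in one factor, and \<open>energyD\<close> gives the change of the table along it.\<close>

lemma energy_function:
  "is_energy_function T (\<lambda>A B. int (en ! class_index A ! class_index B))"
  unfolding is_energy_function_def
proof (intro conjI allI impI)
  show "int (en ! class_index (y_empty T) ! class_index (y_empty T)) = 0"
    using class_index_rep[OF vac(1)] vac(2,3) by (simp add: y_empty_def)
  fix i a b a' b'
  assume A: "young_column T a \<and> young_column T b \<and> tensor_f T i (a, b) = Some (a', b')"
  obtain s n where a: "n < length reps" "a = sigma_pow s (rep n)" using A young_cases by blast
  obtain t c where b: "c < length reps" "b = sigma_pow t (rep c)" using A young_cases by blast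
  note str = f_string(2)[OF a(1)] e_string(2)[OF b(1)]
  show "int (en ! class_index (col_class a') ! class_index (col_class b')) -
      int (en ! class_index (col_class a) ! class_index (col_class b)) =
      (if i \<noteq> I0 then 0 else if col_phi T I0 a > col_eps T I0 b then - 1 else 1)"
  proof (cases "eps i ! c < phi i ! n")
    case True
    then have "col_f T i a = Some a'" "b' = b"
      using A by (auto simp: tensor_f_def a b str)
    then obtain x m k where x: "(n, x, m, k, True) \<in> set edges" "lcolor T (fst x) = i"
        "a' = sigma_pow (s + k) (rep m)"
      using col_f_cases[OF a(1)] unfolding a(2) by blast
    show ?thesis
      using energyD(1)[OF x(1,2) b(1) True] True edgeD(2)[OF x(1)] \<open>b' = b\<close> a(1) b(1)
      by (cases "i = I0") (auto simp: x(3) a(2) b(2) class_index_rep str)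
  next
    case False
    then have "col_f T i b = Some b'" "a' = a"
      using A by (auto simp: tensor_f_def a b str)
    then obtain x m k where x: "(c, x, m, k, True) \<in> set edges" "lcolor T (fst x) = i"
        "b' = sigma_pow (t + k) (rep m)"
      using col_f_cases[OF b(1)] unfolding b(2) by blast
    show ?thesis
      using energyD(2)[OF x(1,2) a(1)] False edgeD(2)[OF x(1)] \<open>a' = a\<close> a(1) b(1)
      by (cases "i = I0") (auto simp: x(3) a(2) b(2) class_index_rep str)
  qed
qed

theorem column_crystal:
  assumes "g \<in> y_empty T"
  shows "column_crystal T g"
proof
  obtain t where g: "g = sigma_pow t (rep vac)"
    using assms by (auto simp: y_empty_def vac(2) col_class_def)
  show "col_phi T i g = of_bool (i = I0)" "col_eps T i g = of_bool (i = I0)" for i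
    by (simp_all only: g f_string(2)[OF vac(1)] e_string(2)[OF vac(1)] vac_strings)
  show "\<exists>H. is_energy_function T H" using energy_function by blast
  fix y i assume y: "young_column T y"
  obtain s n where n: "n < length reps" "y = sigma_pow s (rep n)" using young_cases[OF y] by blast
  show "finite {r. iter_partial (col_f T i) r y \<noteq> None}" "finite {r. iter_partial (col_e T i) r y \<noteq> None}"
    unfolding n(2) by (fact f_string(1)[OF n(1)], fact e_string(1)[OF n(1)])
  show "int (col_phi T i y) - int (col_eps T i y) = - (\<Sum>j\<in>UNIV. content T g y j * cartan T i j)"
    if "finite (y - g)" "finite (g - y)"
    using string_weight[OF n g that] by (simp only: n(2) f_string(2)[OF n(1)] e_string(2)[OF n(1)])
  fix y'
  show "\<exists>x. x \<notin> y \<and> color T x = i \<and> y' = insert x y \<and> young_column T y'"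
    if f: "col_f T i y = Some y'"
  proof -
    obtain x m k where x: "(n, x, m, k, True) \<in> set edges" "lcolor T (fst x) = i"
        "y' = sigma_pow (s + k) (rep m)"
      using col_f_cases[OF n(1)] f unfolding n(2) by blast
    note e = edgeD[OF x(1)]
    show ?thesis
    proof (intro exI conjI)
      show "shift s x \<notin> y" using e(3) by (simp add: n(2) mem_sigma_pow)
      show "color T (shift s x) = i" using x(2) by (simp add: color_def)
      show "y' = insert (shift s x) y" by (simp add: x(3) n(2) sigma_pow_insert[symmetric] e(4))
      show "young_column T y'" using young_rep[OF e(2)] by (simp add: x(3))
    qed
  qed
  show "young_column T y'" if "col_e T i y = Some y'"
    using col_e_cases[OF n(1)] that edgeD(1) young_rep unfolding n(2) by metis
  assume y': "young_column T y'"
  obtain t m where m: "m < length reps" "y' = sigma_pow t (rep m)" using young_cases[OF y'] by blast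
  show "col_f T i y = Some y' \<longleftrightarrow> col_e T i y' = Some y"
  proof
    assume f: "col_f T i y = Some y'"
    then obtain x m' k where x: "(n, x, m', k, True) \<in> set edges" "lcolor T (fst x) = i"
        "y' = sigma_pow (s + k) (rep m')"
      using col_f_cases[OF n(1)] unfolding n(2) by blast
    then show "col_e T i y' = Some y" using col_e_edge[OF x(1,2), of "s + k"] by (simp add: n(2))
  next
    assume e: "col_e T i y' = Some y"
    then obtain n' x k where x: "(n', x, m, k, True) \<in> set edges" "lcolor T (fst x) = i"
        "y = sigma_pow (t - k) (rep n')"
      using col_e_cases[OF m(1)] unfolding m(2) by blast
    then show "col_f T i y = Some y'" using col_f_edge[OF x(1,2), of "t - k"] by (simp add: m(2))
  qed
qed

end

section \<open>The pattern of type $E_6^{(2)}$\<close>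

definition e_reps :: "e_letter block list list" where
  "e_reps = [
    [], [(Ec, 0)], [(Ea, 0)], [(Ea, 0), (Ec, 0)], [(Eb, 0), (Ec, 0)],
    [(Eb', 0), (Ea, 0), (Ec, 0)], [(Ea', 0), (Eb, 0), (Ec, 0)],
    [(Eb', 0), (Eb, 0), (Ea, 0), (Ec, 0)], [(Ea', 0), (Eb, 0), (Ea, 0), (Ec, 0)],
    [(Ez, 0), (Ea', 0), (Eb, 0), (Ec, 0)], [(Ea', 0), (Eb', 0), (Eb, 0), (Ea, 0), (Ec, 0)],
    [(Ec', 0), (Eb', 0), (Eb, 0), (Ea, 0), (Ec, 0)],
    [(Ez, 0), (Ea', 0), (Eb, 0), (Ea, 0), (Ec, 0)],
    [(Ec', 0), (Ea', 0), (Eb', 0), (Eb, 0), (Ea, 0), (Ec, 0)],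
    [(Ez, 0), (Ea', 0), (Eb', 0), (Eb, 0), (Ea, 0), (Ec, 0)],
    [(Ed, 0), (Ec', 0), (Eb', 0), (Eb, 0), (Ea, 0), (Ec, 0)],
    [(Ez, 0), (Ec', 0), (Ea', 0), (Eb', 0), (Eb, 0), (Ea, 0), (Ec, 0)],
    [(Eb'', 0), (Ec', 0), (Ea', 0), (Eb', 0), (Eb, 0), (Ea, 0), (Ec, 0)],
    [(Ed, 0), (Ec', 0), (Ea', 0), (Eb', 0), (Eb, 0), (Ea, 0), (Ec, 0)],
    [(Eb'', 0), (Ez, 0), (Ec', 0), (Ea', 0), (Eb', 0), (Eb, 0), (Ea, 0), (Ec, 0)],
    [(Ed, 0), (Ez, 0), (Ec', 0), (Ea', 0), (Eb', 0), (Eb, 0), (Ea, 0), (Ec, 0)],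
    [(Ed, 0), (Eb'', 0), (Ec', 0), (Ea', 0), (Eb', 0), (Eb, 0), (Ea, 0), (Ec, 0)],
    [(Ec, 1), (Ed, 0), (Eb'', 0), (Ec', 0), (Ea', 0), (Eb', 0), (Eb, 0), (Ea, 0), (Ec, 0)],
    [(Ea, 1), (Eb'', 0), (Ez, 0), (Ec', 0), (Ea', 0), (Eb', 0), (Eb, 0), (Ea, 0), (Ec, 0)],
    [(Eb, 1), (Ec, 1), (Ed, 0), (Eb'', 0), (Ec', 0), (Ea', 0), (Eb', 0), (Eb, 0), (Ea, 0), (Ec, 0)],
    [(Ea', 1), (Eb, 1), (Ec, 1), (Ed, 0), (Eb'', 0), (Ec', 0), (Ea', 0), (Eb', 0), (Eb, 0), (Ea, 0), (Ec, 0)],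
    [(Ez, 1), (Ea', 1), (Eb, 1), (Ec, 1), (Ed, 0), (Eb'', 0), (Ec', 0), (Ea', 0), (Eb', 0), (Eb, 0), (Ea, 0), (Ec, 0)]]"

text \<open>The exceptional column moved to index 0: \<open>Eb\<close> is the free 2-block in the
  top row, \<open>Ea\<close> the free 1-block.\<close>

definition e_exc :: "e_letter block list" where
  "e_exc = [(Eb, 0), (Ea, 0), (Ec, 0)]"

text \<open>The two inactive edges are the 0-edges at representative 6, the class
  \<open>y_r E62 I1\<close>, where only color 1 acts.\<close>

definition e_edges :: "e_letter edge list" where
  "e_edges = [
    (0, (Ec, 0), 1, 0, True), (0, (Ea, 0), 2, 0, True), (1, (Ea, 0), 3, 0, True),
    (1, (Eb, 0), 4, 0, True), (2, (Ec, 0), 3, 0, True), (3, (Eb', 0), 5, 0, True),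
    (4, (Ea', 0), 6, 0, True), (5, (Eb, 0), 7, 0, True), (6, (Ea, 0), 8, 0, True),
    (6, (Ez, 0), 9, 0, False), (7, (Ea', 0), 10, 0, True), (7, (Ec', 0), 11, 0, True),
    (8, (Eb', 0), 10, 0, True), (8, (Ez, 0), 12, 0, True), (9, (Ea, 0), 12, 0, True),
    (10, (Ec', 0), 13, 0, True), (10, (Ez, 0), 14, 0, True), (11, (Ea', 0), 13, 0, True),
    (11, (Ed, 0), 15, 0, True), (12, (Eb', 0), 14, 0, True), (13, (Ez, 0), 16, 0, True),
    (13, (Eb'', 0), 17, 0, True), (13, (Ed, 0), 18, 0, True), (14, (Ec', 0), 16, 0, True),
    (15, (Ea', 0), 18, 0, True), (16, (Eb'', 0), 19, 0, True), (16, (Ed, 0), 20, 0, True),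
    (17, (Ez, 0), 19, 0, True), (17, (Ed, 0), 21, 0, True), (18, (Ez, 0), 20, 0, True),
    (18, (Eb'', 0), 21, 0, True), (19, (Ed, 0), 0, 1, True), (19, (Ea, 1), 23, 0, True),
    (20, (Eb'', 0), 0, 1, True), (21, (Ez, 0), 0, 1, True), (21, (Ec, 1), 22, 0, True),
    (22, (Ez, 0), 1, 1, True), (22, (Eb, 1), 24, 0, True), (23, (Ed, 0), 2, 1, True),
    (24, (Ez, 0), 4, 1, True), (24, (Ea', 1), 25, 0, True), (25, (Ez, 0), 6, 1, False),
    (25, (Ez, 1), 26, 0, True), (26, (Ez, 0), 9, 1, True)]"

fun e_eps :: "idx \<Rightarrow> nat list" where
  "e_eps I0 = [
    1, 1, 0, 0, 1, 0, 0, 0, 0, 2, 0, 0, 1, 0, 1, 0, 1, 0, 0, 1, 1, 0, 0, 0, 0, 0, 1]"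
| "e_eps I1 = [
    0, 0, 1, 1, 0, 0, 1, 0, 2, 0, 1, 0, 1, 1, 0, 0, 0, 0, 1, 0, 0, 0, 0, 1, 0, 1, 0]"
| "e_eps I2 = [
    1, 0, 0, 0, 1, 1, 0, 2, 0, 0, 1, 0, 0, 0, 1, 0, 0, 1, 0, 1, 0, 1, 0, 0, 1, 0, 0]"
| "e_eps I3 = [
    0, 1, 0, 1, 0, 0, 0, 0, 0, 0, 0, 1, 0, 1, 0, 0, 1, 0, 0, 0, 0, 0, 1, 0, 0, 0, 0]"
| "e_eps I4 = [
    1, 0, 1, 0, 0, 0, 0, 0, 0, 0, 0, 0, 0, 0, 0, 1, 0, 0, 1, 0, 1, 1, 0, 0, 0, 0, 0]"

fun e_phi :: "idx \<Rightarrow> nat list" where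
  "e_phi I0 = [
    0, 0, 0, 0, 0, 0, 0, 0, 1, 0, 1, 0, 0, 1, 0, 0, 0, 1, 1, 0, 0, 1, 1, 0, 1, 2, 1]"
| "e_phi I1 = [
    1, 1, 0, 0, 2, 0, 1, 1, 0, 1, 0, 1, 0, 0, 0, 1, 0, 0, 0, 1, 0, 0, 0, 0, 1, 0, 0]"
| "e_phi I2 = [
    0, 1, 0, 2, 0, 1, 0, 0, 1, 0, 0, 0, 1, 1, 0, 0, 1, 0, 1, 0, 1, 0, 1, 0, 0, 0, 0]"
| "e_phi I3 = [
    1, 0, 1, 0, 0, 0, 0, 1, 0, 0, 1, 0, 0, 0, 1, 0, 0, 0, 0, 0, 0, 1, 0, 0, 0, 0, 0]"
| "e_phi I4 = [
    0, 0, 0, 0, 0, 0, 0, 0, 0, 0, 0, 1, 0, 1, 0, 0, 1, 1, 0, 1, 0, 0, 0, 1, 0, 0, 0]"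

text \<open>Rows belong to the left tensor factor, columns to the right one; the 0 in the last
  corner is the normalization at \<open>y_empty E62\<close>.\<close>

definition e_energy :: "nat list list" where
  "e_energy = [
    [2,1,1,1,1,1,1,1,1,2,1,1,2,1,2,1,2,1,1,2,2,1,0,1,0,0,1],
    [2,2,1,1,1,1,1,1,1,2,1,1,2,1,2,1,2,1,1,2,2,1,1,1,0,0,1],
    [2,1,2,1,1,1,1,1,1,2,1,1,2,1,2,1,2,1,1,2,2,1,0,2,0,0,1],
    [2,2,2,2,1,1,1,1,1,2,1,1,2,1,2,1,2,1,1,2,2,1,1,2,0,0,1],
    [2,2,1,1,2,1,1,1,1,2,1,1,2,1,2,1,2,1,1,2,2,1,1,1,1,0,1],
    [2,2,2,2,1,1,1,1,1,2,1,1,2,1,2,1,2,1,1,2,2,1,1,2,0,0,1],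
    [2,2,1,1,2,1,1,1,1,2,1,1,2,1,2,1,2,1,1,2,2,1,1,1,1,0,1],
    [2,2,2,2,2,2,1,2,1,2,1,1,2,1,2,1,2,1,1,2,2,1,1,2,1,0,1],
    [2,2,2,2,2,1,2,1,2,2,1,1,2,1,2,1,2,1,1,2,2,1,1,2,1,1,1],
    [1,1,0,0,1,0,0,0,0,2,0,0,1,0,1,0,1,0,0,1,1,0,0,0,0,0,1],
    [2,2,2,2,2,2,2,2,2,2,2,1,2,1,2,1,2,1,1,2,2,1,1,2,1,1,1],
    [2,2,2,2,2,2,1,2,1,2,1,2,2,1,2,1,2,1,1,2,2,1,1,2,1,0,1],
    [1,1,1,1,1,0,1,0,1,2,0,0,2,0,1,0,1,0,0,1,1,0,0,1,0,0,1],
    [2,2,2,2,2,2,2,2,2,2,2,2,2,2,2,1,2,1,1,2,2,1,1,2,1,1,1],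
    [1,1,1,1,1,1,1,1,1,2,1,0,2,0,2,0,1,0,0,1,1,0,0,1,0,0,1],
    [2,2,2,2,2,2,1,2,1,2,1,2,2,1,2,2,2,1,1,2,2,1,1,2,1,0,1],
    [1,1,1,1,1,1,1,1,1,2,1,1,2,1,2,0,2,0,0,1,1,0,0,1,0,0,1],
    [2,2,2,2,2,2,2,2,2,2,2,2,2,2,2,1,2,2,1,2,2,1,1,2,1,1,1],
    [2,2,2,2,2,2,2,2,2,2,2,2,2,2,2,2,2,1,2,2,2,1,1,2,1,1,1],
    [1,1,1,1,1,1,1,1,1,2,1,1,2,1,2,0,2,1,0,2,1,0,0,1,0,0,1],
    [1,1,1,1,1,1,1,1,1,2,1,1,2,1,2,1,2,0,1,1,2,0,0,1,0,0,1],
    [2,2,2,2,2,2,2,2,2,2,2,2,2,2,2,2,2,2,2,2,2,2,1,2,1,1,1],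
    [2,2,2,2,2,2,2,2,2,2,2,2,2,2,2,2,2,2,2,2,2,2,2,2,1,1,1],
    [1,1,1,1,1,1,1,1,1,2,1,1,2,1,2,0,2,1,0,2,1,0,0,2,0,0,1],
    [2,2,2,2,2,2,2,2,2,2,2,2,2,2,2,2,2,2,2,2,2,2,2,2,2,1,1],
    [2,2,2,2,2,2,2,2,2,2,2,2,2,2,2,2,2,2,2,2,2,2,2,2,2,2,1],
    [1,1,1,1,1,1,1,1,1,1,1,1,1,1,1,1,1,1,1,1,1,1,1,1,1,1,0]]"

text \<open>The defining columns of these classes are complete at index 0; moved down by one power
  of \<sigma> they become the representatives named here.\<close>

fun e_special :: "idx \<Rightarrow> nat option" where
  "e_special I0 = None"
| "e_special I1 = Some 6"
| "e_special I2 = Some 5"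
| "e_special I3 = None"
| "e_special I4 = None"

definition e_vac :: nat where
  "e_vac = 26"

definition e_letters :: "e_letter list" where
  "e_letters = [Ec, Ea, Eb, Eb', Ea', Ec', Ez, Eb'', Ed]"

fun e_supports :: "e_letter \<Rightarrow> e_letter block list" where
  "e_supports Ec = [(Eb'', -1), (Ed, -1)]"
| "e_supports Ea = [(Ez, -1), (Eb'', -1)]"
| "e_supports Eb = [(Ec, 0)]"
| "e_supports Eb' = [(Ec, 0), (Ea, 0)]"
| "e_supports Ea' = [(Eb, 0)]"
| "e_supports Ec' = [(Eb, 0), (Eb', 0)]"
| "e_supports Ez = [(Ea', 0)]"
| "e_supports Eb'' = [(Ea', 0), (Ec', 0)]"
| "e_supports Ed = [(Ec', 0)]"

definition e_bottom :: "e_letter block list" where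
  "e_bottom = [(Ec, 0), (Ea, 0), (Eb, 0), (Eb', 0), (Ea', 0), (Ec', 0), (Eb'', 0)]"

section \<open>Verification of the tables of type E_6^(2)\<close>

lemma e_letters: "set e_letters = UNIV"
  unfolding e_letters_def by (auto intro: e_letter.exhaust)

lemma e_base_eq: "e_base = base e_bottom"
proof (rule set_eqI)
  fix x :: "e_letter block"
  show "x \<in> e_base \<longleftrightarrow> x \<in> base e_bottom"
    by (cases x; cases "fst x") (auto simp: e_base_def base_def e_bottom_def)
qed

lemma e_base_Un:
  assumes "same_set (e_bottom @ M) L"
  shows "e_base \<union> set M = base L"
  using assms by (auto simp: e_base_eq base_def same_set_def)

lemma E62_simps:
  "cartan E62 = cartan_E62" "lcolor E62 = e_color" "lrow E62 = e_row" "lsupp E62 = e_supp" "rep_r E62 = e_rep_r"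
  by (simp_all add: E62_def)

lemma e_rep_r_eq: "e_rep_r j = map_option (\<lambda>n. base (raised e_letters (e_reps ! n))) (e_special j)"
proof (cases j)
  case I1
  have "same_set (e_bottom @ [(Ez, 0), (Ed, 0), (Ec, 1), (Eb, 1), (Ea', 1)])
      (raised e_letters (e_reps ! 6))"
    by code_simp
  from e_base_Un[OF this] show ?thesis by (simp add: I1)
next
  case I2
  have "same_set (e_bottom @ [(Ez, 0), (Ea, 1), (Eb', 1), (Ed, 0), (Ec, 1)])
      (raised e_letters (e_reps ! 5))"
    by code_simp
  from e_base_Un[OF this] show ?thesis by (simp add: I2)
qed simp_all

lemma rep_empty_E62: "rep_empty E62 = base (e_reps ! e_vac)"
proof -
  have "same_set (e_bottom @ [(Ed, 0), (Ec, 1), (Eb, 1), (Ea', 1), (Ez, 1)]) (e_reps ! e_vac)"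
    by code_simp
  from e_base_Un[OF this] show ?thesis by (simp add: E62_def)
qed

interpretation e62: column_table E62 e_letters e_supports e_reps e_exc e_edges e_eps e_phi e_energy
  e_special e_vac
proof
  show "set e_letters = UNIV" by (fact e_letters)
  show "lsupp E62 l = set (e_supports l)" for l unfolding E62_simps by (cases l) simp_all
  show "pattern_check e_letters e_supports (lrow E62)" unfolding E62_simps by code_simp
  show "ideals_check e_letters e_supports (e_exc # e_reps)" by code_simp
  show "\<forall>L\<in>set (e_exc # e_reps). rep_check e_letters e_supports L" by code_simp
  show "exceptional_list e_letters e_supports (lcolor E62) (lrow E62) e_exc"
    unfolding E62_simps by code_simp
  show "\<forall>L\<in>set e_reps. \<not> exceptional_list e_letters e_supports (lcolor E62) (lrow E62) L"
    unfolding E62_simps by code_simp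
  show "distinct e_reps" by code_simp
  show "edge_check e_letters e_reps e_edges" by code_simp
  show "complete_check e_letters e_supports e_reps e_exc e_edges" by code_simp
  show "crystal_check (lcolor E62) (lrow E62) e_special e_edges"
    unfolding E62_simps by code_simp
  show "string_check (length e_reps) (lcolor E62) e_eps e_phi e_edges"
    unfolding E62_simps by code_simp
  show "weight_check (cartan E62) (lcolor E62) e_letters e_reps e_vac e_eps e_phi"
    unfolding E62_simps by code_simp
  show "energy_check (length e_reps) (lcolor E62) e_eps e_phi e_energy e_edges"
    unfolding E62_simps by code_simp
  show "rep_r E62 j = map_option (\<lambda>n. base (raised e_letters (e_reps ! n))) (e_special j)" for j
    unfolding E62_simps by (fact e_rep_r_eq)
  have N: "length e_reps = 27" by code_simp
  show "n < length e_reps" if "e_special j = Some n" for j n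
    using that by (cases j) (auto simp: N)
  show "e_vac < length e_reps" "e_energy ! e_vac ! e_vac = 0" by code_simp+
  show "rep_empty E62 = base (e_reps ! e_vac)" by (fact rep_empty_E62)
  \<comment> \<open>Once \<open>simp only:\<close> has inserted the constructor chosen by
    \<open>cases\<close>, the goal is a closed term that can be evaluated.\<close>
  show "e_phi i ! e_vac = of_bool (i = I0)" "e_eps i ! e_vac = of_bool (i = I0)" for i
    by (cases i; simp only:; code_simp)+
qed

section \<open>The pattern of type $F_4^{(1)}$\<close>

definition f_reps :: "f_letter block list list" where
  "f_reps = [
    [], [(Fc1, 0)], [(Fd1, 0)], [(Fa1, 0)], [(Fd1, 0), (Fc1, 0)], [(Fa1, 0), (Fc1, 0)],
    [(Fa1, 0), (Fd1, 0)], [(Fa1, 0), (Fd1, 0), (Fc1, 0)], [(Fc2, 0), (Fd1, 0), (Fc1, 0)],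
    [(Fb1, 0), (Fa1, 0), (Fc1, 0)], [(Fc2, 0), (Fa1, 0), (Fd1, 0), (Fc1, 0)],
    [(Fb1, 0), (Fa1, 0), (Fd1, 0), (Fc1, 0)], [(Fb2, 0), (Fc2, 0), (Fd1, 0), (Fc1, 0)],
    [(Fc3, 0), (Fb1, 0), (Fa1, 0), (Fc1, 0)],
    [(Fb1, 0), (Fc2, 0), (Fa1, 0), (Fd1, 0), (Fc1, 0)],
    [(Fc3, 0), (Fb1, 0), (Fa1, 0), (Fd1, 0), (Fc1, 0)],
    [(Fa2, 0), (Fb2, 0), (Fc2, 0), (Fd1, 0), (Fc1, 0)],
    [(Fd2, 0), (Fc3, 0), (Fb1, 0), (Fa1, 0), (Fc1, 0)],
    [(Fb2, 0), (Fb1, 0), (Fc2, 0), (Fa1, 0), (Fd1, 0), (Fc1, 0)],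
    [(Fc3, 0), (Fb1, 0), (Fc2, 0), (Fa1, 0), (Fd1, 0), (Fc1, 0)],
    [(Fa2, 0), (Fb2, 0), (Fc2, 0), (Fa1, 0), (Fd1, 0), (Fc1, 0)],
    [(Fd2, 0), (Fc3, 0), (Fb1, 0), (Fa1, 0), (Fd1, 0), (Fc1, 0)],
    [(Fz, 0), (Fa2, 0), (Fb2, 0), (Fc2, 0), (Fd1, 0), (Fc1, 0)],
    [(Fc3, 0), (Fb2, 0), (Fb1, 0), (Fc2, 0), (Fa1, 0), (Fd1, 0), (Fc1, 0)],
    [(Fa2, 0), (Fb2, 0), (Fb1, 0), (Fc2, 0), (Fa1, 0), (Fd1, 0), (Fc1, 0)],
    [(Fd2, 0), (Fc3, 0), (Fb1, 0), (Fc2, 0), (Fa1, 0), (Fd1, 0), (Fc1, 0)],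
    [(Fz, 0), (Fa2, 0), (Fb2, 0), (Fc2, 0), (Fa1, 0), (Fd1, 0), (Fc1, 0)],
    [(Fa2, 0), (Fc3, 0), (Fb2, 0), (Fb1, 0), (Fc2, 0), (Fa1, 0), (Fd1, 0), (Fc1, 0)],
    [(Fc4, 0), (Fc3, 0), (Fb2, 0), (Fb1, 0), (Fc2, 0), (Fa1, 0), (Fd1, 0), (Fc1, 0)],
    [(Fd2, 0), (Fc3, 0), (Fb2, 0), (Fb1, 0), (Fc2, 0), (Fa1, 0), (Fd1, 0), (Fc1, 0)],
    [(Fz, 0), (Fa2, 0), (Fb2, 0), (Fb1, 0), (Fc2, 0), (Fa1, 0), (Fd1, 0), (Fc1, 0)],
    [(Fc4, 0), (Fa2, 0), (Fc3, 0), (Fb2, 0), (Fb1, 0), (Fc2, 0), (Fa1, 0), (Fd1, 0), (Fc1, 0)],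
    [(Fd2, 0), (Fa2, 0), (Fc3, 0), (Fb2, 0), (Fb1, 0), (Fc2, 0), (Fa1, 0), (Fd1, 0), (Fc1, 0)],
    [(Fz, 0), (Fa2, 0), (Fc3, 0), (Fb2, 0), (Fb1, 0), (Fc2, 0), (Fa1, 0), (Fd1, 0), (Fc1, 0)],
    [(Fd2, 0), (Fc4, 0), (Fc3, 0), (Fb2, 0), (Fb1, 0), (Fc2, 0), (Fa1, 0), (Fd1, 0), (Fc1, 0)],
    [(Fd1, 1), (Fd2, 0), (Fc4, 0), (Fc3, 0), (Fb2, 0), (Fb1, 0), (Fc2, 0), (Fa1, 0), (Fd1, 0), (Fc1, 0)],
    [(Fd2, 0), (Fc4, 0), (Fa2, 0), (Fc3, 0), (Fb2, 0), (Fb1, 0), (Fc2, 0), (Fa1, 0), (Fd1, 0), (Fc1, 0)],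
    [(Fz, 0), (Fc4, 0), (Fa2, 0), (Fc3, 0), (Fb2, 0), (Fb1, 0), (Fc2, 0), (Fa1, 0), (Fd1, 0), (Fc1, 0)],
    [(Fb3, 0), (Fc4, 0), (Fa2, 0), (Fc3, 0), (Fb2, 0), (Fb1, 0), (Fc2, 0), (Fa1, 0), (Fd1, 0), (Fc1, 0)],
    [(Fz, 0), (Fd2, 0), (Fa2, 0), (Fc3, 0), (Fb2, 0), (Fb1, 0), (Fc2, 0), (Fa1, 0), (Fd1, 0), (Fc1, 0)],
    [(Fd1, 1), (Fd2, 0), (Fc4, 0), (Fa2, 0), (Fc3, 0), (Fb2, 0), (Fb1, 0), (Fc2, 0), (Fa1, 0), (Fd1, 0), (Fc1, 0)],
    [(Fz, 0), (Fd2, 0), (Fc4, 0), (Fa2, 0), (Fc3, 0), (Fb2, 0), (Fb1, 0), (Fc2, 0), (Fa1, 0), (Fd1, 0), (Fc1, 0)],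
    [(Fb3, 0), (Fd2, 0), (Fc4, 0), (Fa2, 0), (Fc3, 0), (Fb2, 0), (Fb1, 0), (Fc2, 0), (Fa1, 0), (Fd1, 0), (Fc1, 0)],
    [(Fb3, 0), (Fz, 0), (Fc4, 0), (Fa2, 0), (Fc3, 0), (Fb2, 0), (Fb1, 0), (Fc2, 0), (Fa1, 0), (Fd1, 0), (Fc1, 0)],
    [(Fc1, 1), (Fb3, 0), (Fd2, 0), (Fc4, 0), (Fa2, 0), (Fc3, 0), (Fb2, 0), (Fb1, 0), (Fc2, 0), (Fa1, 0), (Fd1, 0), (Fc1, 0)],
    [(Fd1, 1), (Fz, 0), (Fd2, 0), (Fc4, 0), (Fa2, 0), (Fc3, 0), (Fb2, 0), (Fb1, 0), (Fc2, 0), (Fa1, 0), (Fd1, 0), (Fc1, 0)],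
    [(Fd1, 1), (Fb3, 0), (Fd2, 0), (Fc4, 0), (Fa2, 0), (Fc3, 0), (Fb2, 0), (Fb1, 0), (Fc2, 0), (Fa1, 0), (Fd1, 0), (Fc1, 0)],
    [(Fa1, 1), (Fb3, 0), (Fz, 0), (Fc4, 0), (Fa2, 0), (Fc3, 0), (Fb2, 0), (Fb1, 0), (Fc2, 0), (Fa1, 0), (Fd1, 0), (Fc1, 0)],
    [(Fd1, 1), (Fc1, 1), (Fb3, 0), (Fd2, 0), (Fc4, 0), (Fa2, 0), (Fc3, 0), (Fb2, 0), (Fb1, 0), (Fc2, 0), (Fa1, 0), (Fd1, 0), (Fc1, 0)],
    [(Fc2, 1), (Fd1, 1), (Fc1, 1), (Fb3, 0), (Fd2, 0), (Fc4, 0), (Fa2, 0), (Fc3, 0), (Fb2, 0), (Fb1, 0), (Fc2, 0), (Fa1, 0), (Fd1, 0), (Fc1, 0)],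
    [(Fb2, 1), (Fc2, 1), (Fd1, 1), (Fc1, 1), (Fb3, 0), (Fd2, 0), (Fc4, 0), (Fa2, 0), (Fc3, 0), (Fb2, 0), (Fb1, 0), (Fc2, 0), (Fa1, 0), (Fd1, 0), (Fc1, 0)],
    [(Fa2, 1), (Fb2, 1), (Fc2, 1), (Fd1, 1), (Fc1, 1), (Fb3, 0), (Fd2, 0), (Fc4, 0), (Fa2, 0), (Fc3, 0), (Fb2, 0), (Fb1, 0), (Fc2, 0), (Fa1, 0), (Fd1, 0), (Fc1, 0)],
    [(Fz, 1), (Fa2, 1), (Fb2, 1), (Fc2, 1), (Fd1, 1), (Fc1, 1), (Fb3, 0), (Fd2, 0), (Fc4, 0), (Fa2, 0), (Fc3, 0), (Fb2, 0), (Fb1, 0), (Fc2, 0), (Fa1, 0), (Fd1, 0), (Fc1, 0)]]"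

text \<open>The exceptional column moved to index 0: \<open>Fb2\<close> is the free 2-block in the
  top row, \<open>Fa1\<close> the free 1-block.\<close>

definition f_exc :: "f_letter block list" where
  "f_exc = [(Fb2, 0), (Fc2, 0), (Fa1, 0), (Fd1, 0), (Fc1, 0)]"

text \<open>Six edges are inactive: those at the representatives 14, 15 and 16, the classes
  \<open>y_r F41 j\<close> for colors 2, 3 and 1, whose color differs from that of the
  class.\<close>

definition f_edges :: "f_letter edge list" where
  "f_edges = [
    (0, (Fc1, 0), 1, 0, True), (0, (Fd1, 0), 2, 0, True), (0, (Fa1, 0), 3, 0, True),
    (1, (Fd1, 0), 4, 0, True), (1, (Fa1, 0), 5, 0, True), (2, (Fc1, 0), 4, 0, True),
    (2, (Fa1, 0), 6, 0, True), (3, (Fc1, 0), 5, 0, True), (3, (Fd1, 0), 6, 0, True),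
    (4, (Fa1, 0), 7, 0, True), (4, (Fc2, 0), 8, 0, True), (5, (Fd1, 0), 7, 0, True),
    (5, (Fb1, 0), 9, 0, True), (6, (Fc1, 0), 7, 0, True), (7, (Fc2, 0), 10, 0, True),
    (7, (Fb1, 0), 11, 0, True), (8, (Fa1, 0), 10, 0, True), (8, (Fb2, 0), 12, 0, True),
    (9, (Fd1, 0), 11, 0, True), (9, (Fc3, 0), 13, 0, True), (10, (Fb1, 0), 14, 0, True),
    (11, (Fc2, 0), 14, 0, False), (11, (Fc3, 0), 15, 0, True), (12, (Fa2, 0), 16, 0, True),
    (13, (Fd1, 0), 15, 0, False), (13, (Fd2, 0), 17, 0, True), (14, (Fb2, 0), 18, 0, True),
    (14, (Fc3, 0), 19, 0, False), (15, (Fc2, 0), 19, 0, True), (15, (Fd2, 0), 21, 0, False),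
    (16, (Fa1, 0), 20, 0, True), (16, (Fz, 0), 22, 0, False), (17, (Fd1, 0), 21, 0, True),
    (18, (Fc3, 0), 23, 0, True), (18, (Fa2, 0), 24, 0, True), (19, (Fb2, 0), 23, 0, True),
    (19, (Fd2, 0), 25, 0, True), (20, (Fb1, 0), 24, 0, True), (20, (Fz, 0), 26, 0, True),
    (21, (Fc2, 0), 25, 0, True), (22, (Fa1, 0), 26, 0, True), (23, (Fa2, 0), 27, 0, True),
    (23, (Fc4, 0), 28, 0, True), (23, (Fd2, 0), 29, 0, True), (24, (Fc3, 0), 27, 0, True),
    (24, (Fz, 0), 30, 0, True), (25, (Fb2, 0), 29, 0, True), (26, (Fb1, 0), 30, 0, True),
    (27, (Fc4, 0), 31, 0, True), (27, (Fd2, 0), 32, 0, True), (27, (Fz, 0), 33, 0, True),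
    (28, (Fa2, 0), 31, 0, True), (28, (Fd2, 0), 34, 0, True), (29, (Fa2, 0), 32, 0, True),
    (29, (Fc4, 0), 34, 0, True), (30, (Fc3, 0), 33, 0, True), (31, (Fd2, 0), 36, 0, True),
    (31, (Fz, 0), 37, 0, True), (31, (Fb3, 0), 38, 0, True), (32, (Fc4, 0), 36, 0, True),
    (32, (Fz, 0), 39, 0, True), (33, (Fc4, 0), 37, 0, True), (33, (Fd2, 0), 39, 0, True),
    (34, (Fa2, 0), 36, 0, True), (34, (Fd1, 1), 35, 0, True), (35, (Fa2, 0), 40, 0, True),
    (36, (Fz, 0), 41, 0, True), (36, (Fb3, 0), 42, 0, True), (36, (Fd1, 1), 40, 0, True),
    (37, (Fd2, 0), 41, 0, True), (37, (Fb3, 0), 43, 0, True), (38, (Fd2, 0), 42, 0, True),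
    (38, (Fz, 0), 43, 0, True), (39, (Fc4, 0), 41, 0, True), (40, (Fz, 0), 45, 0, True),
    (40, (Fb3, 0), 46, 0, True), (41, (Fb3, 0), 0, 1, True), (41, (Fd1, 1), 45, 0, True),
    (42, (Fz, 0), 0, 1, True), (42, (Fc1, 1), 44, 0, True), (42, (Fd1, 1), 46, 0, True),
    (43, (Fd2, 0), 0, 1, True), (43, (Fa1, 1), 47, 0, True), (44, (Fz, 0), 1, 1, True),
    (44, (Fd1, 1), 48, 0, True), (45, (Fb3, 0), 2, 1, True), (46, (Fz, 0), 2, 1, True),
    (46, (Fc1, 1), 48, 0, True), (47, (Fd2, 0), 3, 1, True), (48, (Fz, 0), 4, 1, True),
    (48, (Fc2, 1), 49, 0, True), (49, (Fz, 0), 8, 1, True), (49, (Fb2, 1), 50, 0, True),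
    (50, (Fz, 0), 12, 1, True), (50, (Fa2, 1), 51, 0, True), (51, (Fz, 0), 16, 1, False),
    (51, (Fz, 1), 52, 0, True), (52, (Fz, 0), 22, 1, True)]"

fun f_eps :: "idx \<Rightarrow> nat list" where
  "f_eps I0 = [
    1, 1, 1, 0, 1, 0, 0, 0, 1, 0, 0, 0, 1, 0, 0, 0, 0, 0, 0, 0, 0, 0, 2, 0, 0, 0, 1, 0, 0, 0,
    1, 0, 0, 1, 0, 0, 0, 1, 0, 1, 0, 1, 0, 1, 0, 1, 0, 0, 0, 0, 0, 0, 1]"
| "f_eps I1 = [
    0, 0, 0, 1, 0, 1, 1, 1, 0, 0, 1, 0, 0, 0, 0, 0, 1, 0, 0, 0, 2, 0, 0, 0, 1, 0, 1, 1, 0, 0,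
    0, 1, 1, 0, 0, 0, 1, 0, 0, 0, 1, 0, 0, 0, 0, 0, 0, 1, 0, 0, 0, 1, 0]"
| "f_eps I2 = [
    1, 0, 1, 0, 0, 0, 0, 0, 0, 1, 0, 1, 1, 0, 1, 0, 0, 0, 2, 0, 0, 0, 0, 1, 1, 0, 0, 0, 0, 1,
    1, 0, 0, 0, 0, 0, 0, 0, 1, 0, 0, 0, 1, 1, 0, 0, 1, 0, 0, 0, 1, 0, 0]"
| "f_eps I3 = [
    0, 1, 0, 0, 1, 1, 0, 1, 2, 0, 2, 0, 0, 1, 0, 1, 0, 0, 0, 2, 0, 0, 0, 1, 0, 1, 0, 1, 2, 0,
    0, 2, 0, 1, 1, 0, 1, 2, 0, 0, 0, 1, 0, 0, 1, 0, 0, 0, 1, 2, 0, 0, 0]"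
| "f_eps I4 = [
    1, 0, 2, 1, 1, 0, 2, 1, 0, 0, 0, 1, 0, 0, 0, 0, 0, 1, 0, 0, 0, 2, 0, 0, 0, 1, 0, 0, 0, 1,
    0, 0, 1, 0, 1, 2, 1, 0, 0, 1, 2, 1, 1, 0, 0, 2, 2, 0, 1, 0, 0, 0, 0]"

fun f_phi :: "idx \<Rightarrow> nat list" where
  "f_phi I0 = [
    0, 0, 0, 0, 0, 0, 0, 0, 0, 0, 0, 0, 0, 0, 0, 0, 0, 0, 0, 0, 1, 0, 0, 0, 1, 0, 0, 1, 0, 0,
    0, 1, 1, 0, 0, 0, 1, 0, 1, 0, 1, 0, 1, 0, 1, 0, 1, 0, 1, 1, 1, 2, 1]"
| "f_phi I1 = [
    1, 1, 1, 0, 1, 0, 0, 0, 1, 0, 0, 0, 2, 0, 0, 0, 1, 0, 1, 0, 0, 0, 1, 1, 0, 0, 0, 0, 1, 1,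
    0, 0, 0, 0, 1, 1, 0, 0, 0, 0, 0, 0, 0, 1, 0, 0, 0, 0, 0, 0, 1, 0, 0]"
| "f_phi I2 = [
    0, 0, 0, 0, 0, 1, 0, 1, 1, 0, 2, 0, 0, 0, 1, 0, 0, 0, 0, 1, 1, 0, 0, 0, 0, 1, 1, 0, 0, 0,
    0, 1, 0, 0, 0, 0, 1, 1, 0, 0, 1, 1, 0, 0, 0, 1, 0, 0, 0, 1, 0, 0, 0]"
| "f_phi I3 = [
    1, 0, 2, 1, 1, 0, 2, 1, 0, 1, 0, 2, 0, 0, 0, 1, 0, 0, 2, 0, 0, 1, 0, 1, 2, 0, 0, 1, 0, 1,
    2, 0, 1, 1, 0, 0, 0, 0, 0, 1, 0, 0, 1, 0, 0, 0, 2, 0, 1, 0, 0, 0, 0]"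
| "f_phi I4 = [
    1, 1, 0, 1, 0, 1, 0, 0, 0, 1, 0, 0, 0, 2, 0, 0, 0, 1, 0, 1, 0, 0, 0, 1, 0, 0, 0, 1, 2, 0,
    0, 2, 0, 1, 1, 0, 1, 2, 2, 0, 0, 1, 1, 2, 1, 0, 0, 2, 0, 0, 0, 0, 0]"

definition f_energy :: "nat list list" where
  "f_energy = [
    [1,1,1,1,1,1,1,1,1,1,1,1,1,1,1,1,1,0,1,1,1,0,2,1,1,0,2,1,1,0,2,1,0,2,0,0,0,2,1,1,0,1,0,2,0,1,0,1,0,0,0,0,1],
    [1,1,1,1,1,1,1,1,1,1,1,1,1,1,1,1,1,0,1,1,1,0,2,1,1,0,2,1,1,0,2,1,0,2,0,0,0,2,1,1,0,1,0,2,0,1,0,1,0,0,0,0,1],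
    [2,1,2,1,1,1,1,1,1,1,1,1,1,1,1,1,1,1,1,1,1,1,2,1,1,1,2,1,1,1,2,1,1,2,1,1,1,2,1,2,1,2,1,2,0,2,1,1,0,0,0,0,1],
    [1,1,1,1,1,1,1,1,1,1,1,1,1,1,1,1,1,0,1,1,1,0,2,1,1,0,2,1,1,0,2,1,0,2,0,0,0,2,1,1,0,1,0,2,0,1,0,2,0,0,0,0,1],
    [2,1,2,1,1,1,1,1,1,1,1,1,1,1,1,1,1,1,1,1,1,1,2,1,1,1,2,1,1,1,2,1,1,2,1,1,1,2,1,2,1,2,1,2,0,2,1,1,0,0,0,0,1],
    [1,1,1,1,1,1,1,1,1,1,1,1,1,1,1,1,1,0,1,1,1,0,2,1,1,0,2,1,1,0,2,1,0,2,0,0,0,2,1,1,0,1,0,2,0,1,0,2,0,0,0,0,1],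
    [2,1,2,2,1,1,2,1,1,1,1,1,1,1,1,1,1,1,1,1,1,1,2,1,1,1,2,1,1,1,2,1,1,2,1,1,1,2,1,2,1,2,1,2,0,2,1,2,0,0,0,0,1],
    [2,1,2,2,1,1,2,1,1,1,1,1,1,1,1,1,1,1,1,1,1,1,2,1,1,1,2,1,1,1,2,1,1,2,1,1,1,2,1,2,1,2,1,2,0,2,1,2,0,0,0,0,1],
    [2,2,2,1,2,1,1,1,2,1,1,1,1,1,1,1,1,1,1,1,1,1,2,1,1,1,2,1,1,1,2,1,1,2,1,1,1,2,1,2,1,2,1,2,1,2,1,1,1,1,0,0,1],
    [1,1,1,1,1,1,1,1,1,1,1,1,1,1,1,1,1,0,1,1,1,0,2,1,1,0,2,1,1,0,2,1,0,2,0,0,0,2,1,1,0,1,0,2,0,1,0,2,0,0,0,0,1],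
    [2,2,2,2,2,2,2,2,2,1,2,1,1,1,1,1,1,1,1,1,1,1,2,1,1,1,2,1,1,1,2,1,1,2,1,1,1,2,1,2,1,2,1,2,1,2,1,2,1,1,0,0,1],
    [2,1,2,2,1,1,2,1,1,1,1,1,1,1,1,1,1,1,1,1,1,1,2,1,1,1,2,1,1,1,2,1,1,2,1,1,1,2,1,2,1,2,1,2,0,2,1,2,0,0,0,0,1],
    [2,2,2,1,2,1,1,1,2,1,1,1,2,1,1,1,1,1,1,1,1,1,2,1,1,1,2,1,1,1,2,1,1,2,1,1,1,2,1,2,1,2,1,2,1,2,1,1,1,1,1,0,1],
    [1,1,1,1,1,1,1,1,1,1,1,1,1,1,1,1,1,0,1,1,1,0,2,1,1,0,2,1,1,0,2,1,0,2,0,0,0,2,1,1,0,1,0,2,0,1,0,2,0,0,0,0,1],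
    [2,2,2,2,2,2,2,2,2,1,2,1,1,1,1,1,1,1,1,1,1,1,2,1,1,1,2,1,1,1,2,1,1,2,1,1,1,2,1,2,1,2,1,2,1,2,1,2,1,1,0,0,1],
    [2,1,2,2,1,1,2,1,1,1,1,1,1,1,1,1,1,1,1,1,1,1,2,1,1,1,2,1,1,1,2,1,1,2,1,1,1,2,1,2,1,2,1,2,0,2,1,2,0,0,0,0,1],
    [2,2,2,1,2,1,1,1,2,1,1,1,2,1,1,1,1,1,1,1,1,1,2,1,1,1,2,1,1,1,2,1,1,2,1,1,1,2,1,2,1,2,1,2,1,2,1,1,1,1,1,0,1],
    [1,1,1,1,1,1,1,1,1,1,1,1,1,1,1,1,1,0,1,1,1,0,2,1,1,0,2,1,1,0,2,1,0,2,0,0,0,2,1,1,0,1,0,2,0,1,0,2,0,0,0,0,1],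
    [2,2,2,2,2,2,2,2,2,2,2,2,2,1,2,1,1,1,2,1,1,1,2,1,1,1,2,1,1,1,2,1,1,2,1,1,1,2,1,2,1,2,1,2,1,2,1,2,1,1,1,0,1],
    [2,2,2,2,2,2,2,2,2,1,2,1,1,1,1,1,1,1,1,1,1,1,2,1,1,1,2,1,1,1,2,1,1,2,1,1,1,2,1,2,1,2,1,2,1,2,1,2,1,1,0,0,1],
    [2,2,2,2,2,2,2,2,2,1,2,1,2,1,1,1,2,1,1,1,2,1,2,1,1,1,2,1,1,1,2,1,1,2,1,1,1,2,1,2,1,2,1,2,1,2,1,2,1,1,1,1,1],
    [2,1,2,2,1,1,2,1,1,1,1,1,1,1,1,1,1,1,1,1,1,1,2,1,1,1,2,1,1,1,2,1,1,2,1,1,1,2,1,2,1,2,1,2,0,2,1,2,0,0,0,0,1],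
    [1,1,1,0,1,0,0,0,1,0,0,0,1,0,0,0,0,0,0,0,0,0,2,0,0,0,1,0,0,0,1,0,0,1,0,0,0,1,0,1,0,1,0,1,0,1,0,0,0,0,0,0,1],
    [2,2,2,2,2,2,2,2,2,2,2,2,2,1,2,1,1,1,2,1,1,1,2,1,1,1,2,1,1,1,2,1,1,2,1,1,1,2,1,2,1,2,1,2,1,2,1,2,1,1,1,0,1],
    [2,2,2,2,2,2,2,2,2,2,2,2,2,1,2,1,2,1,2,1,2,1,2,1,2,1,2,1,1,1,2,1,1,2,1,1,1,2,1,2,1,2,1,2,1,2,1,2,1,1,1,1,1],
    [2,2,2,2,2,2,2,2,2,1,2,1,1,1,1,1,1,1,1,1,1,1,2,1,1,1,2,1,1,1,2,1,1,2,1,1,1,2,1,2,1,2,1,2,1,2,1,2,1,1,0,0,1],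
    [1,1,1,1,1,1,1,1,1,0,1,0,1,0,0,0,1,0,0,0,1,0,2,0,0,0,2,0,0,0,1,0,0,1,0,0,0,1,0,1,0,1,0,1,0,1,0,1,0,0,0,0,1],
    [2,2,2,2,2,2,2,2,2,2,2,2,2,1,2,1,2,1,2,1,2,1,2,1,2,1,2,1,1,1,2,1,1,2,1,1,1,2,1,2,1,2,1,2,1,2,1,2,1,1,1,1,1],
    [2,2,2,2,2,2,2,2,2,2,2,2,2,2,2,2,1,1,2,2,1,1,2,2,1,1,2,1,2,1,2,1,1,2,1,1,1,2,1,2,1,2,1,2,1,2,1,2,1,1,1,0,1],
    [2,2,2,2,2,2,2,2,2,2,2,2,2,1,2,1,1,1,2,1,1,1,2,1,1,1,2,1,1,1,2,1,1,2,1,1,1,2,1,2,1,2,1,2,1,2,1,2,1,1,1,0,1],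
    [1,1,1,1,1,1,1,1,1,1,1,1,1,0,1,0,1,0,1,0,1,0,2,0,1,0,2,0,0,0,2,0,0,1,0,0,0,1,0,1,0,1,0,1,0,1,0,1,0,0,0,0,1],
    [2,2,2,2,2,2,2,2,2,2,2,2,2,2,2,2,2,1,2,2,2,1,2,2,2,1,2,2,2,1,2,2,1,2,1,1,1,2,1,2,1,2,1,2,1,2,1,2,1,1,1,1,1],
    [2,2,2,2,2,2,2,2,2,2,2,2,2,1,2,1,2,1,2,1,2,1,2,1,2,1,2,1,1,1,2,1,1,2,1,1,1,2,1,2,1,2,1,2,1,2,1,2,1,1,1,1,1],
    [1,1,1,1,1,1,1,1,1,1,1,1,1,0,1,0,1,0,1,0,1,0,2,0,1,0,2,0,0,0,2,0,0,1,0,0,0,1,0,1,0,1,0,1,0,1,0,1,0,0,0,0,1],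
    [2,2,2,2,2,2,2,2,2,2,2,2,2,2,2,2,1,1,2,2,1,1,2,2,1,1,2,1,2,1,2,1,1,2,1,1,1,2,1,2,1,2,1,2,1,2,1,2,1,1,1,0,1],
    [2,2,2,2,2,2,2,2,2,2,2,2,2,2,2,2,1,2,2,2,1,2,2,2,1,2,2,1,2,2,2,1,1,2,2,2,1,2,1,2,1,2,1,2,1,2,1,2,1,1,1,0,1],
    [2,2,2,2,2,2,2,2,2,2,2,2,2,2,2,2,2,1,2,2,2,1,2,2,2,1,2,2,2,1,2,2,1,2,1,1,1,2,1,2,1,2,1,2,1,2,1,2,1,1,1,1,1],
    [1,1,1,1,1,1,1,1,1,1,1,1,1,1,1,1,1,0,1,1,1,0,2,1,1,0,2,1,1,0,2,1,0,2,0,0,0,2,0,1,0,1,0,1,0,1,0,1,0,0,0,0,1],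
    [2,2,2,2,2,2,2,2,2,2,2,2,2,2,2,2,2,1,2,2,2,1,2,2,2,1,2,2,2,1,2,2,1,2,1,1,1,2,2,2,1,2,1,2,1,2,1,2,1,1,1,1,1],
    [1,1,1,1,1,1,1,1,1,1,1,1,1,0,1,0,1,0,1,0,1,0,2,0,1,0,2,0,0,0,2,0,0,1,0,0,0,1,0,1,0,1,0,1,0,1,0,1,0,0,0,0,1],
    [2,2,2,2,2,2,2,2,2,2,2,2,2,2,2,2,2,2,2,2,2,2,2,2,2,2,2,2,2,2,2,2,2,2,2,2,2,2,1,2,2,2,1,2,1,2,1,2,1,1,1,1,1],
    [1,1,1,1,1,1,1,1,1,1,1,1,1,1,1,1,1,0,1,1,1,0,2,1,1,0,2,1,1,0,2,1,0,2,0,0,0,2,0,1,0,1,0,1,0,1,0,1,0,0,0,0,1],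
    [2,2,2,2,2,2,2,2,2,2,2,2,2,2,2,2,2,1,2,2,2,1,2,2,2,1,2,2,2,1,2,2,1,2,1,1,1,2,2,2,1,2,1,2,1,2,1,2,1,1,1,1,1],
    [1,1,1,1,1,1,1,1,1,1,1,1,1,1,1,1,1,0,1,1,1,0,2,1,1,0,2,1,1,0,2,1,0,2,0,0,0,2,1,1,0,1,0,2,0,1,0,1,0,0,0,0,1],
    [2,2,2,2,2,2,2,2,2,2,2,2,2,2,2,2,2,1,2,2,2,1,2,2,2,1,2,2,2,1,2,2,1,2,1,1,1,2,2,2,1,2,1,2,1,2,1,2,1,1,1,1,1],
    [1,1,1,1,1,1,1,1,1,1,1,1,1,1,1,1,1,1,1,1,1,1,2,1,1,1,2,1,1,1,2,1,1,2,1,1,1,2,0,2,1,2,0,1,0,2,0,1,0,0,0,0,1],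
    [2,2,2,2,2,2,2,2,2,2,2,2,2,2,2,2,2,2,2,2,2,2,2,2,2,2,2,2,2,2,2,2,2,2,2,2,2,2,2,2,2,2,2,2,1,2,2,2,1,1,1,1,1],
    [1,1,1,1,1,1,1,1,1,1,1,1,1,1,1,1,1,0,1,1,1,0,2,1,1,0,2,1,1,0,2,1,0,2,0,0,0,2,1,1,0,1,0,2,0,1,0,2,0,0,0,0,1],
    [2,2,2,2,2,2,2,2,2,2,2,2,2,2,2,2,2,2,2,2,2,2,2,2,2,2,2,2,2,2,2,2,2,2,2,2,2,2,2,2,2,2,2,2,1,2,2,2,1,1,1,1,1],
    [2,2,2,2,2,2,2,2,2,2,2,2,2,2,2,2,2,2,2,2,2,2,2,2,2,2,2,2,2,2,2,2,2,2,2,2,2,2,2,2,2,2,2,2,2,2,2,2,2,2,1,1,1],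
    [2,2,2,2,2,2,2,2,2,2,2,2,2,2,2,2,2,2,2,2,2,2,2,2,2,2,2,2,2,2,2,2,2,2,2,2,2,2,2,2,2,2,2,2,2,2,2,2,2,2,2,1,1],
    [2,2,2,2,2,2,2,2,2,2,2,2,2,2,2,2,2,2,2,2,2,2,2,2,2,2,2,2,2,2,2,2,2,2,2,2,2,2,2,2,2,2,2,2,2,2,2,2,2,2,2,2,1],
    [1,1,1,1,1,1,1,1,1,1,1,1,1,1,1,1,1,1,1,1,1,1,1,1,1,1,1,1,1,1,1,1,1,1,1,1,1,1,1,1,1,1,1,1,1,1,1,1,1,1,1,1,0]]"

fun f_special :: "idx \<Rightarrow> nat option" where
  "f_special I0 = None"
| "f_special I1 = Some 16"
| "f_special I2 = Some 14"
| "f_special I3 = Some 15"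
| "f_special I4 = Some 17"

definition f_vac :: nat where
  "f_vac = 52"

definition f_letters :: "f_letter list" where
  "f_letters = [Fc1, Fd1, Fa1, Fc2, Fb1, Fb2, Fc3, Fa2, Fc4, Fd2, Fz, Fb3]"

fun f_supports :: "f_letter \<Rightarrow> f_letter block list" where
  "f_supports Fc1 = [(Fb3, -1), (Fc4, -1), (Fd2, -1)]"
| "f_supports Fd1 = [(Fc4, -1), (Fd2, -1)]"
| "f_supports Fa1 = [(Fz, -1), (Fb3, -1)]"
| "f_supports Fc2 = [(Fc1, 0), (Fd1, 0)]"
| "f_supports Fb1 = [(Fc1, 0), (Fa1, 0)]"
| "f_supports Fb2 = [(Fc2, 0)]"
| "f_supports Fc3 = [(Fb1, 0)]"
| "f_supports Fa2 = [(Fb2, 0)]"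
| "f_supports Fc4 = [(Fb2, 0), (Fc3, 0)]"
| "f_supports Fd2 = [(Fc3, 0)]"
| "f_supports Fz = [(Fa2, 0)]"
| "f_supports Fb3 = [(Fa2, 0), (Fc4, 0)]"

definition f_bottom :: "f_letter block list" where
  "f_bottom = [(Fc1, 0), (Fd1, 0), (Fa1, 0), (Fc2, 0), (Fb1, 0), (Fb2, 0), (Fc3, 0), (Fa2, 0), (Fc4, 0), (Fb3, 0)]"

section \<open>Verification of the tables of type F_4^(1)\<close>

lemma f_letters: "set f_letters = UNIV"
  unfolding f_letters_def by (auto intro: f_letter.exhaust)

lemma f_base_eq: "f_base = base f_bottom"
proof (rule set_eqI)
  fix x :: "f_letter block"
  show "x \<in> f_base \<longleftrightarrow> x \<in> base f_bottom"
    by (cases x; cases "fst x") (auto simp: f_base_def base_def f_bottom_def)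
qed

lemma f_base_Un:
  assumes "same_set (f_bottom @ M) L"
  shows "f_base \<union> set M = base L"
  using assms by (auto simp: f_base_eq base_def same_set_def)

lemma F41_simps:
  "cartan F41 = cartan_F41" "lcolor F41 = f_color" "lrow F41 = f_row" "lsupp F41 = f_supp" "rep_r F41 = f_rep_r"
  by (simp_all add: F41_def)

lemma f_rep_r_eq: "f_rep_r j = map_option (\<lambda>n. base (raised f_letters (f_reps ! n))) (f_special j)"
proof (cases j)
  case I1
  have "same_set (f_bottom @ [(Fz, 0), (Fd2, 0), (Fc1, 1), (Fd1, 1), (Fc2, 1), (Fb2, 1), (Fa2, 1)])
      (raised f_letters (f_reps ! 16))"
    by code_simp
  from f_base_Un[OF this] show ?thesis by (simp add: I1)
next
  case I2
  have "same_set (f_bottom @ [(Fz, 0), (Fa1, 1), (Fb1, 1), (Fd2, 0), (Fc1, 1), (Fd1, 1), (Fc2, 1)])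
      (raised f_letters (f_reps ! 14))"
    by code_simp
  from f_base_Un[OF this] show ?thesis by (simp add: I2)
next
  case I3
  have "same_set (f_bottom @ [(Fz, 0), (Fa1, 1), (Fb1, 1), (Fc3, 1), (Fd2, 0), (Fc1, 1), (Fd1, 1)])
      (raised f_letters (f_reps ! 15))"
    by code_simp
  from f_base_Un[OF this] show ?thesis by (simp add: I3)
next
  case I4
  have "same_set (f_bottom @ [(Fz, 0), (Fa1, 1), (Fb1, 1), (Fc3, 1), (Fd2, 1), (Fd2, 0), (Fc1, 1)])
      (raised f_letters (f_reps ! 17))"
    by code_simp
  from f_base_Un[OF this] show ?thesis by (simp add: I4)
qed simp_all

lemma rep_empty_F41: "rep_empty F41 = base (f_reps ! f_vac)"
proof -
  have "same_set (f_bottom @ [(Fd2, 0), (Fc1, 1), (Fd1, 1), (Fc2, 1), (Fb2, 1), (Fa2, 1), (Fz, 1)]) (f_reps ! f_vac)"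
    by code_simp
  from f_base_Un[OF this] show ?thesis by (simp add: F41_def)
qed

interpretation f41: column_table F41 f_letters f_supports f_reps f_exc f_edges f_eps f_phi f_energy
  f_special f_vac
proof
  show "set f_letters = UNIV" by (fact f_letters)
  show "lsupp F41 l = set (f_supports l)" for l unfolding F41_simps by (cases l) simp_all
  show "pattern_check f_letters f_supports (lrow F41)" unfolding F41_simps by code_simp
  show "ideals_check f_letters f_supports (f_exc # f_reps)" by code_simp
  show "\<forall>L\<in>set (f_exc # f_reps). rep_check f_letters f_supports L" by code_simp
  show "exceptional_list f_letters f_supports (lcolor F41) (lrow F41) f_exc"
    unfolding F41_simps by code_simp
  show "\<forall>L\<in>set f_reps. \<not> exceptional_list f_letters f_supports (lcolor F41) (lrow F41) L"
    unfolding F41_simps by code_simp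
  show "distinct f_reps" by code_simp
  show "edge_check f_letters f_reps f_edges" by code_simp
  show "complete_check f_letters f_supports f_reps f_exc f_edges" by code_simp
  show "crystal_check (lcolor F41) (lrow F41) f_special f_edges"
    unfolding F41_simps by code_simp
  show "string_check (length f_reps) (lcolor F41) f_eps f_phi f_edges"
    unfolding F41_simps by code_simp
  show "weight_check (cartan F41) (lcolor F41) f_letters f_reps f_vac f_eps f_phi"
    unfolding F41_simps by code_simp
  show "energy_check (length f_reps) (lcolor F41) f_eps f_phi f_energy f_edges"
    unfolding F41_simps by code_simp
  show "rep_r F41 j = map_option (\<lambda>n. base (raised f_letters (f_reps ! n))) (f_special j)" for j
    unfolding F41_simps by (fact f_rep_r_eq)
  have N: "length f_reps = 53" by code_simp
  show "n < length f_reps" if "f_special j = Some n" for j n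
    using that by (cases j) (auto simp: N)
  show "f_vac < length f_reps" "f_energy ! f_vac ! f_vac = 0" by code_simp+
  show "rep_empty F41 = base (f_reps ! f_vac)" by (fact rep_empty_F41)
  show "f_phi i ! f_vac = of_bool (i = I0)" "f_eps i ! f_vac = of_bool (i = I0)" for i
    by (cases i; simp only:; code_simp)+
qed

theorem theorem5p2:
  shows "(\<forall>g \<in> y_empty E62.
            affine_crystal (cartan E62) (proper_walls E62 g)
              (wall_wt E62 (fund_weight I0) g) (wall_E E62) (wall_F E62) (wall_eps E62) (wall_phi E62))
       \<and> (\<forall>g \<in> y_empty F41.
            affine_crystal (cartan F41) (proper_walls F41 g)
              (wall_wt F41 (fund_weight I0) g) (wall_E F41) (wall_F F41) (wall_eps F41) (wall_phi F41))"
  by (intro conjI ballI column_crystal.proper_walls_crystal e62.column_crystal f41.column_crystal)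

end
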